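(* Let $T$ be a complete, model complete o-minimal theory extending $\mathrm{RCF}$ in a language $L$. Let $\mathcal M\models T$, let $\delta$ be a $T$-derivation on $\mathcal M$, and let $C=\{a\in M:\delta a=0\}$ be the constant field of $(\mathcal M,\delta)$. Then $C$ is the underlying set of an elementary $L$-substructure of $\mathcal M$.
   Context: $L$ extends the language of ordered rings; $M$ is the underlying set of $\mathcal M$. A map $\delta:M\to M$ is a $T$-derivation on $\mathcal M$ if for every $n$, every open $U\subseteq M^n$ and every $\mathcal C^1$-function $f:U\to M$ which is definable in $\mathcal M$ by an $L$-formula without parameters, we have $\delta f(\bar u)=\mathbf J_f(\bar u)\,\delta\bar u$ for all $\bar u\in U$, where $\mathbf J_f$ is the Jacobian matrix and $\delta\bar u=(\delta u_1,\dots,\delta u_n)$. *)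

theory Defs
  imports Main
begin

section \<open>First-order logic\<close>

text \<open>The symbols of a language are the arguments on which its two arity maps are defined.\<close>

record ('f, 'r) lang =
  fun_ar :: "'f \<rightharpoonup> nat"
  rel_ar :: "'r \<rightharpoonup> nat"

datatype 'f tm = Var nat | App 'f "'f tm list"

datatype ('f, 'r) fm =
    FEq "'f tm" "'f tm"
  | FRel 'r "'f tm list"
  | FNot "('f, 'r) fm"
  | FAnd "('f, 'r) fm" "('f, 'r) fm"
  | FEx nat "('f, 'r) fm"

definition FOr :: "('f, 'r) fm \<Rightarrow> ('f, 'r) fm \<Rightarrow> ('f, 'r) fm" where
  "FOr p q = FNot (FAnd (FNot p) (FNot q))"

definition FImp :: "('f, 'r) fm \<Rightarrow> ('f, 'r) fm \<Rightarrow> ('f, 'r) fm" where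
  "FImp p q = FNot (FAnd p (FNot q))"

definition FAll :: "nat \<Rightarrow> ('f, 'r) fm \<Rightarrow> ('f, 'r) fm" where
  "FAll x p = FNot (FEx x (FNot p))"

fun is_term :: "('f, 'r) lang \<Rightarrow> 'f tm \<Rightarrow> bool" where
  "is_term L (Var x) \<longleftrightarrow> True"
| "is_term L (App f ts) \<longleftrightarrow> fun_ar L f = Some (length ts) \<and> (\<forall>t\<in>set ts. is_term L t)"

fun is_formula :: "('f, 'r) lang \<Rightarrow> ('f, 'r) fm \<Rightarrow> bool" where
  "is_formula L (FEq s t) \<longleftrightarrow> is_term L s \<and> is_term L t"
| "is_formula L (FRel r ts) \<longleftrightarrow> rel_ar L r = Some (length ts) \<and> (\<forall>t\<in>set ts. is_term L t)"
| "is_formula L (FNot p) \<longleftrightarrow> is_formula L p"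
| "is_formula L (FAnd p q) \<longleftrightarrow> is_formula L p \<and> is_formula L q"
| "is_formula L (FEx x p) \<longleftrightarrow> is_formula L p"

fun tm_vars :: "'f tm \<Rightarrow> nat set" where
  "tm_vars (Var x) = {x}"
| "tm_vars (App f ts) = (\<Union>t\<in>set ts. tm_vars t)"

fun fm_vars :: "('f, 'r) fm \<Rightarrow> nat set" where
  "fm_vars (FEq s t) = tm_vars s \<union> tm_vars t"
| "fm_vars (FRel r ts) = (\<Union>t\<in>set ts. tm_vars t)"
| "fm_vars (FNot p) = fm_vars p"
| "fm_vars (FAnd p q) = fm_vars p \<union> fm_vars q"
| "fm_vars (FEx x p) = fm_vars p - {x}"

definition is_sentence :: "('f, 'r) lang \<Rightarrow> ('f, 'r) fm \<Rightarrow> bool" where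
  "is_sentence L p \<longleftrightarrow> is_formula L p \<and> fm_vars p = {}"

text \<open>The values of the interpretations off the carrier, at argument lists of the wrong length,
  and at symbols outside the language are irrelevant.\<close>

record ('f, 'r, 'u) struct =
  carrier :: "'u set"
  fun_int :: "'f \<Rightarrow> 'u list \<Rightarrow> 'u"
  rel_int :: "'r \<Rightarrow> 'u list \<Rightarrow> bool"

definition tuples :: "('f, 'r, 'u) struct \<Rightarrow> nat \<Rightarrow> 'u list set" where
  "tuples M n = {u. length u = n \<and> set u \<subseteq> carrier M}"

definition is_struct :: "('f, 'r) lang \<Rightarrow> ('f, 'r, 'u) struct \<Rightarrow> bool" where
  "is_struct L M \<longleftrightarrow> carrier M \<noteq> {} \<and>
     (\<forall>f n. fun_ar L f = Some n \<longrightarrow> (\<forall>u\<in>tuples M n. fun_int M f u \<in> carrier M))"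

fun eval :: "('f, 'r, 'u) struct \<Rightarrow> (nat \<Rightarrow> 'u) \<Rightarrow> 'f tm \<Rightarrow> 'u" where
  "eval M e (Var x) = e x"
| "eval M e (App f ts) = fun_int M f (map (eval M e) ts)"

fun sat :: "('f, 'r, 'u) struct \<Rightarrow> (nat \<Rightarrow> 'u) \<Rightarrow> ('f, 'r) fm \<Rightarrow> bool" where
  "sat M e (FEq s t) \<longleftrightarrow> eval M e s = eval M e t"
| "sat M e (FRel r ts) \<longleftrightarrow> rel_int M r (map (eval M e) ts)"
| "sat M e (FNot p) \<longleftrightarrow> \<not> sat M e p"
| "sat M e (FAnd p q) \<longleftrightarrow> sat M e p \<and> sat M e q"
| "sat M e (FEx x p) \<longleftrightarrow> (\<exists>a\<in>carrier M. sat M (e(x := a)) p)"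

definition holds_in :: "('f, 'r, 'u) struct \<Rightarrow> ('f, 'r) fm \<Rightarrow> bool" where
  "holds_in M p \<longleftrightarrow> (\<forall>e. range e \<subseteq> carrier M \<longrightarrow> sat M e p)"

definition substructure ::
  "('f, 'r) lang \<Rightarrow> ('f, 'r, 'u) struct \<Rightarrow> ('f, 'r, 'u) struct \<Rightarrow> bool" where
  "substructure L N M \<longleftrightarrow> is_struct L N \<and> is_struct L M \<and> carrier N \<subseteq> carrier M \<and>
     (\<forall>f n. fun_ar L f = Some n \<longrightarrow> (\<forall>u\<in>tuples N n. fun_int N f u = fun_int M f u)) \<and>
     (\<forall>r n. rel_ar L r = Some n \<longrightarrow> (\<forall>u\<in>tuples N n. rel_int N r u \<longleftrightarrow> rel_int M r u))"

definition elementary_substructure ::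
  "('f, 'r) lang \<Rightarrow> ('f, 'r, 'u) struct \<Rightarrow> ('f, 'r, 'u) struct \<Rightarrow> bool" where
  "elementary_substructure L N M \<longleftrightarrow> substructure L N M \<and>
     (\<forall>p e. is_formula L p \<longrightarrow> range e \<subseteq> carrier N \<longrightarrow> (sat N e p \<longleftrightarrow> sat M e p))"


section \<open>Theories\<close>

definition is_theory :: "('f, 'r) lang \<Rightarrow> ('f, 'r) fm set \<Rightarrow> bool" where
  "is_theory L T \<longleftrightarrow> (\<forall>p\<in>T. is_sentence L p)"

definition is_model :: "('f, 'r) lang \<Rightarrow> ('f, 'r) fm set \<Rightarrow> ('f, 'r, 'u) struct \<Rightarrow> bool" where
  "is_model L T M \<longleftrightarrow> is_struct L M \<and> (\<forall>p\<in>T. holds_in M p)"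

text \<open>Properties of a theory quantify over all of its models. HOL cannot quantify over types, so
  the type \<open>'u\<close> from which the carriers (arbitrary nonempty subsets of \<open>'u\<close>) are taken is a
  parameter. If the type of formulas embeds into \<open>'u\<close>, then \<open>'u\<close> has at least
  \<open>|L| + \<aleph>\<^sub>0\<close> elements and, by the downward Loewenheim-Skolem theorem,
  entailment, completeness, model completeness and o-minimality of a theory have their
  absolute meaning, independent of \<open>'u\<close>.\<close>

definition entails ::
  "'u itself \<Rightarrow> ('f, 'r) lang \<Rightarrow> ('f, 'r) fm set \<Rightarrow> ('f, 'r) fm \<Rightarrow> bool" where
  "entails _ L T p \<longleftrightarrow> (\<forall>M :: ('f, 'r, 'u) struct. is_model L T M \<longrightarrow> holds_in M p)"

definition complete_theory :: "'u itself \<Rightarrow> ('f, 'r) lang \<Rightarrow> ('f, 'r) fm set \<Rightarrow> bool" where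
  "complete_theory U L T \<longleftrightarrow> (\<exists>M :: ('f, 'r, 'u) struct. is_model L T M) \<and>
     (\<forall>p. is_sentence L p \<longrightarrow> entails U L T p \<or> entails U L T (FNot p))"

definition model_complete :: "'u itself \<Rightarrow> ('f, 'r) lang \<Rightarrow> ('f, 'r) fm set \<Rightarrow> bool" where
  "model_complete _ L T \<longleftrightarrow> (\<forall>N M :: ('f, 'r, 'u) struct.
     is_model L T N \<longrightarrow> is_model L T M \<longrightarrow> substructure L N M \<longrightarrow>
     elementary_substructure L N M)"


section \<open>The language of ordered rings and real closed fields\<close>

text \<open>An extension of the language of ordered rings has function symbols \<open>0, 1, +, -, \<cdot>\<close>
  (with unary \<open>-\<close>), the relation symbol \<open><\<close>, and possibly symbols
  \<open>XFun a\<close>, \<open>XRel b\<close>.\<close>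

datatype 'a oring_fun = RZero | ROne | RAdd | RNeg | RMul | XFun 'a
datatype 'b oring_rel = RLess | XRel 'b

definition extends_oring :: "('a oring_fun, 'b oring_rel) lang \<Rightarrow> bool" where
  "extends_oring L \<longleftrightarrow>
     fun_ar L RZero = Some 0 \<and> fun_ar L ROne = Some 0 \<and> fun_ar L RAdd = Some 2 \<and>
     fun_ar L RNeg = Some 1 \<and> fun_ar L RMul = Some 2 \<and> rel_ar L RLess = Some 2"

type_synonym ('a, 'b) oring_fm = "('a oring_fun, 'b oring_rel) fm"
type_synonym ('a, 'b, 'u) oring_struct = "('a oring_fun, 'b oring_rel, 'u) struct"

abbreviation (input) "t0 \<equiv> App RZero []"
abbreviation (input) "t1 \<equiv> App ROne []"
abbreviation (input) "tadd s t \<equiv> App RAdd [s, t]"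
abbreviation (input) "tneg s \<equiv> App RNeg [s]"
abbreviation (input) "tmul s t \<equiv> App RMul [s, t]"
abbreviation (input) "fless s t \<equiv> FRel RLess [s, t]"

definition FAlls :: "nat \<Rightarrow> ('f, 'r) fm \<Rightarrow> ('f, 'r) fm" where
  "FAlls n p = foldr FAll [0..<n] p"

definition ordered_field_axioms :: "('a, 'b) oring_fm set" where
  "ordered_field_axioms =
    (let x = Var 0; y = Var 1; z = Var 2 in
     FAlls 3 `
      {FEq (tadd (tadd x y) z) (tadd x (tadd y z)),
       FEq (tadd x y) (tadd y x),
       FEq (tadd x t0) x,
       FEq (tadd x (tneg x)) t0,
       FEq (tmul (tmul x y) z) (tmul x (tmul y z)),
       FEq (tmul x y) (tmul y x),
       FEq (tmul x t1) x,
       FEq (tmul x (tadd y z)) (tadd (tmul x y) (tmul x z)),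
       FNot (FEq t0 t1),
       FImp (FNot (FEq x t0)) (FEx 1 (FEq (tmul x y) t1)),
       FNot (fless x x),
       FImp (FAnd (fless x y) (fless y z)) (fless x z),
       FOr (fless x y) (FOr (FEq x y) (fless y x)),
       FImp (fless x y) (fless (tadd x z) (tadd y z)),
       FImp (FAnd (fless t0 x) (fless t0 y)) (fless t0 (tmul x y))})"

text \<open>With \<open>X\<close> the value of \<open>Var x\<close> and \<open>a\<^sub>i\<close> that of \<open>Var i\<close>, the term
  \<open>monic_tm x n\<close> denotes \<open>X\<^sup>n + a\<^sub>0 X\<^sup>n\<^sup>-\<^sup>1 + \<dots> + a\<^sub>n\<^sub>-\<^sub>1\<close>.\<close>

primrec monic_tm :: "nat \<Rightarrow> nat \<Rightarrow> 'a oring_fun tm" where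
  "monic_tm x 0 = t1"
| "monic_tm x (Suc k) = tadd (tmul (monic_tm x k) (Var x)) (Var k)"

definition RCF :: "('a, 'b) oring_fm set" where
  "RCF = ordered_field_axioms \<union>
     {FAlls 1 (FImp (fless t0 (Var 0)) (FEx 1 (FEq (tmul (Var 1) (Var 1)) (Var 0))))} \<union>
     {FAlls n (FEx n (FEq (monic_tm n n) t0)) | n. odd n}"

definition extends_RCF ::
  "'u itself \<Rightarrow> ('a oring_fun, 'b oring_rel) lang \<Rightarrow> ('a, 'b) oring_fm set \<Rightarrow> bool" where
  "extends_RCF U L T \<longleftrightarrow> (\<forall>p\<in>RCF. entails U L T p)"

definition zero_of :: "('a, 'b, 'u) oring_struct \<Rightarrow> 'u" where
  "zero_of M = fun_int M RZero []"

definition add_of :: "('a, 'b, 'u) oring_struct \<Rightarrow> 'u \<Rightarrow> 'u \<Rightarrow> 'u" where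
  "add_of M x y = fun_int M RAdd [x, y]"

definition neg_of :: "('a, 'b, 'u) oring_struct \<Rightarrow> 'u \<Rightarrow> 'u" where
  "neg_of M x = fun_int M RNeg [x]"

definition mul_of :: "('a, 'b, 'u) oring_struct \<Rightarrow> 'u \<Rightarrow> 'u \<Rightarrow> 'u" where
  "mul_of M x y = fun_int M RMul [x, y]"

definition less_of :: "('a, 'b, 'u) oring_struct \<Rightarrow> 'u \<Rightarrow> 'u \<Rightarrow> bool" where
  "less_of M x y \<longleftrightarrow> rel_int M RLess [x, y]"

definition sub_of :: "('a, 'b, 'u) oring_struct \<Rightarrow> 'u \<Rightarrow> 'u \<Rightarrow> 'u" where
  "sub_of M x y = add_of M x (neg_of M y)"

definition abs_of :: "('a, 'b, 'u) oring_struct \<Rightarrow> 'u \<Rightarrow> 'u" where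
  "abs_of M x = (if less_of M x (zero_of M) then neg_of M x else x)"

definition pos_of :: "('a, 'b, 'u) oring_struct \<Rightarrow> 'u set" where
  "pos_of M = {x \<in> carrier M. less_of M (zero_of M) x}"


section \<open>O-minimality\<close>

text \<open>An endpoint \<open>None\<close> stands for \<open>-\<infinity>\<close> on the left and \<open>+\<infinity>\<close> on the right.\<close>

definition open_interval ::
  "('a, 'b, 'u) oring_struct \<Rightarrow> 'u option \<Rightarrow> 'u option \<Rightarrow> 'u set" where
  "open_interval M a b = {x \<in> carrier M.
     (\<forall>c. a = Some c \<longrightarrow> less_of M c x) \<and> (\<forall>c. b = Some c \<longrightarrow> less_of M x c)}"

definition points_and_intervals :: "('a, 'b, 'u) oring_struct \<Rightarrow> 'u set set" where
  "points_and_intervals M = {{c} | c. c \<in> carrier M} \<union>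
     {open_interval M a b | a b. set_option a \<subseteq> carrier M \<and> set_option b \<subseteq> carrier M}"

text \<open>The parameters of the definition of \<open>X\<close> are the values of \<open>e\<close> at the variables other
  than 0.\<close>

definition definable_subset ::
  "('f, 'r) lang \<Rightarrow> ('f, 'r, 'u) struct \<Rightarrow> 'u set \<Rightarrow> bool" where
  "definable_subset L M X \<longleftrightarrow> (\<exists>p e. is_formula L p \<and> range e \<subseteq> carrier M \<and>
     X = {x \<in> carrier M. sat M (e(0 := x)) p})"

definition o_minimal ::
  "('a oring_fun, 'b oring_rel) lang \<Rightarrow> ('a, 'b, 'u) oring_struct \<Rightarrow> bool" where
  "o_minimal L M \<longleftrightarrow> (\<forall>X. definable_subset L M X \<longrightarrow>
     (\<exists>F. finite F \<and> F \<subseteq> points_and_intervals M \<and> X = \<Union>F))"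

definition o_minimal_theory ::
  "'u itself \<Rightarrow> ('a oring_fun, 'b oring_rel) lang \<Rightarrow> ('a, 'b) oring_fm set \<Rightarrow> bool" where
  "o_minimal_theory _ L T \<longleftrightarrow>
     (\<forall>M :: ('a, 'b, 'u) oring_struct. is_model L T M \<longrightarrow> o_minimal L M)"


section \<open>Continuously differentiable functions and derivations\<close>

text \<open>\<open>M\<^sup>n\<close> carries the product of the order topologies. Since \<open>M\<close> is an ordered field, it
  is generated by boxes with a common half-width \<open>r > 0\<close>.\<close>

definition in_box ::
  "('a, 'b, 'u) oring_struct \<Rightarrow> nat \<Rightarrow> 'u \<Rightarrow> 'u list \<Rightarrow> 'u list \<Rightarrow> bool" where
  "in_box M n r u v \<longleftrightarrow> (\<forall>i<n. less_of M (abs_of M (sub_of M (v ! i) (u ! i))) r)"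

definition open_in_power :: "('a, 'b, 'u) oring_struct \<Rightarrow> nat \<Rightarrow> 'u list set \<Rightarrow> bool" where
  "open_in_power M n U \<longleftrightarrow> U \<subseteq> tuples M n \<and>
     (\<forall>u\<in>U. \<exists>r\<in>pos_of M. \<forall>v\<in>tuples M n. in_box M n r u v \<longrightarrow> v \<in> U)"

definition continuous_on_power ::
  "('a, 'b, 'u) oring_struct \<Rightarrow> nat \<Rightarrow> 'u list set \<Rightarrow> ('u list \<Rightarrow> 'u) \<Rightarrow> bool" where
  "continuous_on_power M n U g \<longleftrightarrow> (\<forall>u\<in>U. \<forall>\<epsilon>\<in>pos_of M. \<exists>r\<in>pos_of M. \<forall>v\<in>U.
     in_box M n r u v \<longrightarrow> less_of M (abs_of M (sub_of M (g v) (g u))) \<epsilon>)"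

text \<open>The difference quotient \<open>(f (u + h e\<^sub>i) - f u) / h\<close> tends to \<open>d\<close> as \<open>h\<close> tends to \<open>0\<close>,
  written without division.\<close>

definition has_partial_derivative ::
  "('a, 'b, 'u) oring_struct \<Rightarrow> 'u list set \<Rightarrow> ('u list \<Rightarrow> 'u) \<Rightarrow> nat \<Rightarrow> 'u list \<Rightarrow> 'u \<Rightarrow> bool" where
  "has_partial_derivative M U f i u d \<longleftrightarrow>
     (\<forall>\<epsilon>\<in>pos_of M. \<exists>\<eta>\<in>pos_of M. \<forall>h\<in>carrier M.
        let u' = u[i := add_of M (u ! i) h] in
        h \<noteq> zero_of M \<longrightarrow> less_of M (abs_of M h) \<eta> \<longrightarrow> u' \<in> U \<longrightarrow>
        less_of M (abs_of M (sub_of M (sub_of M (f u') (f u)) (mul_of M d h)))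
                  (mul_of M \<epsilon> (abs_of M h)))"

text \<open>\<open>f : U \<rightarrow> M\<close> is \<open>C\<^sup>1\<close> and \<open>J u\<close> is the only row of its Jacobian matrix
  at \<open>u\<close>.\<close>

definition C1_with_Jacobian ::
  "('a, 'b, 'u) oring_struct \<Rightarrow> nat \<Rightarrow> 'u list set \<Rightarrow> ('u list \<Rightarrow> 'u) \<Rightarrow> ('u list \<Rightarrow> 'u list) \<Rightarrow> bool"
where
  "C1_with_Jacobian M n U f J \<longleftrightarrow> f ` U \<subseteq> carrier M \<and> J ` U \<subseteq> tuples M n \<and>
     (\<forall>i<n. (\<forall>u\<in>U. has_partial_derivative M U f i u (J u ! i)) \<and>
            continuous_on_power M n U (\<lambda>u. J u ! i))"

text \<open>The graph of \<open>f : U \<rightarrow> M\<close> is defined by a formula in the variables \<open>0, \<dots>, n\<close>.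
  The valuation \<open>(!) v\<close> sends the variable \<open>i\<close> to the \<open>i\<close>-th entry of \<open>v\<close>.\<close>

definition zero_definable_fun ::
  "('f, 'r) lang \<Rightarrow> ('f, 'r, 'u) struct \<Rightarrow> nat \<Rightarrow> 'u list set \<Rightarrow> ('u list \<Rightarrow> 'u) \<Rightarrow> bool" where
  "zero_definable_fun L M n U f \<longleftrightarrow> (\<exists>p. is_formula L p \<and> fm_vars p \<subseteq> {..n} \<and>
     {u @ [f u] | u. u \<in> U} = {v \<in> tuples M (Suc n). sat M ((!) v) p})"

definition dot_of :: "('a, 'b, 'u) oring_struct \<Rightarrow> 'u list \<Rightarrow> 'u list \<Rightarrow> 'u" where
  "dot_of M v w = foldr (add_of M) (map2 (mul_of M) v w) (zero_of M)"

definition T_derivation ::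
  "('a oring_fun, 'b oring_rel) lang \<Rightarrow> ('a, 'b, 'u) oring_struct \<Rightarrow> ('u \<Rightarrow> 'u) \<Rightarrow> bool" where
  "T_derivation L M \<delta> \<longleftrightarrow> \<delta> ` carrier M \<subseteq> carrier M \<and>
     (\<forall>n U f J. open_in_power M n U \<longrightarrow> zero_definable_fun L M n U f \<longrightarrow>
        C1_with_Jacobian M n U f J \<longrightarrow>
        (\<forall>u\<in>U. \<delta> (f u) = dot_of M (J u) (map \<delta> u)))"

definition constants :: "('a, 'b, 'u) oring_struct \<Rightarrow> ('u \<Rightarrow> 'u) \<Rightarrow> 'u set" where
  "constants M \<delta> = {a \<in> carrier M. \<delta> a = zero_of M}"

end

(*
  A nonempty set definable over a definably closed C contains a point of C: an endpoint of one of its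
  components, or a midpoint of two endpoints, or an endpoint shifted by 1. By the Tarski-Vaught test
  it is therefore enough that C is definably closed. If a is definable from constants, choose a
  minimal finite set u of constants from which it is definable. No member of u is definable from
  the others, so a = f(u) for a parameter-free definable f which is C^1 on a neighbourhood of u,
  and delta a = J_f(u) (delta u) = 0.

  The regularity of f at u is obtained without cell decomposition. A definable set that contains an
  independent point contains a box around it, and a definable function is continuous there; both
  follow by a simultaneous induction on the number of variables, the ends of a fibre being themselves
  values of definable functions of the other coordinates.
*)
theory Submission
  imports Defs
begin

section \<open>Definable predicates and definable closure\<close>

text \<open>Joint continuity needs more than continuity in each variable: F is monotone in one
  coordinate on a whole box and continuous along the others, so its values are squeezed between
  those on two nearby slices. Monotonicity at an independent point holds because an interval of
  strict local minima is impossible, which in turn is shown by exhibiting points across which the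
  function both falls and rises.

  The derivative is a cut in the slopes: those whose line is crossed upwards lie below it, those
  whose line is crossed downwards lie above it. If the cuts from the left and from the right
  differed, g(y) - c y would have a strict local extremum at the point for a whole interval of
  slopes c. By openness a single slope would then work on an interval of points, which is
  impossible. An infinite slope would also persist on an interval and contradict the slope of a
  chord.

  Partial derivatives are again definable without parameters, so the continuity statement applies to
  them. Openness then turns existence and continuity of the derivatives at one point into the same
  on a box.\<close>

lemma eval_cong:
  "(\<And>x. x \<in> tm_vars t \<Longrightarrow> e x = e' x) \<Longrightarrow> eval M e t = eval M e' t"
proof (induction t)
  case (App f ts)
  have "map (eval M e) ts = map (eval M e') ts"
    using App by (intro map_cong) auto
  then show ?case by (metis eval.simps(2))
qed simp

lemma sat_cong:
  "(\<And>x. x \<in> fm_vars p \<Longrightarrow> e x = e' x) \<Longrightarrow> sat M e p = sat M e' p"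
proof (induction p arbitrary: e e')
  case (FEq s t)
  then show ?case using eval_cong[of s e e' M] eval_cong[of t e e' M] by auto
next
  case (FRel r ts)
  have "map (eval M e) ts = map (eval M e') ts"
    using FRel by (intro map_cong refl eval_cong) auto
  then show ?case by (metis sat.simps(2))
next
  case (FNot p)
  have "sat M e p = sat M e' p"
    using FNot.prems by (intro FNot.IH) auto
  then show ?case by simp
next
  case (FAnd p q)
  have "sat M e p = sat M e' p" "sat M e q = sat M e' q"
    using FAnd.prems by (auto intro!: FAnd.IH simp del: sat.simps)
  then show ?case by simp
next
  case (FEx x p)
  have "sat M (e(x := a)) p = sat M (e'(x := a)) p" for a
    using FEx.prems by (intro FEx.IH) auto
  then show ?case by simp
qed

lemma finite_tm_vars [simp]: "finite (tm_vars t)"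
  by (induction t) auto

lemma finite_fm_vars [simp]: "finite (fm_vars p)"
  by (induction p) auto

section \<open>Renaming of variables in formulas\<close>

fun ren_tm :: "(nat \<Rightarrow> nat) \<Rightarrow> 'f tm \<Rightarrow> 'f tm" where
  "ren_tm \<pi> (Var x) = Var (\<pi> x)"
| "ren_tm \<pi> (App f ts) = App f (map (ren_tm \<pi>) ts)"

lemma is_term_ren_tm [simp]: "is_term L (ren_tm \<pi> t) = is_term L t"
  by (induction t) auto

lemma tm_vars_ren_tm [simp]: "tm_vars (ren_tm \<pi> t) = \<pi> ` tm_vars t"
  by (induction t) auto

lemma eval_ren_tm [simp]: "eval M e (ren_tm \<pi> t) = eval M (\<lambda>k. e (\<pi> k)) t"
proof (induction t)
  case (App f ts)
  then have "map (\<lambda>t. eval M e (ren_tm \<pi> t)) ts = map (eval M (\<lambda>k. e (\<pi> k))) ts"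
    by (intro map_cong) auto
  then show ?case by (simp only: ren_tm.simps eval.simps map_map comp_def)
qed simp

text \<open>The map \<open>\<pi>\<close> may identify variables or hit a bound one, so each
  quantifier is rebound to a variable outside the image of the free variables of its body. This
  choice is the reason why the renamed formula is only asserted to exist.\<close>

lemma ex_renaming:
  assumes "is_formula L p"
  shows "\<exists>q. is_formula L q \<and> fm_vars q = \<pi> ` fm_vars p \<and> (\<forall>e. sat M e q = sat M (\<lambda>k. e (\<pi> k)) p)"
  using assms
proof (induction p arbitrary: \<pi>)
  case (FEq s t)
  then show ?case by (intro exI[of _ "FEq (ren_tm \<pi> s) (ren_tm \<pi> t)"]) auto
next
  case (FRel r ts)
  have "sat M e (FRel r (map (ren_tm \<pi>) ts)) = sat M (\<lambda>k. e (\<pi> k)) (FRel r ts)" for e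
    by (simp only: sat.simps map_map comp_def eval_ren_tm)
  moreover have "is_formula L (FRel r (map (ren_tm \<pi>) ts))"
    using FRel by simp
  moreover have "fm_vars (FRel r (map (ren_tm \<pi>) ts)) = \<pi> ` fm_vars (FRel r ts)"
    by (simp add: image_UN)
  ultimately show ?case by (intro exI[of _ "FRel r (map (ren_tm \<pi>) ts)"] conjI allI)
next
  case (FNot p)
  then obtain q where "is_formula L q" "fm_vars q = \<pi> ` fm_vars p"
    "\<forall>e. sat M e q = sat M (\<lambda>k. e (\<pi> k)) p"
    using FNot.IH[of \<pi>] FNot.prems unfolding is_formula.simps by blast
  then show ?case by (intro exI[of _ "FNot q"]) auto
next
  case (FAnd p p')
  then obtain q where "is_formula L q" "fm_vars q = \<pi> ` fm_vars p"
    "\<forall>e. sat M e q = sat M (\<lambda>k. e (\<pi> k)) p"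
    using FAnd.IH(1)[of \<pi>] FAnd.prems unfolding is_formula.simps by blast
  moreover from FAnd obtain q' where "is_formula L q'" "fm_vars q' = \<pi> ` fm_vars p'"
    "\<forall>e. sat M e q' = sat M (\<lambda>k. e (\<pi> k)) p'"
    using FAnd.IH(2)[of \<pi>] FAnd.prems unfolding is_formula.simps by blast
  ultimately show ?case by (intro exI[of _ "FAnd q q'"]) auto
next
  case (FEx x p)
  obtain y where y: "y \<notin> \<pi> ` fm_vars p"
    using ex_new_if_finite[of "\<pi> ` fm_vars p"] by auto
  from FEx obtain q where q: "is_formula L q" "fm_vars q = (\<pi>(x := y)) ` fm_vars p"
    "\<forall>e. sat M e q = sat M (\<lambda>k. e ((\<pi>(x := y)) k)) p"
    using FEx.IH[of "\<pi>(x := y)"] FEx.prems unfolding is_formula.simps by blast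
  have "sat M (\<lambda>k. (e(y := a)) ((\<pi>(x := y)) k)) p = sat M ((\<lambda>k. e (\<pi> k))(x := a)) p" for e a
    using y by (intro sat_cong) auto
  moreover have "(\<pi>(x := y)) ` fm_vars p - {y} = \<pi> ` (fm_vars p - {x})"
    using y by (auto split: if_splits)
  ultimately have "fm_vars (FEx y q) = \<pi> ` fm_vars (FEx x p)"
    "\<And>e. sat M e (FEx y q) = sat M (\<lambda>k. e (\<pi> k)) (FEx x p)"
    using q by simp_all
  moreover have "is_formula L (FEx y q)" using q by simp
  ultimately show ?case by blast
qed

definition pval :: "(nat \<Rightarrow> 'u) \<Rightarrow> nat + 'u \<Rightarrow> 'u" where
  "pval e = case_sum e (\<lambda>a. a)"

lemma pval_simps [simp]: "pval e (Inl i) = e i" "pval e (Inr a) = a"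
  by (simp_all add: pval_def)

locale fo_struct =
  fixes L :: "('f, 'r) lang" and M :: "('f, 'r, 'u) struct"
  assumes struct: "is_struct L M"
begin

abbreviation U where "U \<equiv> carrier M"

definition vals :: "(nat \<Rightarrow> 'u) set" where
  "vals = {e. range e \<subseteq> U}"

text \<open>Predicates on valuations that are definable with parameters from \<open>A\<close>: the map \<open>s\<close> assigns to
  each variable of the defining formula a coordinate of the valuation or a parameter.\<close>

definition definable :: "'u set \<Rightarrow> ((nat \<Rightarrow> 'u) \<Rightarrow> bool) \<Rightarrow> bool" where
  "definable A P \<longleftrightarrow> (\<exists>p s. is_formula L p \<and> (\<forall>k a. s k = Inr a \<longrightarrow> a \<in> A) \<and>
     (\<forall>e\<in>vals. P e \<longleftrightarrow> sat M (\<lambda>k. pval e (s k)) p))"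

text \<open>Functions of a valuation are given by their graphs, with the value in coordinate
  \<open>0\<close> and the arguments shifted. Terms of the language and functions that no term
  denotes, such as partial derivatives, then obey the same rules.\<close>

definition dterm :: "'u set \<Rightarrow> ((nat \<Rightarrow> 'u) \<Rightarrow> 'u) \<Rightarrow> bool" where
  "dterm A t \<longleftrightarrow> (\<forall>e\<in>vals. t e \<in> U) \<and> definable A (\<lambda>e. e 0 = t (\<lambda>k. e (Suc k)))"

definition dfun :: "'u set \<Rightarrow> ('u \<Rightarrow> 'u) \<Rightarrow> bool" where
  "dfun A g \<longleftrightarrow> (\<forall>x\<in>U. g x \<in> U) \<and> definable A (\<lambda>e. e 0 = g (e 1))"

definition dset :: "'u set \<Rightarrow> 'u set \<Rightarrow> bool" where
  "dset A X \<longleftrightarrow> X \<subseteq> U \<and> definable A (\<lambda>e. e 0 \<in> X)"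

definition dcl :: "'u set \<Rightarrow> 'u set" where
  "dcl A = {a \<in> U. definable A (\<lambda>e. e 0 = a)}"

lemma vals_in [simp]: "e \<in> vals \<Longrightarrow> e k \<in> U"
  by (auto simp: vals_def)

lemma vals_upd [simp]: "e \<in> vals \<Longrightarrow> a \<in> U \<Longrightarrow> e(i := a) \<in> vals"
  by (auto simp: vals_def)

lemma vals_ren [simp]: "e \<in> vals \<Longrightarrow> (\<lambda>k. e (\<pi> k)) \<in> vals"
  by (auto simp: vals_def)

lemma vals_case_nat [simp]: "e \<in> vals \<Longrightarrow> a \<in> U \<Longrightarrow> case_nat a e \<in> vals"
  by (auto simp: vals_def split: nat.splits)

lemma valsI: "(\<And>k. e k \<in> U) \<Longrightarrow> e \<in> vals"
  by (auto simp: vals_def)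

section \<open>Connectives, quantifiers and substitution for definable predicates\<close>

lemma definable_cong:
  "(\<And>e. e \<in> vals \<Longrightarrow> P e = Q e) \<Longrightarrow> definable A P = definable A Q"
  by (simp add: definable_def)

lemma definable_mono: "definable A P \<Longrightarrow> A \<subseteq> B \<Longrightarrow> definable B P"
  unfolding definable_def by (meson subsetD)

lemma definable_rename:
  assumes "definable A P"
  shows "definable A (\<lambda>e. P (\<lambda>k. e (\<pi> k)))"
proof -
  from assms obtain p s where p: "is_formula L p" "\<forall>k a. s k = Inr a \<longrightarrow> a \<in> A"
    "\<forall>e\<in>vals. P e \<longleftrightarrow> sat M (\<lambda>k. pval e (s k)) p"
    unfolding definable_def by blast
  have eq: "(\<lambda>k. pval (\<lambda>k. e (\<pi> k)) (s k)) = (\<lambda>k. pval e ((map_sum \<pi> id \<circ> s) k))" for e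
    by (auto simp: fun_eq_iff pval_def map_sum_def split: sum.splits)
  have "\<forall>k a. (map_sum \<pi> id \<circ> s) k = Inr a \<longrightarrow> a \<in> A"
    using p(2) by (auto simp: map_sum_def split: sum.splits)
  moreover have "P (\<lambda>k. e (\<pi> k)) \<longleftrightarrow> sat M (\<lambda>k. pval e ((map_sum \<pi> id \<circ> s) k)) p" if "e \<in> vals" for e
    unfolding eq[symmetric] using p(3) vals_ren[OF that] by blast
  ultimately show ?thesis
    unfolding definable_def using p(1) by blast
qed

lemma definable_sat: "is_formula L p \<Longrightarrow> definable A (\<lambda>e. sat M e p)"
  unfolding definable_def by (intro exI[of _ p] exI[of _ Inl]) auto

lemma definable_not: "definable A P \<Longrightarrow> definable A (\<lambda>e. \<not> P e)"
  unfolding definable_def by (metis is_formula.simps(3) sat.simps(3))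

lemma definable_conj:
  assumes "definable A P" "definable A Q"
  shows "definable A (\<lambda>e. P e \<and> Q e)"
proof -
  from assms(1) obtain p s where p: "is_formula L p" "\<forall>k a. s k = Inr a \<longrightarrow> a \<in> A"
    "\<forall>e\<in>vals. P e \<longleftrightarrow> sat M (\<lambda>k. pval e (s k)) p"
    unfolding definable_def by blast
  from assms(2) obtain q t where q: "is_formula L q" "\<forall>k a. t k = Inr a \<longrightarrow> a \<in> A"
    "\<forall>e\<in>vals. Q e \<longleftrightarrow> sat M (\<lambda>k. pval e (t k)) q"
    unfolding definable_def by blast
  \<comment> \<open>The two formulas come with different maps \<open>s\<close> and \<open>t\<close>.
    Moving their variables to the even and the odd numbers lets the single map \<open>r\<close>
    serve both.\<close>
  obtain p' where p': "is_formula L p'" "\<forall>e. sat M e p' = sat M (\<lambda>k. e (2 * k)) p"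
    using ex_renaming[OF p(1)] by metis
  obtain q' where q': "is_formula L q'" "\<forall>e. sat M e q' = sat M (\<lambda>k. e (2 * k + 1)) q"
    using ex_renaming[OF q(1)] by metis
  define r where "r k = (if even k then s (k div 2) else t (k div 2))" for k
  have "r (2 * k) = s k" "r (2 * k + 1) = t k" for k
    by (auto simp: r_def)
  moreover have "\<forall>k a. r k = Inr a \<longrightarrow> a \<in> A"
    using p(2) q(2) unfolding r_def by metis
  ultimately show ?thesis
    unfolding definable_def using p q p' q'
    by (intro exI[of _ "FAnd p' q'"] exI[of _ r]) auto
qed

text \<open>Binders are handled in de Bruijn style: under a quantifier, coordinate \<open>0\<close> is the bound variable
  and \<open>k\<close> becomes \<open>Suc k\<close>.\<close>

lemma definable_ex:
  assumes "definable A (\<lambda>e. Q (e 0) (\<lambda>k. e (Suc k)))"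
  shows "definable A (\<lambda>e. \<exists>a\<in>U. Q a e)"
proof -
  from assms obtain p s where p: "is_formula L p" "\<forall>k a. s k = Inr a \<longrightarrow> a \<in> A"
    "\<forall>e\<in>vals. Q (e 0) (\<lambda>k. e (Suc k)) \<longleftrightarrow> sat M (\<lambda>k. pval e (s k)) p"
    unfolding definable_def by blast
  \<comment> \<open>All formula variables that read the bound coordinate are merged into variable
    \<open>0\<close>, which \<open>FEx 0\<close> then binds; the others move up by one. The map
    \<open>t\<close> undoes this shift. What it says at \<open>0\<close> is harmless, because the
    quantifier overwrites that value.\<close>
  define \<pi> where "\<pi> k = (if s k = Inl 0 then 0 else Suc k)" for k
  define t where "t k = map_sum (\<lambda>i. i - 1) id (s (k - 1))" for k
  obtain q where q: "is_formula L q" "\<forall>e. sat M e q = sat M (\<lambda>k. e (\<pi> k)) p"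
    using ex_renaming[OF p(1)] by metis
  have "\<forall>k a. t k = Inr a \<longrightarrow> a \<in> A"
    using p(2) by (auto simp: t_def map_sum_def split: sum.splits)
  moreover have "(\<lambda>k. ((\<lambda>k. pval e (t k))(0 := a)) (\<pi> k)) = (\<lambda>k. pval (case_nat a e) (s k))" for e a
  proof
    fix k
    show "((\<lambda>k. pval e (t k))(0 := a)) (\<pi> k) = pval (case_nat a e) (s k)"
      by (cases "s k") (auto simp: \<pi>_def t_def split: nat.splits)
  qed
  moreover have "Q a e \<longleftrightarrow> sat M (\<lambda>k. pval (case_nat a e) (s k)) p" if "e \<in> vals" "a \<in> U" for e a
    using p(3)[rule_format, of "case_nat a e"] that by simp
  ultimately show ?thesis
    unfolding definable_def using q
    by (intro exI[of _ "FEx 0 q"] exI[of _ t]) auto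
qed

lemma definable_disj:
  assumes "definable A P" "definable A Q"
  shows "definable A (\<lambda>e. P e \<or> Q e)"
proof -
  have "definable A (\<lambda>e. \<not> (\<not> P e \<and> \<not> Q e))"
    by (rule definable_not[OF definable_conj[OF definable_not[OF assms(1)] definable_not[OF assms(2)]]])
  then show ?thesis by simp
qed

lemma definable_imp:
  assumes "definable A P" "definable A Q"
  shows "definable A (\<lambda>e. P e \<longrightarrow> Q e)"
proof -
  have "definable A (\<lambda>e. \<not> P e \<or> Q e)"
    by (rule definable_disj[OF definable_not[OF assms(1)] assms(2)])
  then show ?thesis by (simp only: imp_conv_disj)
qed

lemma definable_all:
  assumes "definable A (\<lambda>e. Q (e 0) (\<lambda>k. e (Suc k)))"
  shows "definable A (\<lambda>e. \<forall>a\<in>U. Q a e)"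
proof -
  have "definable A (\<lambda>e. \<not> (\<exists>a\<in>U. \<not> Q a e))"
    by (rule definable_not[OF definable_ex[OF definable_not[OF assms]]])
  then show ?thesis by simp
qed

lemma definable_True: "definable A (\<lambda>e. True)"
  using definable_sat[of "FEq (Var 0) (Var 0)"] by simp

lemma definable_const: "definable A (\<lambda>e. b)"
  using definable_True[of A] definable_not[OF definable_True, of A] by (cases b) auto

lemma definable_finite_all:
  "finite I \<Longrightarrow> (\<And>i. i \<in> I \<Longrightarrow> definable A (P i)) \<Longrightarrow> definable A (\<lambda>e. \<forall>i\<in>I. P i e)"
proof (induction I rule: finite_induct)
  case empty
  then show ?case by (simp add: definable_True)
next
  case (insert i I)
  then have "definable A (\<lambda>e. P i e \<and> (\<forall>i\<in>I. P i e))"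
    by (intro definable_conj) auto
  then show ?case by simp
qed

section \<open>Definable functions, definable sets and definable closure\<close>

lemma dterm_in: "dterm A t \<Longrightarrow> e \<in> vals \<Longrightarrow> t e \<in> U"
  by (simp add: dterm_def)

lemma dterm_mono: "dterm A t \<Longrightarrow> A \<subseteq> B \<Longrightarrow> dterm B t"
  unfolding dterm_def using definable_mono by blast

lemma dterm_rename: "dterm A t \<Longrightarrow> dterm A (\<lambda>e. t (\<lambda>k. e (\<pi> k)))"
  unfolding dterm_def
  using definable_rename[of A "\<lambda>e. e 0 = t (\<lambda>k. e (Suc k))" "case_nat 0 (\<lambda>k. Suc (\<pi> k))"] by auto

text \<open>A definable function cannot be substituted into a formula as a term, so its value is
  introduced by an existential quantifier.\<close>

lemma definable_let:
  assumes "dterm A t" "definable A (\<lambda>e. Q (e 0) (\<lambda>k. e (Suc k)))"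
  shows "definable A (\<lambda>e. Q (t e) e)"
proof -
  have "definable A (\<lambda>e. \<exists>a\<in>U. a = t e \<and> Q a e)"
    using assms by (intro definable_ex definable_conj) (auto simp: dterm_def)
  then show ?thesis
    by (rule definable_cong[THEN iffD1, rotated]) (use assms(1) in \<open>auto simp: dterm_def\<close>)
qed

lemma dterm_eval:
  assumes "is_term L t"
  shows "dterm A (\<lambda>e. eval M e t)"
proof -
  have "eval M e t \<in> U" if "e \<in> vals" for e
    using assms
  proof (induction t)
    case (App f ts)
    then have "map (eval M e) ts \<in> tuples M (length ts)"
      by (auto simp: tuples_def)
    then show ?case
      using struct App.prems by (simp add: is_struct_def)
  qed (use that in auto)
  moreover have "definable A (\<lambda>e. sat M e (FEq (Var 0) (ren_tm Suc t)))"
    using assms by (intro definable_sat) simp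
  ultimately show ?thesis by (auto simp: dterm_def comp_def)
qed

lemma dterm_var: "dterm A (\<lambda>e. e k)"
  using dterm_eval[of "Var k"] by simp

lemma definable_eq: "dterm A s \<Longrightarrow> dterm A t \<Longrightarrow> definable A (\<lambda>e. s e = t e)"
proof -
  assume s: "dterm A s" and t: "dterm A t"
  have "definable A (\<lambda>e. e 0 = t (\<lambda>k. e (Suc k)))"
    using t by (simp add: dterm_def)
  from definable_let[OF s, of "\<lambda>a e. a = t e", OF this] show ?thesis .
qed

lemma dterm_subst:
  assumes t: "dterm A t" and r: "dterm A (\<lambda>e. R (e 0) (\<lambda>k. e (Suc k)))"
  shows "dterm A (\<lambda>e. R (t e) e)"
proof -
  have "R (t e) e \<in> U" if "e \<in> vals" for e
    using dterm_in[OF r, of "case_nat (t e) e"] dterm_in[OF t that] that by simp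
  moreover have "definable A (\<lambda>e. e 0 = R (t (\<lambda>k. e (Suc k))) (\<lambda>k. e (Suc k)))"
  proof (rule definable_let[of A "\<lambda>e. t (\<lambda>k. e (Suc k))" "\<lambda>a e. e 0 = R a (\<lambda>k. e (Suc k))"])
    show "dterm A (\<lambda>e. t (\<lambda>k. e (Suc k)))" by (rule dterm_rename[OF t])
    show "definable A (\<lambda>e. e (Suc 0) = R (e 0) (\<lambda>k. e (Suc (Suc k))))"
      using dterm_rename[OF r, of "case_nat 0 (\<lambda>k. Suc (Suc k))"]
      by (intro definable_eq dterm_var) simp
  qed
  ultimately show ?thesis by (simp add: dterm_def)
qed

lemma dterm_const: "a \<in> A \<Longrightarrow> a \<in> U \<Longrightarrow> dterm A (\<lambda>e. a)"
  unfolding dterm_def definable_def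
  by (intro conjI exI[of _ "FEq (Var 0) (Var 1)"] exI[of _ "\<lambda>k. if k = 0 then Inl 0 else Inr a"]) auto

text \<open>Elements of \<open>dcl A\<close> thereby become admissible constants in definability
  proofs, and closure of \<open>dcl A\<close> under definable operations becomes an instance of the
  rules for \<open>dterm\<close>.\<close>

lemma dcl_iff: "a \<in> dcl A \<longleftrightarrow> dterm A (\<lambda>e. a)"
proof
  assume h: "dterm A (\<lambda>e. a)"
  obtain u where "u \<in> U" using struct by (auto simp: is_struct_def)
  then have "a \<in> U" using dterm_in[OF h, of "\<lambda>_. u"] by (simp add: vals_def)
  moreover have "definable A (\<lambda>e. e 0 = a)" using h by (simp add: dterm_def)
  ultimately show "a \<in> dcl A" by (simp add: dcl_def)
qed (simp add: dcl_def dterm_def)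

lemma dcl_in: "a \<in> dcl A \<Longrightarrow> a \<in> U"
  by (simp add: dcl_def)

lemma dcl_mono: "A \<subseteq> B \<Longrightarrow> dcl A \<subseteq> dcl B"
  using dterm_mono by (auto simp: dcl_iff)

lemma dfun_in: "dfun A g \<Longrightarrow> x \<in> U \<Longrightarrow> g x \<in> U"
  by (simp add: dfun_def)

lemma dfun_mono: "dfun A g \<Longrightarrow> A \<subseteq> B \<Longrightarrow> dfun B g"
  unfolding dfun_def using definable_mono by blast

lemma dterm_app:
  assumes g: "dfun A g" and t: "dterm A t"
  shows "dterm A (\<lambda>e. g (t e))"
proof (rule dterm_subst[OF t])
  show "dterm A (\<lambda>e. g (e 0))"
    using g unfolding dfun_def dterm_def by auto
qed

lemma dfunI: "dterm A (\<lambda>e. g (e 0)) \<Longrightarrow> dfun A g"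
proof -
  assume h: "dterm A (\<lambda>e. g (e 0))"
  have "g x \<in> U" if "x \<in> U" for x
    using dterm_in[OF h, of "\<lambda>_. x"] that by (simp add: vals_def)
  then show ?thesis using h by (auto simp: dfun_def dterm_def)
qed

lemma dset_in: "dset A X \<Longrightarrow> x \<in> X \<Longrightarrow> x \<in> U"
  by (auto simp: dset_def)

lemma dset_mono: "dset A X \<Longrightarrow> A \<subseteq> B \<Longrightarrow> dset B X"
  unfolding dset_def using definable_mono by blast

lemma definable_mem: "dset A X \<Longrightarrow> dterm A t \<Longrightarrow> definable A (\<lambda>e. t e \<in> X)"
  by (rule definable_let) (auto simp: dset_def)

lemma dsetI: "definable A (\<lambda>e. P (e 0)) \<Longrightarrow> dset A {x \<in> U. P x}"
  unfolding dset_def by (auto elim!: definable_cong[THEN iffD1, rotated])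

lemmas definable_intros =
  definable_conj definable_disj definable_imp definable_not definable_ex definable_all
  definable_eq definable_const dterm_var

section \<open>Trading parameters for variables\<close>

lemma definable_abstract_param:
  assumes "definable (insert b A) P"
  shows "\<exists>Q. definable A Q \<and> (\<forall>e\<in>vals. P e = Q (case_nat b e))"
proof -
  from assms obtain p s where p: "is_formula L p" "\<forall>k a. s k = Inr a \<longrightarrow> a \<in> insert b A"
    "\<forall>e\<in>vals. P e \<longleftrightarrow> sat M (\<lambda>k. pval e (s k)) p"
    unfolding definable_def by blast
  define t where "t k = (case s k of Inl i \<Rightarrow> Inl (Suc i) | Inr a \<Rightarrow> if a = b then Inl 0 else Inr a)" for k
  have "\<forall>k a. t k = Inr a \<longrightarrow> a \<in> A"
    using p(2) by (auto simp: t_def split: sum.splits if_splits)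
  moreover have "(\<lambda>k. pval (case_nat b e) (t k)) = (\<lambda>k. pval e (s k))" for e
    by (auto simp: fun_eq_iff t_def pval_def split: sum.splits)
  ultimately show ?thesis
    using p unfolding definable_def
    by (intro exI[of _ "\<lambda>e. sat M (\<lambda>k. pval e (t k)) p"]) auto
qed

text \<open>The parameter \<open>b\<close> is turned into a coordinate, and the constant function
  \<open>b\<close>, definable over \<open>A\<close>, is then substituted for that
  coordinate.\<close>

lemma definable_dcl_insert:
  assumes "definable (insert b A) P" "b \<in> dcl A"
  shows "definable A P"
proof -
  obtain Q where Q: "definable A Q" "\<forall>e\<in>vals. P e = Q (case_nat b e)"
    using definable_abstract_param[OF assms(1)] by blast
  have "definable A (\<lambda>e. Q (case_nat b e))"
  proof (rule definable_let)
    show "dterm A (\<lambda>e. b)" using assms(2) by (simp add: dcl_iff)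
    have "case_nat (e 0) (\<lambda>k. e (Suc k)) = e" for e :: "nat \<Rightarrow> 'u"
      by (auto simp: fun_eq_iff split: nat.splits)
    then show "definable A (\<lambda>e. Q (case_nat (e 0) (\<lambda>k. e (Suc k))))"
      using Q(1) by simp
  qed
  with Q(2) show ?thesis by (simp cong: definable_cong)
qed

lemma dcl_dcl_insert: "b \<in> dcl A \<Longrightarrow> dcl (insert b A) = dcl A"
  using dcl_mono[of A "insert b A"] definable_dcl_insert by (auto simp: dcl_def)

lemma definable_finite_params:
  assumes "definable A P"
  shows "\<exists>B\<subseteq>A. finite B \<and> definable B P"
proof -
  from assms obtain p s where p: "is_formula L p" "\<forall>k a. s k = Inr a \<longrightarrow> a \<in> A"
    "\<forall>e\<in>vals. P e \<longleftrightarrow> sat M (\<lambda>k. pval e (s k)) p"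
    unfolding definable_def by blast
  \<comment> \<open>The map \<open>s\<close> may attach parameters to infinitely many variables, but
    only those occurring in \<open>p\<close> count; the others are redirected to coordinate
    \<open>0\<close>.\<close>
  define t where "t k = (if k \<in> fm_vars p then s k else Inl 0)" for k
  define B where "B = A \<inter> (\<lambda>k. case s k of Inl i \<Rightarrow> undefined | Inr a \<Rightarrow> a) ` fm_vars p"
  have "\<forall>k a. t k = Inr a \<longrightarrow> a \<in> B"
  proof (intro allI impI)
    fix k a assume "t k = Inr a"
    then have k: "k \<in> fm_vars p" "s k = Inr a" by (auto simp: t_def split: if_splits)
    then have "a \<in> (\<lambda>k. case s k of Inl i \<Rightarrow> undefined | Inr a \<Rightarrow> a) ` fm_vars p"
      by (intro image_eqI[of _ _ k]) auto
    then show "a \<in> B" using p(2) k(2) unfolding B_def by blast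
  qed
  moreover have "sat M (\<lambda>k. pval e (t k)) p = sat M (\<lambda>k. pval e (s k)) p" for e
    by (rule sat_cong) (simp add: t_def)
  ultimately have "definable B P"
    unfolding definable_def using p by (intro exI[of _ p] exI[of _ t]) auto
  moreover have "finite B" "B \<subseteq> A" by (auto simp: B_def)
  ultimately show ?thesis by blast
qed

text \<open>The parameters become a second valuation \<open>c\<close>, interleaved with
  \<open>e\<close> on the even positions. The last clause records that only the entries with index
  in \<open>J\<close> are consulted, which later lets a function ignore all other
  coordinates.\<close>

lemma definable_params_to_vars:
  assumes "definable (c ` J) P"
  shows "\<exists>Q. definable {} (\<lambda>E. Q (\<lambda>k. E (2 * k)) (\<lambda>k. E (2 * k + 1))) \<and>
    (\<forall>e\<in>vals. P e = Q c e) \<and> (\<forall>c c' e. (\<forall>j\<in>J. c j = c' j) \<longrightarrow> Q c e = Q c' e)"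
proof -
  from assms obtain p s where p: "is_formula L p" "\<forall>k a. s k = Inr a \<longrightarrow> a \<in> c ` J"
    "\<forall>e\<in>vals. P e \<longleftrightarrow> sat M (\<lambda>k. pval e (s k)) p"
    unfolding definable_def by blast
  \<comment> \<open>Since \<open>c\<close> need not be injective, one index is chosen for every
    parameter.\<close>
  define j where "j a = (SOME j. j \<in> J \<and> c j = a)" for a
  have j: "j a \<in> J \<and> c (j a) = a" if "a \<in> c ` J" for a
    unfolding j_def by (rule someI_ex) (use that in auto)
  define Q where "Q c e = sat M (\<lambda>k. case s k of Inl i \<Rightarrow> e i | Inr a \<Rightarrow> c (j a)) p" for c e
  define t :: "nat \<Rightarrow> nat + 'u" where
    "t k = Inl (case s k of Inl i \<Rightarrow> 2 * i + 1 | Inr a \<Rightarrow> 2 * j a)" for k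
  have s: "(\<exists>i. s k = Inl i) \<or> (\<exists>a\<in>c ` J. s k = Inr a)" for k
  proof (cases "s k")
    case (Inr a)
    then have "a \<in> c ` J" using p(2) by blast
    then show ?thesis using Inr by blast
  qed simp
  have "(\<lambda>k. pval E (t k)) = (\<lambda>k. case s k of Inl i \<Rightarrow> E (2 * i + 1) | Inr a \<Rightarrow> E (2 * j a))" for E
    by (auto simp: fun_eq_iff t_def split: sum.splits)
  then have 1: "definable {} (\<lambda>E. Q (\<lambda>k. E (2 * k)) (\<lambda>k. E (2 * k + 1)))"
    unfolding definable_def Q_def using p(1)
    by (intro exI[of _ p] exI[of _ t]) (auto simp: t_def)
  have 2: "P e = Q c e" if "e \<in> vals" for e
  proof -
    have "(\<lambda>k. case s k of Inl i \<Rightarrow> e i | Inr a \<Rightarrow> c (j a)) = (\<lambda>k. pval e (s k))"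
    proof
      fix k show "(case s k of Inl i \<Rightarrow> e i | Inr a \<Rightarrow> c (j a)) = pval e (s k)"
        using s[of k] j by auto
    qed
    then show ?thesis using p(3) that by (simp add: Q_def)
  qed
  have 3: "Q c1 e = Q c2 e" if "\<forall>i\<in>J. c1 i = c2 i" for c1 c2 e
  proof -
    have "(\<lambda>k. case s k of Inl i \<Rightarrow> e i | Inr a \<Rightarrow> c1 (j a)) = (\<lambda>k. case s k of Inl i \<Rightarrow> e i | Inr a \<Rightarrow> c2 (j a))"
    proof
      fix k show "(case s k of Inl i \<Rightarrow> e i | Inr a \<Rightarrow> c1 (j a)) = (case s k of Inl i \<Rightarrow> e i | Inr a \<Rightarrow> c2 (j a))"
        using s[of k] j that by auto
    qed
    then show ?thesis by (simp add: Q_def)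
  qed
  show ?thesis using 1 2 3 by blast
qed

text \<open>A box around a point quantifies over finitely many coordinates of a second valuation
  while the remaining ones are copied from the first. This is the rule that makes such statements
  definable; the two valuations are interleaved on even and odd positions.\<close>

lemma definable_block_ex:
  assumes "finite I" "definable A (\<lambda>E. G (\<lambda>k. E (2 * k)) (\<lambda>k. E (2 * k + 1)))"
  shows "definable A (\<lambda>e. \<exists>e'\<in>vals. (\<forall>k. k \<notin> I \<longrightarrow> e' k = e (\<pi> k)) \<and> G e e')"
proof -
  \<comment> \<open>Changing the coordinates in a finite set \<open>S\<close> amounts to one
    ordinary quantifier for each of them.\<close>
  have *: "definable A (\<lambda>E. \<exists>E'\<in>vals. (\<forall>k. k \<notin> S \<longrightarrow> E' k = E k) \<and> H E')"
    if "finite S" "definable A H" for S H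
    using that
  proof (induction S arbitrary: H rule: finite_induct)
    case empty
    have "(\<exists>E'\<in>vals. (\<forall>k. k \<notin> {} \<longrightarrow> E' k = E k) \<and> H E') = H E" if "E \<in> vals" for E
    proof -
      have "(\<forall>k. k \<notin> {} \<longrightarrow> E' k = E k) \<longleftrightarrow> E' = E" for E' by auto
      then show ?thesis using that by simp
    qed
    then show ?case using empty by (simp cong: definable_cong)
  next
    case (insert i S)
    have "(\<lambda>k. e (if k = i then 0 else Suc k)) = (\<lambda>k. if k = i then e 0 else e (Suc k))"
      for e :: "nat \<Rightarrow> 'u" by auto
    then have "definable A (\<lambda>E. \<exists>a\<in>U. H (\<lambda>k. if k = i then a else E k))"
      using definable_rename[OF insert.prems, of "\<lambda>k. if k = i then 0 else Suc k"]
      by (intro definable_ex) simp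
    from insert.IH[OF this]
    have "definable A (\<lambda>E. \<exists>E'\<in>vals. (\<forall>k. k \<notin> S \<longrightarrow> E' k = E k) \<and>
      (\<exists>a\<in>U. H (\<lambda>k. if k = i then a else E' k)))" .
    moreover have "(\<exists>E'\<in>vals. (\<forall>k. k \<notin> S \<longrightarrow> E' k = E k) \<and>
      (\<exists>a\<in>U. H (\<lambda>k. if k = i then a else E' k))) \<longleftrightarrow>
      (\<exists>E'\<in>vals. (\<forall>k. k \<notin> insert i S \<longrightarrow> E' k = E k) \<and> H E')" if "E \<in> vals" for E
    proof
      assume "\<exists>E'\<in>vals. (\<forall>k. k \<notin> S \<longrightarrow> E' k = E k) \<and> (\<exists>a\<in>U. H (\<lambda>k. if k = i then a else E' k))"
      then obtain E' a where "E' \<in> vals" "\<forall>k. k \<notin> S \<longrightarrow> E' k = E k" "a \<in> U"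
        "H (\<lambda>k. if k = i then a else E' k)" by blast
      then show "\<exists>E'\<in>vals. (\<forall>k. k \<notin> insert i S \<longrightarrow> E' k = E k) \<and> H E'"
        by (intro bexI[of _ "\<lambda>k. if k = i then a else E' k"]) (auto simp: vals_def)
    next
      assume "\<exists>E'\<in>vals. (\<forall>k. k \<notin> insert i S \<longrightarrow> E' k = E k) \<and> H E'"
      then obtain E' where E': "E' \<in> vals" "\<forall>k. k \<notin> insert i S \<longrightarrow> E' k = E k" "H E'" by blast
      have "(\<lambda>k. if k = i then E' i else (E'(i := E i)) k) = E'" by auto
      with E' that insert.hyps show "\<exists>E'\<in>vals. (\<forall>k. k \<notin> S \<longrightarrow> E' k = E k) \<and>
          (\<exists>a\<in>U. H (\<lambda>k. if k = i then a else E' k))"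
        by (intro bexI[of _ "E'(i := E i)"] conjI bexI[of _ "E' i"]) auto
    qed
    ultimately show ?case by (simp cong: definable_cong)
  qed
  define S where "S = (\<lambda>k. 2 * k + 1) ` I"
  \<comment> \<open>Reading \<open>e\<close> along \<open>\<rho>\<close> gives the interleaving of
    \<open>e\<close> with its copy along \<open>\<pi>\<close>; only the odd positions in
    \<open>S\<close> are then allowed to vary.\<close>
  define \<rho> where "\<rho> k = (if even k then k div 2 else \<pi> (k div 2))" for k
  have "definable A (\<lambda>e. \<exists>E'\<in>vals. (\<forall>k. k \<notin> S \<longrightarrow> E' k = e (\<rho> k)) \<and>
      G (\<lambda>k. E' (2 * k)) (\<lambda>k. E' (2 * k + 1)))"
    using definable_rename[OF *[OF _ assms(2)], of S \<rho>] assms(1) by (simp add: S_def)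
  moreover have "(\<exists>E'\<in>vals. (\<forall>k. k \<notin> S \<longrightarrow> E' k = e (\<rho> k)) \<and> G (\<lambda>k. E' (2 * k)) (\<lambda>k. E' (2 * k + 1)))
     \<longleftrightarrow> (\<exists>e'\<in>vals. (\<forall>k. k \<notin> I \<longrightarrow> e' k = e (\<pi> k)) \<and> G e e')" if "e \<in> vals" for e
  proof
    assume "\<exists>E'\<in>vals. (\<forall>k. k \<notin> S \<longrightarrow> E' k = e (\<rho> k)) \<and> G (\<lambda>k. E' (2 * k)) (\<lambda>k. E' (2 * k + 1))"
    then obtain E' where E: "E' \<in> vals" "\<And>k. k \<notin> S \<Longrightarrow> E' k = e (\<rho> k)"
      "G (\<lambda>k. E' (2 * k)) (\<lambda>k. E' (2 * k + 1))" by blast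
    have "2 * k \<notin> S" for k unfolding S_def by (auto simp: image_iff) presburger
    then have "(\<lambda>k. E' (2 * k)) = e" using E(2) by (auto simp: \<rho>_def)
    moreover have "k \<notin> I \<Longrightarrow> 2 * k + 1 \<notin> S" for k unfolding S_def by auto
    then have "k \<notin> I \<Longrightarrow> E' (2 * k + 1) = e (\<pi> k)" for k using E(2) by (auto simp: \<rho>_def)
    ultimately show "\<exists>e'\<in>vals. (\<forall>k. k \<notin> I \<longrightarrow> e' k = e (\<pi> k)) \<and> G e e'"
      using E(3) vals_ren[OF E(1), of "\<lambda>k. 2 * k + 1"]
      by (intro bexI[of _ "\<lambda>k. E' (2 * k + 1)"]) auto
  next
    assume "\<exists>e'\<in>vals. (\<forall>k. k \<notin> I \<longrightarrow> e' k = e (\<pi> k)) \<and> G e e'"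
    then obtain e' where e': "e' \<in> vals" "\<forall>k. k \<notin> I \<longrightarrow> e' k = e (\<pi> k)" "G e e'" by blast
    define E' where "E' k = (if even k then e (k div 2) else e' (k div 2))" for k
    have "E' k = e (\<rho> k)" if "k \<notin> S" for k
    proof (cases "even k")
      case False
      then have "k = 2 * (k div 2) + 1" by simp
      then have "k div 2 \<notin> I" using that unfolding S_def by blast
      then show ?thesis using e' False by (simp add: E'_def \<rho>_def)
    qed (simp add: E'_def \<rho>_def)
    moreover have "E' \<in> vals" using e'(1) that by (auto simp: vals_def E'_def)
    ultimately show "\<exists>E'\<in>vals. (\<forall>k. k \<notin> S \<longrightarrow> E' k = e (\<rho> k)) \<and> G (\<lambda>k. E' (2 * k)) (\<lambda>k. E' (2 * k + 1))"
      using e'(3) by (intro bexI[of _ E']) (auto simp: E'_def)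
  qed
  ultimately show ?thesis by (simp cong: definable_cong)
qed

lemma definable_block_all:
  assumes "finite I" "definable A (\<lambda>E. G (\<lambda>k. E (2 * k)) (\<lambda>k. E (2 * k + 1)))"
  shows "definable A (\<lambda>e. \<forall>e'\<in>vals. (\<forall>k. k \<notin> I \<longrightarrow> e' k = e (\<pi> k)) \<longrightarrow> G e e')"
proof -
  have "definable A (\<lambda>e. \<not> (\<exists>e'\<in>vals. (\<forall>k. k \<notin> I \<longrightarrow> e' k = e (\<pi> k)) \<and> \<not> G e e'))"
    by (rule definable_not[OF definable_block_ex[OF assms(1) definable_not[OF assms(2)]]])
  moreover have "(\<not> (\<exists>e'\<in>vals. (\<forall>k. k \<notin> I \<longrightarrow> e' k = e (\<pi> k)) \<and> \<not> G e e')) \<longleftrightarrow>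
      (\<forall>e'\<in>vals. (\<forall>k. k \<notin> I \<longrightarrow> e' k = e (\<pi> k)) \<longrightarrow> G e e')" for e
    by blast
  ultimately show ?thesis by simp
qed

end

section \<open>The ordered field and its transport along an injection\<close>

text \<open>The hypotheses on \<open>T\<close> only concern structures over a larger type, so \<open>M\<close> is moved there
  along \<open>Inl\<close> and o-minimality is pulled back.\<close>

definition lift_struct :: "('f, 'r, 'u) struct \<Rightarrow> ('f, 'r, 'u + 'v) struct" where
  "lift_struct M = \<lparr>carrier = Inl ` carrier M, fun_int = (\<lambda>f us. Inl (fun_int M f (map projl us))),
     rel_int = (\<lambda>r us. rel_int M r (map projl us))\<rparr>"

lemma lift_struct_simps [simp]:
  "carrier (lift_struct M) = Inl ` carrier M"
  "fun_int (lift_struct M) f us = Inl (fun_int M f (map projl us))"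
  "rel_int (lift_struct M) r us = rel_int M r (map projl us)"
  by (simp_all add: lift_struct_def)

lemma eval_lift_struct:
  "eval (lift_struct M :: ('f, 'r, 'u + 'v) struct) (\<lambda>k. Inl (e k)) t = Inl (eval M e t)"
proof (induction t)
  case (App f ts)
  then have "map (\<lambda>t. projl (eval (lift_struct M :: ('f, 'r, 'u + 'v) struct) (\<lambda>k. Inl (e k)) t)) ts = map (eval M e) ts"
    by (intro map_cong) auto
  then show ?case by (simp only: eval.simps lift_struct_simps map_map comp_def)
qed simp

lemma sat_lift_struct:
  "sat (lift_struct M :: ('f, 'r, 'u + 'v) struct) (\<lambda>k. Inl (e k)) p = sat M e p"
proof (induction p arbitrary: e)
  case (FEx x p)
  have "(\<lambda>k. Inl (e k) :: 'u + 'v)(x := Inl a) = (\<lambda>k. Inl ((e(x := a)) k))" for a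
    by auto
  then show ?case by (simp add: FEx del: fun_upd_apply)
qed (simp_all add: eval_lift_struct comp_def)

lemma range_lift_struct:
  assumes "range e \<subseteq> carrier (lift_struct M)"
  obtains e' where "range e' \<subseteq> carrier M" "e = (\<lambda>k. Inl (e' k))"
proof
  have *: "\<exists>a\<in>carrier M. e k = Inl a" for k using assms by auto
  show "range (\<lambda>k. projl (e k)) \<subseteq> carrier M"
  proof
    fix x assume "x \<in> range (\<lambda>k. projl (e k))"
    then obtain k where "x = projl (e k)" by blast
    with *[of k] show "x \<in> carrier M" by auto
  qed
  show "e = (\<lambda>k. Inl (projl (e k)))"
  proof
    fix k show "e k = Inl (projl (e k))" using *[of k] by auto
  qed
qed

lemma holds_in_lift_struct: "holds_in (lift_struct M :: ('f, 'r, 'u + 'v) struct) p = holds_in M p" (is "holds_in ?M p = _")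
proof
  assume h: "holds_in ?M p"
  show "holds_in M p"
    unfolding holds_in_def
  proof (intro allI impI)
    fix e :: "nat \<Rightarrow> 'u" assume "range e \<subseteq> carrier M"
    then have "range (\<lambda>k. Inl (e k)) \<subseteq> carrier ?M" by auto
    with h have "sat ?M (\<lambda>k. Inl (e k)) p" unfolding holds_in_def by blast
    then show "sat M e p" by (simp add: sat_lift_struct)
  qed
next
  assume h: "holds_in M p"
  show "holds_in ?M p"
    unfolding holds_in_def
  proof (intro allI impI)
    fix e :: "nat \<Rightarrow> 'u + 'v" assume "range e \<subseteq> carrier ?M"
    then obtain e' where "range e' \<subseteq> carrier M" "e = (\<lambda>k. Inl (e' k))"
      by (rule range_lift_struct)
    with h show "sat ?M e p" unfolding holds_in_def by (simp add: sat_lift_struct)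
  qed
qed

lemma is_model_lift_struct:
  assumes "is_model L T M"
  shows "is_model L T (lift_struct M :: ('f, 'r, 'u + 'v) struct)" (is "is_model L T ?M")
proof -
  have "fun_int ?M f u \<in> carrier ?M"
    if f: "fun_ar L f = Some n" and u: "u \<in> tuples ?M n" for f n u
  proof -
    have "map projl u \<in> tuples M n" using u by (auto simp: tuples_def subset_iff)
    then have "fun_int M f (map projl u) \<in> carrier M"
      using assms f by (simp add: is_model_def is_struct_def)
    then show ?thesis by simp
  qed
  then show ?thesis
    using assms by (simp add: is_model_def is_struct_def holds_in_lift_struct)
qed

text \<open>The same formula defines the copy of a definable set, and \<open>Inl\<close> is an order
  isomorphism onto the lifted carrier, so preimages of points and intervals are again points and
  intervals.\<close>

lemma o_minimal_lift_struct:
  assumes "o_minimal L (lift_struct M :: ('a, 'b, 'u + 'v) oring_struct)" (is "o_minimal L ?M")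
  shows "o_minimal L M"
  unfolding o_minimal_def
proof (intro allI impI)
  fix X assume "definable_subset L M X"
  then obtain p e where p: "is_formula L p" "range e \<subseteq> carrier M"
    and X: "X = {x \<in> carrier M. sat M (e(0 := x)) p}"
    unfolding definable_subset_def by blast
  have eq: "(\<lambda>k. Inl (e k))(0 := Inl x) = (\<lambda>k. Inl ((e(0 := x)) k))" for x
    by auto
  have "Inl ` X = {x \<in> carrier ?M. sat ?M ((\<lambda>k. Inl (e k))(0 := x)) p}"
    by (auto simp: X eq sat_lift_struct simp del: fun_upd_apply)
  moreover have "range (\<lambda>k. Inl (e k)) \<subseteq> carrier ?M" using p(2) by auto
  ultimately have "definable_subset L ?M (Inl ` X)"
    unfolding definable_subset_def using p(1) by blast
  from assms[unfolded o_minimal_def, rule_format, OF this]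
  obtain F where F: "finite F" "F \<subseteq> points_and_intervals ?M" "Inl ` X = \<Union>F"
    by (elim exE conjE)
  have "Inl -` S \<in> points_and_intervals M" if "S \<in> points_and_intervals ?M" for S
    using that unfolding points_and_intervals_def
  proof (elim UnE)
    assume "S \<in> {{c} | c. c \<in> carrier ?M}"
    then obtain c where "c \<in> carrier M" "S = {Inl c}" by auto
    then have "Inl -` S = {c}" by auto
    with \<open>c \<in> carrier M\<close> show "Inl -` S \<in> {{c} | c. c \<in> carrier M} \<union>
     {open_interval M a b | a b. set_option a \<subseteq> carrier M \<and> set_option b \<subseteq> carrier M}" by blast
  next
    assume "S \<in> {open_interval ?M a b | a b.
      set_option a \<subseteq> carrier ?M \<and> set_option b \<subseteq> carrier ?M}"
    then obtain a b where S: "S = open_interval ?M a b"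
      and a: "set_option a \<subseteq> Inl ` carrier M" and b: "set_option b \<subseteq> Inl ` carrier M" by auto
    have "Inl -` S = open_interval M (map_option projl a) (map_option projl b)"
      using a b by (cases a; cases b) (auto simp: S open_interval_def less_of_def)
    moreover have "set_option (map_option projl a) \<subseteq> carrier M" "set_option (map_option projl b) \<subseteq> carrier M"
      using a b by (auto simp: option.set_map)
    ultimately show "Inl -` S \<in> {{c} | c. c \<in> carrier M} \<union>
     {open_interval M a b | a b. set_option a \<subseteq> carrier M \<and> set_option b \<subseteq> carrier M}" by blast
  qed
  then have "(\<lambda>S. Inl -` S) ` F \<subseteq> points_and_intervals M" using F(2) by blast
  moreover have "X = \<Union>((\<lambda>S. Inl -` S) ` F)"
  proof -
    have "x \<in> X \<longleftrightarrow> (Inl x :: 'u + 'v) \<in> \<Union>F" for x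
      unfolding F(3)[symmetric] by auto
    then show ?thesis by auto
  qed
  ultimately show "\<exists>F. finite F \<and> F \<subseteq> points_and_intervals M \<and> X = \<Union>F"
    using F(1) by blast
qed

section \<open>Reading the ordered field axioms off their formulas\<close>

lemma sat_FAll: "sat M e (FAll x p) \<longleftrightarrow> (\<forall>a\<in>carrier M. sat M (e(x := a)) p)"
  by (simp add: FAll_def)

lemma sat_FAlls:
  assumes "sat M e (FAlls n p)" "range e \<subseteq> carrier M"
  shows "sat M e p"
proof -
  have "sat M e p" if "sat M e (foldr FAll xs p)" for xs
    using that
  proof (induction xs)
    case (Cons x xs)
    \<comment> \<open>Each quantifier is instantiated with the value that the variable already has,
      so the valuation does not change.\<close>
    then have "sat M (e(x := e x)) (foldr FAll xs p)"
      using assms(2) unfolding foldr.simps comp_def sat_FAll by blast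
    then show ?case using Cons.IH by simp
  qed simp
  then show ?thesis using assms(1) unfolding FAlls_def by blast
qed

lemma holds_FAllsD:
  assumes "holds_in M (FAlls n p)" "range e \<subseteq> carrier M"
  shows "sat M e p"
  using assms sat_FAlls unfolding holds_in_def by blast

locale ordered_field_struct = fo_struct L M
  for L :: "('a oring_fun, 'b oring_rel) lang" and M :: "('a, 'b, 'u) oring_struct" +
  assumes ext: "extends_oring L"
    and field_axioms: "\<forall>p\<in>ordered_field_axioms. holds_in M p"
begin

abbreviation add (infixl "\<oplus>" 65) where "x \<oplus> y \<equiv> add_of M x y"
abbreviation neg ("\<ominus> _" [80] 80) where "\<ominus> x \<equiv> neg_of M x"
abbreviation mul (infixl "\<otimes>" 70) where "x \<otimes> y \<equiv> mul_of M x y"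
abbreviation less (infix "\<prec>" 50) where "x \<prec> y \<equiv> less_of M x y"
abbreviation zero ("\<zero>") where "\<zero> \<equiv> zero_of M"
abbreviation one ("\<one>") where "\<one> \<equiv> fun_int M ROne []"

lemmas op_defs = add_of_def neg_of_def mul_of_def less_of_def zero_of_def

lemma closed [simp]:
  "\<zero> \<in> U" "\<one> \<in> U" "x \<in> U \<Longrightarrow> \<ominus> x \<in> U"
  "x \<in> U \<Longrightarrow> y \<in> U \<Longrightarrow> x \<oplus> y \<in> U" "x \<in> U \<Longrightarrow> y \<in> U \<Longrightarrow> x \<otimes> y \<in> U"
  using ext struct unfolding extends_oring_def is_struct_def tuples_def op_defs
  by auto

lemma
  assumes "x \<in> U" "y \<in> U" "z \<in> U"
  shows add_assoc: "x \<oplus> y \<oplus> z = x \<oplus> (y \<oplus> z)" and base_add_comm: "x \<oplus> y = y \<oplus> x"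
    and base_add_zero: "x \<oplus> \<zero> = x" and base_add_neg: "x \<oplus> \<ominus> x = \<zero>"
    and mul_assoc: "x \<otimes> y \<otimes> z = x \<otimes> (y \<otimes> z)" and base_mul_comm: "x \<otimes> y = y \<otimes> x"
    and base_mul_one: "x \<otimes> \<one> = x" and distrib: "x \<otimes> (y \<oplus> z) = x \<otimes> y \<oplus> x \<otimes> z"
    and base_zero_neq_one: "\<zero> \<noteq> \<one>" and base_ex_inverse: "x \<noteq> \<zero> \<Longrightarrow> \<exists>y\<in>U. x \<otimes> y = \<one>"
    and base_less_irrefl: "\<not> x \<prec> x" and less_trans: "x \<prec> y \<Longrightarrow> y \<prec> z \<Longrightarrow> x \<prec> z"
    and base_less_linear: "x \<prec> y \<or> x = y \<or> y \<prec> x"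
    and add_strict_right_mono: "x \<prec> y \<Longrightarrow> x \<oplus> z \<prec> y \<oplus> z"
    and base_mul_pos: "\<zero> \<prec> x \<Longrightarrow> \<zero> \<prec> y \<Longrightarrow> \<zero> \<prec> x \<otimes> y"
proof -
  define e where "e k = (if k = 0 then x else if k = Suc 0 then y else z)" for k :: nat
  have e: "range e \<subseteq> U" "e 0 = x" "e (Suc 0) = y" "e 1 = y" "e 2 = z"
    using assms by (auto simp: e_def)
  have sat_ax: "sat M e p" if "FAlls 3 p \<in> ordered_field_axioms" for p
    using field_axioms that holds_FAllsD[OF _ e(1)] by blast
  note S = sat_ax[unfolded ordered_field_axioms_def Let_def, OF imageI]
  show "x \<oplus> y \<oplus> z = x \<oplus> (y \<oplus> z)"
    using S[of "FEq (tadd (tadd (Var 0) (Var 1)) (Var 2)) (tadd (Var 0) (tadd (Var 1) (Var 2)))"]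
    by (simp add: e op_defs)
  show "x \<oplus> y = y \<oplus> x"
    using S[of "FEq (tadd (Var 0) (Var 1)) (tadd (Var 1) (Var 0))"] by (simp add: e op_defs)
  show "x \<oplus> \<zero> = x"
    using S[of "FEq (tadd (Var 0) t0) (Var 0)"] by (simp add: e op_defs)
  show "x \<oplus> \<ominus> x = \<zero>"
    using S[of "FEq (tadd (Var 0) (tneg (Var 0))) t0"] by (simp add: e op_defs)
  show "x \<otimes> y \<otimes> z = x \<otimes> (y \<otimes> z)"
    using S[of "FEq (tmul (tmul (Var 0) (Var 1)) (Var 2)) (tmul (Var 0) (tmul (Var 1) (Var 2)))"]
    by (simp add: e op_defs)
  show "x \<otimes> y = y \<otimes> x"
    using S[of "FEq (tmul (Var 0) (Var 1)) (tmul (Var 1) (Var 0))"] by (simp add: e op_defs)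
  show "x \<otimes> \<one> = x"
    using S[of "FEq (tmul (Var 0) t1) (Var 0)"] by (simp add: e op_defs)
  show "x \<otimes> (y \<oplus> z) = x \<otimes> y \<oplus> x \<otimes> z"
    using S[of "FEq (tmul (Var 0) (tadd (Var 1) (Var 2))) (tadd (tmul (Var 0) (Var 1)) (tmul (Var 0) (Var 2)))"]
    by (simp add: e op_defs)
  show "\<zero> \<noteq> \<one>"
    using S[of "FNot (FEq t0 t1)"] by (simp add: e op_defs)
  show "\<exists>y\<in>U. x \<otimes> y = \<one>" if "x \<noteq> \<zero>"
    using S[of "FImp (FNot (FEq (Var 0) t0)) (FEx 1 (FEq (tmul (Var 0) (Var 1)) t1))"] that
    by (simp add: e op_defs FImp_def)
  show "\<not> x \<prec> x"
    using S[of "FNot (fless (Var 0) (Var 0))"] by (simp add: e op_defs)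
  show "x \<prec> z" if "x \<prec> y" "y \<prec> z"
    using S[of "FImp (FAnd (fless (Var 0) (Var 1)) (fless (Var 1) (Var 2))) (fless (Var 0) (Var 2))"] that
    by (simp add: e op_defs FImp_def)
  show "x \<prec> y \<or> x = y \<or> y \<prec> x"
    using S[of "FOr (fless (Var 0) (Var 1)) (FOr (FEq (Var 0) (Var 1)) (fless (Var 1) (Var 0)))"]
    by (auto simp: e op_defs FOr_def)
  show "x \<oplus> z \<prec> y \<oplus> z" if "x \<prec> y"
    using S[of "FImp (fless (Var 0) (Var 1)) (fless (tadd (Var 0) (Var 2)) (tadd (Var 1) (Var 2)))"] that
    by (simp add: e op_defs FImp_def)
  show "\<zero> \<prec> x \<otimes> y" if "\<zero> \<prec> x" "\<zero> \<prec> y"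
    using S[of "FImp (FAnd (fless t0 (Var 0)) (fless t0 (Var 1))) (fless t0 (tmul (Var 0) (Var 1)))"] that
    by (simp add: e op_defs FImp_def)
qed

text \<open>The joint statement assumes three elements; the positions of variables that do not occur
  in an axiom are filled with \<open>\<zero>\<close>.\<close>

lemmas add_comm = base_add_comm[OF _ _ closed(1)]
  and add_zero [simp] = base_add_zero[OF _ closed(1,1)]
  and add_neg [simp] = base_add_neg[OF _ closed(1,1)]
  and mul_comm = base_mul_comm[OF _ _ closed(1)]
  and mul_one [simp] = base_mul_one[OF _ closed(1,1)]
  and zero_neq_one [simp] = base_zero_neq_one[OF closed(1,1,1)]
  and ex_inverse = base_ex_inverse[OF _ closed(1,1)]
  and less_irrefl [simp] = base_less_irrefl[OF _ closed(1,1)]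
  and less_linear = base_less_linear[OF _ _ closed(1)]
  and mul_pos = base_mul_pos[OF _ _ closed(1)]

section \<open>Arithmetic and order of the field\<close>

lemma add_lcomm: "x \<in> U \<Longrightarrow> y \<in> U \<Longrightarrow> z \<in> U \<Longrightarrow> x \<oplus> (y \<oplus> z) = y \<oplus> (x \<oplus> z)"
  by (metis add_assoc add_comm)

lemmas add_ac = add_assoc add_comm add_lcomm

lemma zero_add [simp]: "x \<in> U \<Longrightarrow> \<zero> \<oplus> x = x"
  by (metis add_comm add_zero closed(1))

lemma neg_add [simp]: "x \<in> U \<Longrightarrow> \<ominus> x \<oplus> x = \<zero>"
  by (metis add_comm add_neg closed(3))

lemma add_neg_cancel [simp]:
  "x \<in> U \<Longrightarrow> y \<in> U \<Longrightarrow> x \<oplus> (\<ominus> x \<oplus> y) = y" "x \<in> U \<Longrightarrow> y \<in> U \<Longrightarrow> \<ominus> x \<oplus> (x \<oplus> y) = y"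
  by (simp_all flip: add_assoc)

lemma add_neg_cancel_right [simp]:
  "x \<in> U \<Longrightarrow> y \<in> U \<Longrightarrow> y \<oplus> x \<oplus> \<ominus> x = y" "x \<in> U \<Longrightarrow> y \<in> U \<Longrightarrow> y \<oplus> \<ominus> x \<oplus> x = y"
  by (simp_all add: add_assoc)

lemma add_left_cancel: "x \<in> U \<Longrightarrow> y \<in> U \<Longrightarrow> z \<in> U \<Longrightarrow> x \<oplus> y = x \<oplus> z \<longleftrightarrow> y = z"
  by (metis add_neg_cancel(2))

lemma neg_unique: "x \<in> U \<Longrightarrow> y \<in> U \<Longrightarrow> x \<oplus> y = \<zero> \<Longrightarrow> \<ominus> x = y"
  by (metis add_neg_cancel(2) add_zero closed(3))

lemma neg_neg [simp]: "x \<in> U \<Longrightarrow> \<ominus> \<ominus> x = x"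
  by (simp add: neg_unique)

lemma neg_zero [simp]: "\<ominus> \<zero> = \<zero>"
  by (simp add: neg_unique)

lemma neg_add_distrib: "x \<in> U \<Longrightarrow> y \<in> U \<Longrightarrow> \<ominus> (x \<oplus> y) = \<ominus> x \<oplus> \<ominus> y"
proof (rule neg_unique)
  assume "x \<in> U" "y \<in> U"
  then have "x \<oplus> y \<oplus> (\<ominus> x \<oplus> \<ominus> y) = x \<oplus> (\<ominus> x \<oplus> (y \<oplus> \<ominus> y))"
    by (simp only: add_ac closed)
  with \<open>x \<in> U\<close> \<open>y \<in> U\<close> show "x \<oplus> y \<oplus> (\<ominus> x \<oplus> \<ominus> y) = \<zero>" by simp
qed simp_all

lemma mul_zero [simp]: "x \<in> U \<Longrightarrow> x \<otimes> \<zero> = \<zero>"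
proof -
  assume x: "x \<in> U"
  then have "x \<otimes> \<zero> \<oplus> x \<otimes> \<zero> = x \<otimes> \<zero> \<oplus> \<zero>"
    by (simp flip: distrib)
  with x show ?thesis by (simp add: add_left_cancel del: add_zero)
qed

lemma distrib_right: "x \<in> U \<Longrightarrow> y \<in> U \<Longrightarrow> z \<in> U \<Longrightarrow> (x \<oplus> y) \<otimes> z = x \<otimes> z \<oplus> y \<otimes> z"
  by (simp add: distrib mul_comm[of _ z])

lemma mul_neg: "x \<in> U \<Longrightarrow> y \<in> U \<Longrightarrow> x \<otimes> \<ominus> y = \<ominus> (x \<otimes> y)"
  by (rule neg_unique[symmetric]) (simp_all flip: distrib)

lemma neg_mul: "x \<in> U \<Longrightarrow> y \<in> U \<Longrightarrow> \<ominus> x \<otimes> y = \<ominus> (x \<otimes> y)"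
  by (simp add: mul_neg mul_comm[of _ y])

lemma less_asym: "x \<in> U \<Longrightarrow> y \<in> U \<Longrightarrow> x \<prec> y \<Longrightarrow> \<not> y \<prec> x"
  by (metis less_irrefl less_trans)

text \<open>The language has only the strict order; \<open>\<not> y \<prec> x\<close> takes the
  place of x \<le> y here and below.\<close>

lemma less_le_trans: "x \<in> U \<Longrightarrow> y \<in> U \<Longrightarrow> z \<in> U \<Longrightarrow> x \<prec> y \<Longrightarrow> \<not> z \<prec> y \<Longrightarrow> x \<prec> z"
  by (metis less_linear less_trans)

lemma le_less_trans: "x \<in> U \<Longrightarrow> y \<in> U \<Longrightarrow> z \<in> U \<Longrightarrow> \<not> y \<prec> x \<Longrightarrow> y \<prec> z \<Longrightarrow> x \<prec> z"
  by (metis less_linear less_trans)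

lemma le_trans: "x \<in> U \<Longrightarrow> y \<in> U \<Longrightarrow> z \<in> U \<Longrightarrow> \<not> y \<prec> x \<Longrightarrow> \<not> z \<prec> y \<Longrightarrow> \<not> z \<prec> x"
  by (metis less_linear less_trans)

lemma add_less_cancel_right [simp]:
  "x \<in> U \<Longrightarrow> y \<in> U \<Longrightarrow> z \<in> U \<Longrightarrow> x \<oplus> z \<prec> y \<oplus> z \<longleftrightarrow> x \<prec> y"
  by (metis add_strict_right_mono closed(3) closed(4) add_neg_cancel_right(1))

lemma add_less_cancel_left [simp]:
  "x \<in> U \<Longrightarrow> y \<in> U \<Longrightarrow> z \<in> U \<Longrightarrow> z \<oplus> x \<prec> z \<oplus> y \<longleftrightarrow> x \<prec> y"
  by (simp add: add_comm[of z])

lemma add_less_le_mono: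
  assumes "x \<in> U" "y \<in> U" "z \<in> U" "w \<in> U" "\<not> y \<prec> x" "z \<prec> w"
  shows "x \<oplus> z \<prec> y \<oplus> w"
  using assms by (intro le_less_trans[of "x \<oplus> z" "y \<oplus> z" "y \<oplus> w"]) simp_all

lemma sub_less_iff: "x \<in> U \<Longrightarrow> y \<in> U \<Longrightarrow> z \<in> U \<Longrightarrow> x \<oplus> \<ominus> y \<prec> z \<longleftrightarrow> x \<prec> z \<oplus> y"
  using add_less_cancel_right[of "x \<oplus> \<ominus> y" z y] by simp

lemma less_sub_iff: "x \<in> U \<Longrightarrow> y \<in> U \<Longrightarrow> z \<in> U \<Longrightarrow> x \<prec> y \<oplus> \<ominus> z \<longleftrightarrow> x \<oplus> z \<prec> y"
  using add_less_cancel_right[of x "y \<oplus> \<ominus> z" z] by simp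

lemma neg_less_neg [simp]: "x \<in> U \<Longrightarrow> y \<in> U \<Longrightarrow> \<ominus> x \<prec> \<ominus> y \<longleftrightarrow> y \<prec> x"
  by (metis add_comm closed(1,3) less_sub_iff sub_less_iff zero_add)

lemma neg_less_iff: "x \<in> U \<Longrightarrow> y \<in> U \<Longrightarrow> \<ominus> x \<prec> y \<longleftrightarrow> \<ominus> y \<prec> x"
  using neg_less_neg[of x "\<ominus> y"] by simp

lemma less_neg_iff: "x \<in> U \<Longrightarrow> y \<in> U \<Longrightarrow> x \<prec> \<ominus> y \<longleftrightarrow> y \<prec> \<ominus> x"
  using neg_less_neg[of "\<ominus> x" y] by simp

lemma zero_less_sub: "x \<in> U \<Longrightarrow> y \<in> U \<Longrightarrow> \<zero> \<prec> y \<oplus> \<ominus> x \<longleftrightarrow> x \<prec> y"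
  by (simp add: less_sub_iff)

lemma zero_less_one [simp]: "\<zero> \<prec> \<one>"
proof (rule ccontr)
  assume "\<not> \<zero> \<prec> \<one>"
  then have "\<one> \<prec> \<zero>" using less_linear[of \<zero> \<one>] by auto
  then have "\<zero> \<prec> \<ominus> \<one>" using less_neg_iff[of \<zero> \<one>] by simp
  from mul_pos[OF _ _ this this] have "\<zero> \<prec> \<one>"
    by (simp add: mul_neg neg_mul)
  with \<open>\<not> \<zero> \<prec> \<one>\<close> show False by simp
qed

lemma less_add_pos: "x \<in> U \<Longrightarrow> r \<in> U \<Longrightarrow> \<zero> \<prec> r \<Longrightarrow> x \<prec> x \<oplus> r"
  using add_less_cancel_left[of \<zero> r x] by simp

lemma sub_pos_less: "x \<in> U \<Longrightarrow> r \<in> U \<Longrightarrow> \<zero> \<prec> r \<Longrightarrow> x \<oplus> \<ominus> r \<prec> x"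
  by (simp add: sub_less_iff less_add_pos)

lemma mul_strict_right_mono:
  assumes "x \<in> U" "y \<in> U" "z \<in> U" "x \<prec> y" "\<zero> \<prec> z"
  shows "z \<otimes> x \<prec> z \<otimes> y"
proof -
  have "\<zero> \<prec> z \<otimes> (y \<oplus> \<ominus> x)"
    using assms by (intro mul_pos) (simp_all add: zero_less_sub)
  then show ?thesis using assms by (simp add: distrib mul_neg zero_less_sub)
qed

section \<open>Halves, midpoints and neighbourhoods\<close>

definition half :: 'u where
  "half = (SOME h. h \<in> U \<and> h \<oplus> h = \<one>)"

lemma half_prop: "half \<in> U" "half \<oplus> half = \<one>"
proof -
  have "\<zero> \<prec> \<one> \<oplus> \<one>"
    using less_trans[of \<zero> \<one> "\<one> \<oplus> \<one>"] less_add_pos[of \<one> \<one>] by simp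
  then have "\<one> \<oplus> \<one> \<noteq> \<zero>" by auto
  then obtain h where "h \<in> U" "(\<one> \<oplus> \<one>) \<otimes> h = \<one>"
    using ex_inverse[of "\<one> \<oplus> \<one>"] by auto
  then have "h \<in> U \<and> h \<oplus> h = \<one>"
    using mul_comm[of \<one> h] by (simp add: distrib_right)
  then have "half \<in> U \<and> half \<oplus> half = \<one>" unfolding half_def by (rule someI)
  then show "half \<in> U" "half \<oplus> half = \<one>" by auto
qed

lemmas half_closed [simp] = half_prop(1)

lemma half_pos: "\<zero> \<prec> half"
proof (rule ccontr)
  assume h: "\<not> \<zero> \<prec> half"
  have "half \<oplus> half \<noteq> \<zero>" using half_prop by (metis zero_neq_one closed(1))
  then have "half \<noteq> \<zero>" by auto
  with h have "half \<prec> \<zero>" using less_linear[of \<zero> half] half_prop by auto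
  then have "half \<oplus> half \<prec> \<zero>"
    using less_trans[of "half \<oplus> half" half \<zero>] add_less_cancel_left[of half \<zero> half] half_prop by simp
  then show False using zero_less_one less_asym[of \<zero> \<one>] half_prop by simp
qed

definition mid :: "'u \<Rightarrow> 'u \<Rightarrow> 'u" where
  "mid x y = x \<oplus> half \<otimes> (y \<oplus> \<ominus> x)"

lemma mid_closed [simp]: "x \<in> U \<Longrightarrow> y \<in> U \<Longrightarrow> mid x y \<in> U"
  by (simp add: mid_def)

lemma half_half: "x \<in> U \<Longrightarrow> half \<otimes> x \<oplus> half \<otimes> x = x"
  by (metis distrib_right half_closed half_prop(2) mul_comm mul_one closed(2))

lemma mid_less:
  assumes "x \<in> U" "y \<in> U" "x \<prec> y"
  shows "x \<prec> mid x y" "mid x y \<prec> y"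
proof -
  have d: "\<zero> \<prec> half \<otimes> (y \<oplus> \<ominus> x)"
    using assms half_pos by (intro mul_pos) (simp_all add: zero_less_sub)
  then show "x \<prec> mid x y" unfolding mid_def using assms by (simp add: less_add_pos)
  have "mid x y \<prec> mid x y \<oplus> half \<otimes> (y \<oplus> \<ominus> x)"
    using d assms by (intro less_add_pos) simp_all
  also have "mid x y \<oplus> half \<otimes> (y \<oplus> \<ominus> x) = x \<oplus> (half \<otimes> (y \<oplus> \<ominus> x) \<oplus> half \<otimes> (y \<oplus> \<ominus> x))"
    unfolding mid_def using assms by (simp add: add_assoc)
  also have "\<dots> = y" using assms by (simp add: half_half add_comm[of x])
  finally show "mid x y \<prec> y" .
qed

lemma dense: "x \<in> U \<Longrightarrow> y \<in> U \<Longrightarrow> x \<prec> y \<Longrightarrow> \<exists>z\<in>U. x \<prec> z \<and> z \<prec> y"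
  by (intro bexI[of _ "mid x y"]) (simp_all add: mid_less)

lemma ex_greater: "x \<in> U \<Longrightarrow> \<exists>y\<in>U. x \<prec> y"
  using less_add_pos[of x \<one>] by (intro bexI[of _ "x \<oplus> \<one>"]) simp_all

lemma ex_less: "x \<in> U \<Longrightarrow> \<exists>y\<in>U. y \<prec> x"
  using sub_pos_less[of x \<one>] by (intro bexI[of _ "x \<oplus> \<ominus> \<one>"]) simp_all

definition maxi :: "'u \<Rightarrow> 'u \<Rightarrow> 'u" where "maxi x y = (if x \<prec> y then y else x)"
definition mini :: "'u \<Rightarrow> 'u \<Rightarrow> 'u" where "mini x y = (if x \<prec> y then x else y)"

lemma maxi_closed [simp]: "x \<in> U \<Longrightarrow> y \<in> U \<Longrightarrow> maxi x y \<in> U"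
  by (simp add: maxi_def)

lemma mini_closed [simp]: "x \<in> U \<Longrightarrow> y \<in> U \<Longrightarrow> mini x y \<in> U"
  by (simp add: mini_def)

lemma maxi_less [simp]: "x \<in> U \<Longrightarrow> y \<in> U \<Longrightarrow> z \<in> U \<Longrightarrow> maxi x y \<prec> z \<longleftrightarrow> x \<prec> z \<and> y \<prec> z"
  using less_trans[of x y z] le_less_trans[of y x z] by (auto simp: maxi_def)

lemma less_mini [simp]: "x \<in> U \<Longrightarrow> y \<in> U \<Longrightarrow> z \<in> U \<Longrightarrow> z \<prec> mini x y \<longleftrightarrow> z \<prec> x \<and> z \<prec> y"
  using less_trans[of z x y] less_le_trans[of z y x] by (auto simp: mini_def)

text \<open>Spelled exactly as the condition inside \<open>in_box\<close>, so that the
  neighbourhoods of the proof are the boxes of the statement.\<close>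

definition nearby :: "'u \<Rightarrow> 'u \<Rightarrow> 'u \<Rightarrow> bool" where
  "nearby r x y \<longleftrightarrow> abs_of M (sub_of M y x) \<prec> r"

lemma nearby_iff:
  assumes "x \<in> U" "y \<in> U" "r \<in> U" "\<zero> \<prec> r"
  shows "nearby r x y \<longleftrightarrow> x \<oplus> \<ominus> r \<prec> y \<and> y \<prec> x \<oplus> r"
proof (cases "y \<prec> x")
  case True
  then have "y \<oplus> \<ominus> x \<prec> \<zero>" using assms by (simp add: sub_less_iff)
  then have "nearby r x y \<longleftrightarrow> x \<oplus> \<ominus> y \<prec> r"
    using assms by (simp add: nearby_def abs_of_def sub_of_def neg_add_distrib add_comm[of "\<ominus> y"])
  also have "\<dots> \<longleftrightarrow> x \<oplus> \<ominus> r \<prec> y" using assms by (simp add: sub_less_iff add_comm[of y])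
  also have "\<dots> \<longleftrightarrow> x \<oplus> \<ominus> r \<prec> y \<and> y \<prec> x \<oplus> r"
    using less_trans[of y x "x \<oplus> r"] less_add_pos[of x r] True assms by simp
  finally show ?thesis .
next
  case False
  then have "\<not> y \<oplus> \<ominus> x \<prec> \<zero>" using assms by (simp add: sub_less_iff)
  then have "nearby r x y \<longleftrightarrow> y \<oplus> \<ominus> x \<prec> r"
    using assms by (simp add: nearby_def abs_of_def sub_of_def)
  also have "\<dots> \<longleftrightarrow> y \<prec> x \<oplus> r" using assms by (simp add: sub_less_iff add_comm[of r])
  also have "\<dots> \<longleftrightarrow> x \<oplus> \<ominus> r \<prec> y \<and> y \<prec> x \<oplus> r"
    using less_le_trans[of "x \<oplus> \<ominus> r" x y] sub_pos_less[of x r] False assms by simp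
  finally show ?thesis .
qed

lemma nearby_refl: "x \<in> U \<Longrightarrow> r \<in> U \<Longrightarrow> \<zero> \<prec> r \<Longrightarrow> nearby r x x"
  by (simp add: nearby_iff sub_pos_less less_add_pos)

lemma ex_nearby:
  assumes "x \<in> U" "p \<in> U" "q \<in> U" "p \<prec> x" "x \<prec> q"
  shows "\<exists>r\<in>U. \<zero> \<prec> r \<and> (\<forall>y\<in>U. nearby r x y \<longrightarrow> p \<prec> y \<and> y \<prec> q)"
proof -
  define r where "r = mini (x \<oplus> \<ominus> p) (q \<oplus> \<ominus> x)"
  have r: "r \<in> U" "\<zero> \<prec> r" "\<not> x \<oplus> \<ominus> p \<prec> r" "\<not> q \<oplus> \<ominus> x \<prec> r"
    using assms less_asym[of "x \<oplus> \<ominus> p" "q \<oplus> \<ominus> x"] by (simp_all add: r_def zero_less_sub mini_def)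
  have "p \<prec> y \<and> y \<prec> q" if "y \<in> U" "nearby r x y" for y
  proof
    have "\<not> x \<oplus> \<ominus> r \<prec> p" using r(1,3) assms by (simp add: sub_less_iff add_comm[of p])
    moreover have "x \<oplus> \<ominus> r \<prec> y" using that nearby_iff[of x y r] r assms by simp
    ultimately show "p \<prec> y" using that assms r le_less_trans[of p "x \<oplus> \<ominus> r" y] by simp
    have "\<not> q \<prec> x \<oplus> r" using r(1,4) assms by (simp add: sub_less_iff add_comm[of r])
    moreover have "y \<prec> x \<oplus> r" using that nearby_iff[of x y r] r assms by simp
    ultimately show "y \<prec> q" using that assms r less_le_trans[of y "x \<oplus> r" q] by simp
  qed
  with r show ?thesis by blast
qed

lemma nearby_mono:
  "nearby r x y \<Longrightarrow> \<not> r' \<prec> r \<Longrightarrow> x \<in> U \<Longrightarrow> y \<in> U \<Longrightarrow> r \<in> U \<Longrightarrow> r' \<in> U \<Longrightarrow> nearby r' x y"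
  unfolding nearby_def
  by (rule less_le_trans) (simp_all add: abs_of_def sub_of_def)

lemma nearby_mini:
  assumes "nearby (mini r r') x y" "x \<in> U" "y \<in> U" "r \<in> U" "r' \<in> U"
  shows "nearby r x y" "nearby r' x y"
  using assms nearby_mono[OF assms(1), of r] nearby_mono[OF assms(1), of r'] less_asym[of r r']
  by (simp_all add: mini_def split: if_splits)

text \<open>The triangle inequality, in the form that makes interiors open.\<close>

lemma nearby_half:
  assumes "nearby (half \<otimes> r) x y" "nearby (half \<otimes> r) y z" "x \<in> U" "y \<in> U" "z \<in> U" "r \<in> U" "\<zero> \<prec> r"
  shows "nearby r x z"
proof -
  let ?h = "half \<otimes> r"
  have h: "?h \<in> U" "\<zero> \<prec> ?h" using assms mul_pos[of half r] half_pos by auto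
  have 1: "x \<oplus> \<ominus> ?h \<prec> y" "y \<prec> x \<oplus> ?h"
    using assms h nearby_iff[of x y ?h] by simp_all
  have 2: "y \<oplus> \<ominus> ?h \<prec> z" "z \<prec> y \<oplus> ?h"
    using assms h nearby_iff[of y z ?h] by simp_all
  have "z \<prec> x \<oplus> ?h \<oplus> ?h"
    using 1(2) 2(2) assms h less_trans[of z "y \<oplus> ?h" "x \<oplus> ?h \<oplus> ?h"] by simp
  then have u: "z \<prec> x \<oplus> r" using assms by (simp add: add_assoc half_half)
  have "x \<oplus> \<ominus> ?h \<oplus> \<ominus> ?h \<prec> z"
    using 1(1) 2(1) assms h less_trans[of "x \<oplus> \<ominus> ?h \<oplus> \<ominus> ?h" "y \<oplus> \<ominus> ?h" z] by simp
  moreover have "x \<oplus> \<ominus> ?h \<oplus> \<ominus> ?h = x \<oplus> \<ominus> r"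
    using assms half_half[of r] neg_add_distrib[of ?h ?h] by (simp add: add_assoc)
  ultimately show ?thesis using u assms nearby_iff by simp
qed

section \<open>Definability of the field operations\<close>

lemma definable_less:
  assumes "dterm A s" "dterm A t"
  shows "definable A (\<lambda>e. s e \<prec> t e)"
proof -
  have "definable A (\<lambda>e. sat M e (fless (Var 1) (Var 0)))"
    using ext by (intro definable_sat) (simp add: extends_oring_def)
  then have "definable A (\<lambda>e. e 1 \<prec> e 0)" by (simp add: less_of_def)
  from definable_rename[OF this, of "\<lambda>k. if k = 0 then 0 else Suc 0"]
  have base: "definable A (\<lambda>e. e 1 \<prec> e 0)" by simp
  have "definable A (\<lambda>e. s (\<lambda>k. e (Suc k)) \<prec> e 0)"
    using definable_let[OF dterm_rename[OF assms(1), of Suc], of "\<lambda>a e. a \<prec> e 0"]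
      definable_rename[OF base, of "\<lambda>k. if k = 0 then Suc 0 else 0"] by simp
  then show ?thesis
    using definable_let[OF assms(2), of "\<lambda>a e. s e \<prec> a"] by simp
qed

lemma dterm_zero: "dterm A (\<lambda>e. \<zero>)"
  using dterm_eval[of t0] ext by (simp add: extends_oring_def zero_of_def)

lemma dterm_one: "dterm A (\<lambda>e. \<one>)"
  using dterm_eval[of t1] ext by (simp add: extends_oring_def)

lemma dterm_neg:
  assumes "dterm A s"
  shows "dterm A (\<lambda>e. \<ominus> (s e))"
proof -
  have "dterm A (\<lambda>e. \<ominus> (e 0))"
    using dterm_eval[of "tneg (Var 0)"] ext by (simp add: extends_oring_def neg_of_def)
  then show ?thesis using dterm_subst[OF assms, of "\<lambda>a e. \<ominus> a"] by simp
qed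

lemma dterm_binary:
  assumes "dterm A (\<lambda>e. h (e 1) (e 0))" "dterm A s" "dterm A t"
  shows "dterm A (\<lambda>e. h (s e) (t e))"
proof -
  have "dterm A (\<lambda>e. h (s (\<lambda>k. e (Suc k))) (e 0))"
    using dterm_subst[OF dterm_rename[OF assms(2), of Suc], of "\<lambda>a e. h a (e 0)"]
      dterm_rename[OF assms(1), of "\<lambda>k. if k = 0 then Suc 0 else 0"] by simp
  then show ?thesis
    using dterm_subst[OF assms(3), of "\<lambda>a e. h (s e) a"] by simp
qed

lemma dterm_add: "dterm A s \<Longrightarrow> dterm A t \<Longrightarrow> dterm A (\<lambda>e. s e \<oplus> t e)"
  by (rule dterm_binary[where h = "\<lambda>x y. x \<oplus> y"])
    (use dterm_eval[of "tadd (Var 1) (Var 0)" A] ext in \<open>simp_all add: extends_oring_def add_of_def\<close>)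

lemma dterm_mul: "dterm A s \<Longrightarrow> dterm A t \<Longrightarrow> dterm A (\<lambda>e. s e \<otimes> t e)"
  by (rule dterm_binary[where h = "\<lambda>x y. x \<otimes> y"])
    (use dterm_eval[of "tmul (Var 1) (Var 0)" A] ext in \<open>simp_all add: extends_oring_def mul_of_def\<close>)

text \<open>Although \<open>half\<close> is introduced by a choice, it is the only solution of x + x
  = 1 and hence definable without parameters.\<close>

lemma dterm_half: "dterm A (\<lambda>e. half)"
proof -
  have "x = half \<longleftrightarrow> x \<oplus> x = \<one>" if x: "x \<in> U" for x
  proof
    assume h: "x \<oplus> x = \<one>"
    have "half \<otimes> x \<oplus> half \<otimes> x = half \<otimes> (x \<oplus> x)" using x by (simp add: distrib)
    then show "x = half" using h half_half[OF x] by simp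
  qed (use half_prop in auto)
  moreover have "definable A (\<lambda>e. e 0 \<oplus> e 0 = \<one>)"
    by (intro definable_eq dterm_add dterm_one dterm_var)
  ultimately show ?thesis
    unfolding dterm_def by (simp cong: definable_cong)
qed

lemma dterm_mid: "dterm A s \<Longrightarrow> dterm A t \<Longrightarrow> dterm A (\<lambda>e. mid (s e) (t e))"
  unfolding mid_def by (intro dterm_add dterm_mul dterm_half dterm_neg)

lemma definable_nearby:
  assumes "dterm A r" "dterm A s" "dterm A t"
  shows "definable A (\<lambda>e. nearby (r e) (s e) (t e))"
proof -
  have "definable A (\<lambda>e. (sub_of M (t e) (s e) \<prec> \<zero> \<and> \<ominus> (sub_of M (t e) (s e)) \<prec> r e) \<or>
     (\<not> sub_of M (t e) (s e) \<prec> \<zero> \<and> sub_of M (t e) (s e) \<prec> r e))"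
    unfolding sub_of_def
    by (intro definable_disj definable_conj definable_not definable_less dterm_neg dterm_add dterm_zero assms)
  moreover have "nearby (r e) (s e) (t e) \<longleftrightarrow>
     (sub_of M (t e) (s e) \<prec> \<zero> \<and> \<ominus> (sub_of M (t e) (s e)) \<prec> r e) \<or>
     (\<not> sub_of M (t e) (s e) \<prec> \<zero> \<and> sub_of M (t e) (s e) \<prec> r e)" for e
    by (simp add: nearby_def abs_of_def)
  ultimately show ?thesis by simp
qed

lemmas field_intros = definable_intros definable_less definable_nearby
  dterm_add dterm_mul dterm_neg dterm_zero dterm_one dterm_half dterm_mid

end

section \<open>One-variable definable sets\<close>

locale o_minimal_field = ordered_field_struct L M
  for L :: "('a oring_fun, 'b oring_rel) lang" and M :: "('a, 'b, 'u) oring_struct" +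
  assumes omin: "o_minimal L M"
begin

lemma dset_definable_subset:
  assumes "dset U X"
  shows "definable_subset L M X"
proof -
  from assms obtain p s where p: "is_formula L p" "\<forall>k a. s k = Inr a \<longrightarrow> a \<in> U"
    "\<forall>e\<in>vals. e 0 \<in> X \<longleftrightarrow> sat M (\<lambda>k. pval e (s k)) p"
    unfolding dset_def definable_def by blast
  \<comment> \<open>Variables that read a coordinate are all sent to \<open>0\<close>, those that
    carry a parameter to \<open>Suc k\<close>, where \<open>e0\<close> stores it. Merging the
    coordinates is harmless: membership depends on coordinate \<open>0\<close> alone, so a constant
    valuation may be used.\<close>
  define \<pi> where "\<pi> k = (case s k of Inl i \<Rightarrow> 0 | Inr a \<Rightarrow> Suc k)" for k
  define e0 where "e0 k = (case s (k - 1) of Inl i \<Rightarrow> \<zero> | Inr a \<Rightarrow> a)" for k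
  obtain q where q: "is_formula L q" "\<forall>e. sat M e q = sat M (\<lambda>k. e (\<pi> k)) p"
    using ex_renaming[OF p(1)] by metis
  have "e0 k \<in> U" for k using p(2) by (auto simp: e0_def split: sum.splits)
  then have "range e0 \<subseteq> U" by auto
  moreover have "(\<lambda>k. (e0(0 := x)) (\<pi> k)) = (\<lambda>k. pval (\<lambda>_. x) (s k))" for x
    by (auto simp: fun_eq_iff \<pi>_def e0_def pval_def split: sum.splits)
  then have "x \<in> X \<longleftrightarrow> sat M (e0(0 := x)) q" if "x \<in> U" for x
    using p(3)[rule_format, of "\<lambda>_. x"] q(2) that by (simp add: vals_def)
  then have "X = {x \<in> U. sat M (e0(0 := x)) q}"
    using assms by (auto simp: dset_def)
  ultimately show ?thesis unfolding definable_subset_def using q(1) by blast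
qed

text \<open>O-minimality as an induction rule over finite unions of points and intervals. The union
  case asks only for subsets of the carrier, so definability need not be carried through the
  induction.\<close>

lemma dset_induct [consumes 1, case_names empty single interval union]:
  assumes "dset U X"
    and "Q {}" "\<And>c. c \<in> U \<Longrightarrow> Q {c}"
    and "\<And>a b. set_option a \<subseteq> U \<Longrightarrow> set_option b \<subseteq> U \<Longrightarrow> Q (open_interval M a b)"
    and "\<And>X Y. X \<subseteq> U \<Longrightarrow> Y \<subseteq> U \<Longrightarrow> Q X \<Longrightarrow> Q Y \<Longrightarrow> Q (X \<union> Y)"
  shows "Q X"
proof -
  obtain F where F: "finite F" "F \<subseteq> points_and_intervals M" "X = \<Union>F"
    using omin[unfolded o_minimal_def, rule_format, OF dset_definable_subset[OF assms(1)]]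
    by (elim exE conjE)
  have "\<Union>F \<subseteq> U \<and> Q (\<Union>F)"
    using F(1,2)
  proof (induction F rule: finite_induct)
    case (insert S F)
    then have S: "S \<in> points_and_intervals M" by simp
    have "S \<subseteq> U \<and> Q S"
    proof (cases "\<exists>c\<in>U. S = {c}")
      case False
      then obtain a b where "S = open_interval M a b" "set_option a \<subseteq> U" "set_option b \<subseteq> U"
        using S unfolding points_and_intervals_def by auto
      moreover have "open_interval M a b \<subseteq> U" by (auto simp: open_interval_def)
      ultimately show ?thesis using assms(4) by simp
    qed (use assms(3) in auto)
    with insert show ?case using assms(5) by simp
  qed (simp add: assms(2))
  then show ?thesis using F(3) by simp
qed

section \<open>One-sided germs\<close>

definition ivl :: "'u \<Rightarrow> 'u \<Rightarrow> 'u set" where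
  "ivl p q = {x \<in> U. p \<prec> x \<and> x \<prec> q}"

text \<open>To be read as "eventually from the right": a property of the right germ at
  \<open>x\<close>, which says nothing about \<open>x\<close> itself. \<open>evl\<close> is the left
  counterpart.\<close>

definition evr :: "'u \<Rightarrow> ('u \<Rightarrow> bool) \<Rightarrow> bool" where
  "evr x P \<longleftrightarrow> (\<exists>q\<in>U. x \<prec> q \<and> (\<forall>y\<in>U. x \<prec> y \<longrightarrow> y \<prec> q \<longrightarrow> P y))"

definition evl :: "'u \<Rightarrow> ('u \<Rightarrow> bool) \<Rightarrow> bool" where
  "evl x P \<longleftrightarrow> (\<exists>p\<in>U. p \<prec> x \<and> (\<forall>y\<in>U. p \<prec> y \<longrightarrow> y \<prec> x \<longrightarrow> P y))"

lemma evr_mono: "evr x P \<Longrightarrow> (\<And>y. y \<in> U \<Longrightarrow> x \<prec> y \<Longrightarrow> P y \<Longrightarrow> Q y) \<Longrightarrow> evr x Q"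
  unfolding evr_def by meson

lemma evl_mono: "evl x P \<Longrightarrow> (\<And>y. y \<in> U \<Longrightarrow> y \<prec> x \<Longrightarrow> P y \<Longrightarrow> Q y) \<Longrightarrow> evl x Q"
  unfolding evl_def by meson

lemma evr_conj:
  assumes "evr x P" "evr x Q" "x \<in> U"
  shows "evr x (\<lambda>y. P y \<and> Q y)"
proof -
  from assms(1) obtain q where "q \<in> U" "x \<prec> q" "\<forall>y\<in>U. x \<prec> y \<longrightarrow> y \<prec> q \<longrightarrow> P y"
    unfolding evr_def by blast
  moreover from assms(2) obtain q' where "q' \<in> U" "x \<prec> q'" "\<forall>y\<in>U. x \<prec> y \<longrightarrow> y \<prec> q' \<longrightarrow> Q y"
    unfolding evr_def by blast
  ultimately show ?thesis unfolding evr_def using assms(3) by (intro bexI[of _ "mini q q'"]) simp_all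
qed

lemma evl_conj:
  assumes "evl x P" "evl x Q" "x \<in> U"
  shows "evl x (\<lambda>y. P y \<and> Q y)"
proof -
  from assms(1) obtain q where "q \<in> U" "q \<prec> x" "\<forall>y\<in>U. q \<prec> y \<longrightarrow> y \<prec> x \<longrightarrow> P y"
    unfolding evl_def by blast
  moreover from assms(2) obtain q' where "q' \<in> U" "q' \<prec> x" "\<forall>y\<in>U. q' \<prec> y \<longrightarrow> y \<prec> x \<longrightarrow> Q y"
    unfolding evl_def by blast
  ultimately show ?thesis unfolding evl_def using assms(3) by (intro bexI[of _ "maxi q q'"]) simp_all
qed

lemma evr_less: "x \<in> U \<Longrightarrow> q \<in> U \<Longrightarrow> x \<prec> q \<Longrightarrow> evr x (\<lambda>y. y \<prec> q)"
  unfolding evr_def by blast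

lemma evl_greater: "x \<in> U \<Longrightarrow> p \<in> U \<Longrightarrow> p \<prec> x \<Longrightarrow> evl x (\<lambda>y. p \<prec> y)"
  unfolding evl_def by blast

lemma evr_trivial: "x \<in> U \<Longrightarrow> evr x (\<lambda>y. x \<prec> y)"
  using ex_greater unfolding evr_def by blast

lemma evl_trivial: "x \<in> U \<Longrightarrow> evl x (\<lambda>y. y \<prec> x)"
  using ex_less unfolding evl_def by blast

lemma evr_ex: "evr x P \<Longrightarrow> x \<in> U \<Longrightarrow> \<exists>y\<in>U. x \<prec> y \<and> P y"
  using dense unfolding evr_def by metis

lemma evl_ex: "evl x P \<Longrightarrow> x \<in> U \<Longrightarrow> \<exists>y\<in>U. y \<prec> x \<and> P y"
  using dense unfolding evl_def by metis

lemma evr_ex_less: "evr x P \<Longrightarrow> x \<in> U \<Longrightarrow> q \<in> U \<Longrightarrow> x \<prec> q \<Longrightarrow> \<exists>y\<in>U. x \<prec> y \<and> y \<prec> q \<and> P y"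
  using evr_ex[OF evr_conj[OF evr_less]] by meson

lemma evl_ex_greater: "evl x P \<Longrightarrow> x \<in> U \<Longrightarrow> p \<in> U \<Longrightarrow> p \<prec> x \<Longrightarrow> \<exists>y\<in>U. p \<prec> y \<and> y \<prec> x \<and> P y"
  using evl_ex[OF evl_conj[OF evl_greater]] by meson

lemma evr_neg: "x \<in> U \<Longrightarrow> evr x (\<lambda>y. P (\<ominus> y)) \<longleftrightarrow> evl (\<ominus> x) P"
proof
  assume x: "x \<in> U"
  { assume "evr x (\<lambda>y. P (\<ominus> y))"
    then obtain q where q: "q \<in> U" "x \<prec> q" "\<forall>y\<in>U. x \<prec> y \<longrightarrow> y \<prec> q \<longrightarrow> P (\<ominus> y)"
      unfolding evr_def by blast
    have "P y" if "y \<in> U" "\<ominus> q \<prec> y" "y \<prec> \<ominus> x" for y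
      using q(3)[rule_format, of "\<ominus> y"] that q(1) x neg_less_iff[of q y] less_neg_iff[of y x] by simp
    then show "evl (\<ominus> x) P" unfolding evl_def using q x by (intro bexI[of _ "\<ominus> q"]) simp_all }
  { assume "evl (\<ominus> x) P"
    then obtain q where q: "q \<in> U" "q \<prec> \<ominus> x" "\<forall>y\<in>U. q \<prec> y \<longrightarrow> y \<prec> \<ominus> x \<longrightarrow> P y"
      unfolding evl_def by blast
    have "P (\<ominus> y)" if "y \<in> U" "x \<prec> y" "y \<prec> \<ominus> q" for y
      using q(3)[rule_format, of "\<ominus> y"] that q(1) x less_neg_iff[of y q] by simp
    then show "evr x (\<lambda>y. P (\<ominus> y))"
      unfolding evr_def using q x less_neg_iff[of q x] by (intro bexI[of _ "\<ominus> q"]) simp_all }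
qed

lemma evl_neg: "x \<in> U \<Longrightarrow> evl x (\<lambda>y. P (\<ominus> y)) \<longleftrightarrow> evr (\<ominus> x) P"
proof -
  assume x: "x \<in> U"
  have "evr (\<ominus> x) (\<lambda>y. P (\<ominus> \<ominus> y)) \<longleftrightarrow> evl x (\<lambda>y. P (\<ominus> y))"
    using evr_neg[of "\<ominus> x" "\<lambda>y. P (\<ominus> y)"] x by simp
  moreover have "evr (\<ominus> x) (\<lambda>y. P (\<ominus> \<ominus> y)) \<longleftrightarrow> evr (\<ominus> x) P"
    unfolding evr_def by simp
  ultimately show ?thesis by blast
qed

lemma definable_evr:
  assumes "definable A (\<lambda>e. P (e 0) (\<lambda>k. e (Suc k)))" "dterm A t"
  shows "definable A (\<lambda>e. evr (t e) (\<lambda>y. P y e))"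
  unfolding evr_def
  by (intro definable_intros definable_less dterm_rename[OF assms(2)]
      definable_rename[OF assms(1), of "case_nat 0 (\<lambda>k. Suc (Suc k))", simplified])

lemma definable_evl:
  assumes "definable A (\<lambda>e. P (e 0) (\<lambda>k. e (Suc k)))" "dterm A t"
  shows "definable A (\<lambda>e. evl (t e) (\<lambda>y. P y e))"
  unfolding evl_def
  by (intro definable_intros definable_less dterm_rename[OF assms(2)]
      definable_rename[OF assms(1), of "case_nat 0 (\<lambda>k. Suc (Suc k))", simplified])

definition rdec :: "'u \<Rightarrow> ('u \<Rightarrow> bool) \<Rightarrow> bool" where
  "rdec x P \<longleftrightarrow> evr x P \<or> evr x (\<lambda>y. \<not> P y)"

definition ldec :: "'u \<Rightarrow> ('u \<Rightarrow> bool) \<Rightarrow> bool" where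
  "ldec x P \<longleftrightarrow> evl x P \<or> evl x (\<lambda>y. \<not> P y)"

lemma rdec_conj: "rdec x P \<Longrightarrow> rdec x Q \<Longrightarrow> x \<in> U \<Longrightarrow> rdec x (\<lambda>y. P y \<and> Q y)"
  unfolding rdec_def using evr_conj[of x P Q] evr_mono[of x] by (smt (verit))

lemma ldec_conj: "ldec x P \<Longrightarrow> ldec x Q \<Longrightarrow> x \<in> U \<Longrightarrow> ldec x (\<lambda>y. P y \<and> Q y)"
  unfolding ldec_def using evl_conj[of x P Q] evl_mono[of x] by (smt (verit))

lemma rdec_not: "rdec x P \<Longrightarrow> rdec x (\<lambda>y. \<not> P y)"
  unfolding rdec_def by auto

lemma ldec_not: "ldec x P \<Longrightarrow> ldec x (\<lambda>y. \<not> P y)"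
  unfolding ldec_def by auto

lemma rdec_disj: "rdec x P \<Longrightarrow> rdec x Q \<Longrightarrow> x \<in> U \<Longrightarrow> rdec x (\<lambda>y. P y \<or> Q y)"
  using rdec_not[OF rdec_conj[OF rdec_not[of x P] rdec_not[of x Q]]] by simp

lemma ldec_disj: "ldec x P \<Longrightarrow> ldec x Q \<Longrightarrow> x \<in> U \<Longrightarrow> ldec x (\<lambda>y. P y \<or> Q y)"
  using ldec_not[OF ldec_conj[OF ldec_not[of x P] ldec_not[of x Q]]] by simp

lemma dec_const: "x \<in> U \<Longrightarrow> rdec x (\<lambda>y. b) \<and> ldec x (\<lambda>y. b)"
  using evr_trivial[of x] evl_trivial[of x] unfolding rdec_def ldec_def
  by (metis (full_types) evr_mono evl_mono)

lemma dec_greater: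
  assumes "x \<in> U" "c \<in> U"
  shows "rdec x (\<lambda>y. c \<prec> y) \<and> ldec x (\<lambda>y. c \<prec> y)"
proof
  show "rdec x (\<lambda>y. c \<prec> y)"
  proof (cases "x \<prec> c")
    case True
    then have "evr x (\<lambda>y. \<not> c \<prec> y)"
      by (intro evr_mono[OF evr_less[OF assms True]]) (metis less_asym assms(2))
    then show ?thesis by (simp add: rdec_def)
  next
    case False
    then have "evr x (\<lambda>y. c \<prec> y)"
      by (intro evr_mono[OF evr_trivial[OF assms(1)]]) (metis le_less_trans assms)
    then show ?thesis by (simp add: rdec_def)
  qed
  show "ldec x (\<lambda>y. c \<prec> y)"
  proof (cases "c \<prec> x")
    case True
    then show ?thesis using evl_greater assms by (simp add: ldec_def)
  next
    case False
    then have "evl x (\<lambda>y. \<not> c \<prec> y)"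
      by (intro evl_mono[OF evl_trivial[OF assms(1)]]) (metis less_trans assms)
    then show ?thesis by (simp add: ldec_def)
  qed
qed

lemma dec_less:
  assumes "x \<in> U" "c \<in> U"
  shows "rdec x (\<lambda>y. y \<prec> c) \<and> ldec x (\<lambda>y. y \<prec> c)"
proof
  show "rdec x (\<lambda>y. y \<prec> c)"
  proof (cases "x \<prec> c")
    case True
    then show ?thesis using evr_less assms by (simp add: rdec_def)
  next
    case False
    then have "evr x (\<lambda>y. \<not> y \<prec> c)"
      by (intro evr_mono[OF evr_trivial[OF assms(1)]]) (metis less_trans assms)
    then show ?thesis by (simp add: rdec_def)
  qed
  show "ldec x (\<lambda>y. y \<prec> c)"
  proof (cases "c \<prec> x")
    case True
    then have "evl x (\<lambda>y. \<not> y \<prec> c)"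
      by (intro evl_mono[OF evl_greater[OF assms(1,2) True]]) (metis less_asym assms(2))
    then show ?thesis by (simp add: ldec_def)
  next
    case False
    then have "evl x (\<lambda>y. y \<prec> c)"
      by (intro evl_mono[OF evl_trivial[OF assms(1)]]) (metis less_le_trans assms)
    then show ?thesis by (simp add: ldec_def)
  qed
qed

text \<open>Predicates whose truth value settles on each side of \<open>x\<close> form a Boolean
  algebra that contains the rays. Hence it contains membership in every finite union of points and
  intervals.\<close>

lemma dec_mem:
  assumes "dset U X" "x \<in> U"
  shows "rdec x (\<lambda>y. y \<in> X) \<and> ldec x (\<lambda>y. y \<in> X)"
  using assms(1)
proof (induction rule: dset_induct)
  case empty
  then show ?case using dec_const[OF assms(2), of False] by simp
next
  case (single c)
  have "(y \<in> {c}) = (\<not> c \<prec> y \<and> \<not> y \<prec> c)" if "y \<in> U" for y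
    using less_linear[OF \<open>c \<in> U\<close> that] \<open>c \<in> U\<close> by auto
  then have "evr x (\<lambda>y. y \<in> {c}) = evr x (\<lambda>y. \<not> c \<prec> y \<and> \<not> y \<prec> c)"
    "evr x (\<lambda>y. y \<notin> {c}) = evr x (\<lambda>y. \<not> (\<not> c \<prec> y \<and> \<not> y \<prec> c))"
    "evl x (\<lambda>y. y \<in> {c}) = evl x (\<lambda>y. \<not> c \<prec> y \<and> \<not> y \<prec> c)"
    "evl x (\<lambda>y. y \<notin> {c}) = evl x (\<lambda>y. \<not> (\<not> c \<prec> y \<and> \<not> y \<prec> c))"
    unfolding evr_def evl_def by (metis, metis, metis, metis)
  moreover have "rdec x (\<lambda>y. \<not> c \<prec> y \<and> \<not> y \<prec> c)" "ldec x (\<lambda>y. \<not> c \<prec> y \<and> \<not> y \<prec> c)"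
    using dec_greater[OF assms(2) single] dec_less[OF assms(2) single]
    by (intro rdec_conj rdec_not ldec_conj ldec_not assms; simp)+
  ultimately show ?case unfolding rdec_def ldec_def by simp
next
  case (interval a b)
  have 1: "rdec x (\<lambda>y. \<forall>c. a = Some c \<longrightarrow> c \<prec> y) \<and> ldec x (\<lambda>y. \<forall>c. a = Some c \<longrightarrow> c \<prec> y)"
    using interval assms(2) dec_greater dec_const[OF assms(2), of True] by (cases a) auto
  have 2: "rdec x (\<lambda>y. \<forall>c. b = Some c \<longrightarrow> y \<prec> c) \<and> ldec x (\<lambda>y. \<forall>c. b = Some c \<longrightarrow> y \<prec> c)"
    using interval assms(2) dec_less dec_const[OF assms(2), of True] by (cases b) auto
  let ?P = "\<lambda>y. (\<forall>c. a = Some c \<longrightarrow> c \<prec> y) \<and> (\<forall>c. b = Some c \<longrightarrow> y \<prec> c)"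
  have "rdec x ?P" "ldec x ?P"
    using 1 2 assms(2) by (auto intro!: rdec_conj ldec_conj)
  moreover have "evr x (\<lambda>y. y \<in> open_interval M a b) = evr x ?P"
    "evr x (\<lambda>y. y \<notin> open_interval M a b) = evr x (\<lambda>y. \<not> ?P y)"
    "evl x (\<lambda>y. y \<in> open_interval M a b) = evl x ?P"
    "evl x (\<lambda>y. y \<notin> open_interval M a b) = evl x (\<lambda>y. \<not> ?P y)"
    unfolding evr_def evl_def by (auto simp: open_interval_def)
  ultimately show ?case unfolding rdec_def ldec_def by simp
next
  case (union X Y)
  then show ?case using assms(2) by (simp add: rdec_disj ldec_disj)
qed

section \<open>Suprema and infima of definable sets\<close>

definition lub :: "'u set \<Rightarrow> 'u \<Rightarrow> bool" where
  "lub X s \<longleftrightarrow> s \<in> U \<and> (\<forall>x\<in>X. \<not> s \<prec> x) \<and> (\<forall>z\<in>U. z \<prec> s \<longrightarrow> (\<exists>x\<in>X. z \<prec> x))"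

definition glb :: "'u set \<Rightarrow> 'u \<Rightarrow> bool" where
  "glb X s \<longleftrightarrow> s \<in> U \<and> (\<forall>x\<in>X. \<not> x \<prec> s) \<and> (\<forall>z\<in>U. s \<prec> z \<longrightarrow> (\<exists>x\<in>X. x \<prec> z))"

text \<open>Definable completeness. The supremum of an interval is its right end, which is finite
  because the interval is bounded; for a union it is the larger of the two suprema.\<close>

lemma ex_lub:
  assumes "dset U X" "X \<noteq> {}" "u \<in> U" "\<forall>x\<in>X. \<not> u \<prec> x"
  shows "\<exists>s. lub X s"
proof -
  have "X \<noteq> {} \<longrightarrow> (\<exists>u\<in>U. \<forall>x\<in>X. \<not> u \<prec> x) \<longrightarrow> (\<exists>s. lub X s)"
    using assms(1)
  proof (induction rule: dset_induct)
    case (single c)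
    then have "lub {c} c" by (simp add: lub_def)
    then show ?case by blast
  next
    case (interval a b)
    show ?case
    proof (intro impI)
      assume "open_interval M a b \<noteq> {}" and bdd: "\<exists>u\<in>U. \<forall>x\<in>open_interval M a b. \<not> u \<prec> x"
      then obtain x where x: "x \<in> U" "x \<in> open_interval M a b"
        unfolding open_interval_def by auto
      have up: "y \<in> open_interval M a b" if "y \<in> U" "x \<prec> y" "\<forall>c. b = Some c \<longrightarrow> y \<prec> c" for y
        using x that interval less_trans[of _ x y] by (auto simp: open_interval_def)
      show "\<exists>s. lub (open_interval M a b) s"
      proof (cases b)
        case None
        from bdd obtain u where u: "u \<in> U" "\<forall>x\<in>open_interval M a b. \<not> u \<prec> x" by blast
        obtain y where y: "y \<in> U" "maxi u x \<prec> y" using ex_greater[of "maxi u x"] u x by auto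
        then have "u \<prec> y" "y \<in> open_interval M a b" using up u x None by auto
        with u show ?thesis by blast
      next
        case (Some c)
        then have c: "c \<in> U" "x \<prec> c" using interval x by (auto simp: open_interval_def)
        have "\<not> c \<prec> y" if "y \<in> open_interval M a b" for y
          using that Some c less_asym[of y c] by (auto simp: open_interval_def)
        moreover have "\<exists>y\<in>open_interval M a b. z \<prec> y" if z: "z \<in> U" "z \<prec> c" for z
        proof -
          obtain y where "y \<in> U" "maxi z x \<prec> y" "y \<prec> c"
            using dense[of "maxi z x" c] z c x by auto
          then show ?thesis using up z x Some by auto
        qed
        ultimately have "lub (open_interval M a b) c" using c by (simp add: lub_def)
        then show ?thesis by blast
      qed
    qed
  next
    case (union X Y)
    show ?case
    proof (intro impI)
      assume "X \<union> Y \<noteq> {}" and bdd: "\<exists>u\<in>U. \<forall>x\<in>X \<union> Y. \<not> u \<prec> x"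
      show "\<exists>s. lub (X \<union> Y) s"
      proof (cases "X = {} \<or> Y = {}")
        case True
        then show ?thesis using \<open>X \<union> Y \<noteq> {}\<close> bdd union by auto
      next
        case False
        then obtain s t where st: "lub X s" "lub Y t" using bdd union by blast
        then have s: "s \<in> U" "t \<in> U" by (auto simp: lub_def)
        have *: "lub (X' \<union> Y') s'" if "lub X' s'" "lub Y' t'" "\<not> s' \<prec> t'" "Y' \<subseteq> U" for X' Y' s' t'
          using that le_trans[of _ t' s'] unfolding lub_def by blast
        show ?thesis
          using *[OF st] *[OF st(2,1)] union(1,2) less_asym[OF s] by (metis Un_commute)
      qed
    qed
  qed simp
  then show ?thesis using assms by blast
qed

text \<open>The lower bounds of a definable set form a definable set, and the supremum of the lower
  bounds is the infimum. No mirrored induction is required.\<close>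

lemma ex_glb:
  assumes "dset U X" "X \<noteq> {}" "u \<in> U" "\<forall>x\<in>X. \<not> x \<prec> u"
  shows "\<exists>s. glb X s"
proof -
  let ?Z = "{z \<in> U. \<forall>x\<in>U. x \<in> X \<longrightarrow> \<not> x \<prec> z}"
  have XU: "X \<subseteq> U" using assms(1) by (auto simp: dset_def)
  have "dset U ?Z"
    by (intro dsetI field_intros definable_mem[OF assms(1)])
  moreover have "?Z \<noteq> {}" using assms by auto
  moreover obtain x0 where x0: "x0 \<in> X" using assms(2) by blast
  moreover from x0 have "\<forall>z\<in>?Z. \<not> x0 \<prec> z" using XU by auto
  ultimately obtain s where s: "lub ?Z s" using ex_lub[of ?Z x0] XU by blast
  then have sU: "s \<in> U" by (simp add: lub_def)
  have "\<not> x \<prec> s" if "x \<in> X" for x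
    using s that XU unfolding lub_def by blast
  moreover have "\<exists>x\<in>X. x \<prec> z" if "z \<in> U" "s \<prec> z" for z
    using s that XU unfolding lub_def by blast
  ultimately show ?thesis using sU by (auto simp: glb_def)
qed

lemma infinite_dset:
  assumes "dset U X" "infinite X"
  shows "\<exists>p\<in>U. \<exists>q\<in>U. p \<prec> q \<and> ivl p q \<subseteq> X"
proof -
  have "finite X \<or> (\<exists>p\<in>U. \<exists>q\<in>U. p \<prec> q \<and> ivl p q \<subseteq> X)"
    using assms(1)
  proof (induction rule: dset_induct)
    case (interval a b)
    show ?case
    proof (cases "open_interval M a b = {}")
      case False
      then obtain x where x: "x \<in> U" "x \<in> open_interval M a b"
        unfolding open_interval_def by auto
      have "\<exists>p\<in>U. p \<prec> x \<and> (\<forall>c. a = Some c \<longrightarrow> c = p)"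
        using x interval ex_less[of x] by (cases a) (auto simp: open_interval_def)
      then obtain p where p: "p \<in> U" "p \<prec> x" "\<forall>c. a = Some c \<longrightarrow> c = p" by blast
      have "\<exists>q\<in>U. x \<prec> q \<and> (\<forall>c. b = Some c \<longrightarrow> c = q)"
        using x interval ex_greater[of x] by (cases b) (auto simp: open_interval_def)
      then obtain q where q: "q \<in> U" "x \<prec> q" "\<forall>c. b = Some c \<longrightarrow> c = q" by blast
      have "ivl p q \<subseteq> open_interval M a b"
        using p q by (auto simp: ivl_def open_interval_def)
      moreover have "p \<prec> q" using less_trans p q x by blast
      ultimately show ?thesis using p q by blast
    qed simp
  next
    case (union X Y)
    then show ?case by (metis finite_UnI le_supI1 le_supI2)
  qed auto
  with assms(2) show ?thesis by blast
qed

section \<open>Boundaries of definable sets\<close>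

definition bd :: "'u set \<Rightarrow> 'u set" where
  "bd X = {x \<in> U. \<not> (\<exists>p\<in>U. \<exists>q\<in>U. p \<prec> x \<and> x \<prec> q \<and>
     ((\<forall>y\<in>U. p \<prec> y \<longrightarrow> y \<prec> q \<longrightarrow> y \<in> X) \<or> (\<forall>y\<in>U. p \<prec> y \<longrightarrow> y \<prec> q \<longrightarrow> y \<notin> X)))}"

text \<open>The boundary is cut out by a first-order condition over the same parameters as
  \<open>X\<close>. Together with its finiteness this places every boundary point in
  \<open>dcl A\<close>.\<close>

lemma dset_bd:
  assumes "dset A X"
  shows "dset A (bd X)"
  unfolding bd_def by (intro dsetI field_intros definable_mem[OF assms])

lemma bd_Un: "bd (X \<union> Y) \<subseteq> bd X \<union> bd Y"
proof
  fix x assume x: "x \<in> bd (X \<union> Y)"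
  then have xU: "x \<in> U" by (simp add: bd_def)
  show "x \<in> bd X \<union> bd Y"
  proof (rule ccontr)
    assume c: "x \<notin> bd X \<union> bd Y"
    then obtain p q where p: "p \<in> U" "q \<in> U" "p \<prec> x" "x \<prec> q"
      "(\<forall>y\<in>U. p \<prec> y \<longrightarrow> y \<prec> q \<longrightarrow> y \<in> X) \<or> (\<forall>y\<in>U. p \<prec> y \<longrightarrow> y \<prec> q \<longrightarrow> y \<notin> X)"
      using xU unfolding bd_def by blast
    from c obtain p' q' where p': "p' \<in> U" "q' \<in> U" "p' \<prec> x" "x \<prec> q'"
      "(\<forall>y\<in>U. p' \<prec> y \<longrightarrow> y \<prec> q' \<longrightarrow> y \<in> Y) \<or> (\<forall>y\<in>U. p' \<prec> y \<longrightarrow> y \<prec> q' \<longrightarrow> y \<notin> Y)"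
      using xU unfolding bd_def by blast
    have "(\<forall>y\<in>U. maxi p p' \<prec> y \<longrightarrow> y \<prec> mini q q' \<longrightarrow> y \<in> X \<union> Y) \<or>
      (\<forall>y\<in>U. maxi p p' \<prec> y \<longrightarrow> y \<prec> mini q q' \<longrightarrow> y \<notin> X \<union> Y)"
      using p p' by auto
    moreover have "maxi p p' \<in> U" "mini q q' \<in> U" "maxi p p' \<prec> x" "x \<prec> mini q q'"
      using p p' xU by simp_all
    ultimately show False using x unfolding bd_def by blast
  qed
qed

lemma finite_bd:
  assumes "dset U X"
  shows "finite (bd X)"
  using assms
proof (induction rule: dset_induct)
  case empty
  have "bd {} = {}" using ex_less ex_greater by (auto simp: bd_def)
  then show ?case by simp
next
  case (single c)
  have "x \<notin> bd {c}" if x: "x \<in> U" "x \<noteq> c" for x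
  proof -
    consider "x \<prec> c" | "c \<prec> x" using less_linear x single by blast
    then have "\<exists>p\<in>U. \<exists>q\<in>U. p \<prec> x \<and> x \<prec> q \<and> (\<forall>y\<in>U. p \<prec> y \<longrightarrow> y \<prec> q \<longrightarrow> y \<notin> {c})"
    proof cases
      case 1
      then show ?thesis using ex_less[OF x(1)] \<open>c \<in> U\<close> less_irrefl by blast
    next
      case 2
      then show ?thesis using ex_greater[OF x(1)] \<open>c \<in> U\<close> less_irrefl by blast
    qed
    then show ?thesis unfolding bd_def by blast
  qed
  then have "bd {c} \<subseteq> {c}" unfolding bd_def by blast
  then show ?case by (rule finite_subset) simp
next
  case (interval a b)
  have 1: "\<exists>p\<in>U. \<exists>q\<in>U. p \<prec> x \<and> x \<prec> q \<and>
      ((\<forall>y\<in>U. p \<prec> y \<longrightarrow> y \<prec> q \<longrightarrow> (\<forall>c. a = Some c \<longrightarrow> c \<prec> y)) \<or>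
       (\<forall>y\<in>U. p \<prec> y \<longrightarrow> y \<prec> q \<longrightarrow> \<not> (\<forall>c. a = Some c \<longrightarrow> c \<prec> y)))" if x: "x \<in> U" "x \<notin> set_option a" for x
  proof (cases a)
    case None
    then show ?thesis using ex_less[OF x(1)] ex_greater[OF x(1)] by auto
  next
    case (Some c)
    then have c: "c \<in> U" "x \<noteq> c" using interval x by auto
    then consider "x \<prec> c" | "c \<prec> x" using less_linear x by blast
    then show ?thesis
    proof cases
      case 1
      obtain p where "p \<in> U" "p \<prec> x" using ex_less[OF x(1)] by blast
      with 1 c Some show ?thesis
        by (intro bexI[of _ p] bexI[of _ c]) (auto dest: less_asym)
    next
      case 2
      obtain q where "q \<in> U" "x \<prec> q" using ex_greater[OF x(1)] by blast
      with 2 c Some show ?thesis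
        by (intro bexI[of _ c] bexI[of _ q]) auto
    qed
  qed
  have 2: "\<exists>p\<in>U. \<exists>q\<in>U. p \<prec> x \<and> x \<prec> q \<and>
      ((\<forall>y\<in>U. p \<prec> y \<longrightarrow> y \<prec> q \<longrightarrow> (\<forall>c. b = Some c \<longrightarrow> y \<prec> c)) \<or>
       (\<forall>y\<in>U. p \<prec> y \<longrightarrow> y \<prec> q \<longrightarrow> \<not> (\<forall>c. b = Some c \<longrightarrow> y \<prec> c)))" if x: "x \<in> U" "x \<notin> set_option b" for x
  proof (cases b)
    case None
    then show ?thesis using ex_less[OF x(1)] ex_greater[OF x(1)] by auto
  next
    case (Some c)
    then have c: "c \<in> U" "x \<noteq> c" using interval x by auto
    then consider "x \<prec> c" | "c \<prec> x" using less_linear x by blast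
    then show ?thesis
    proof cases
      case 1
      obtain p where "p \<in> U" "p \<prec> x" using ex_less[OF x(1)] by blast
      with 1 c Some show ?thesis
        by (intro bexI[of _ p] bexI[of _ c]) auto
    next
      case 2
      obtain q where "q \<in> U" "x \<prec> q" using ex_greater[OF x(1)] by blast
      with 2 c Some show ?thesis
        by (intro bexI[of _ c] bexI[of _ q]) (auto dest: less_asym)
    qed
  qed
  have "x \<notin> bd (open_interval M a b)" if x: "x \<in> U" "x \<notin> set_option a \<union> set_option b" for x
  proof -
    obtain p q where p: "p \<in> U" "q \<in> U" "p \<prec> x" "x \<prec> q"
      "(\<forall>y\<in>U. p \<prec> y \<longrightarrow> y \<prec> q \<longrightarrow> (\<forall>c. a = Some c \<longrightarrow> c \<prec> y)) \<or>
       (\<forall>y\<in>U. p \<prec> y \<longrightarrow> y \<prec> q \<longrightarrow> \<not> (\<forall>c. a = Some c \<longrightarrow> c \<prec> y))"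
      using 1 x by blast
    obtain p' q' where p': "p' \<in> U" "q' \<in> U" "p' \<prec> x" "x \<prec> q'"
      "(\<forall>y\<in>U. p' \<prec> y \<longrightarrow> y \<prec> q' \<longrightarrow> (\<forall>c. b = Some c \<longrightarrow> y \<prec> c)) \<or>
       (\<forall>y\<in>U. p' \<prec> y \<longrightarrow> y \<prec> q' \<longrightarrow> \<not> (\<forall>c. b = Some c \<longrightarrow> y \<prec> c))"
      using 2 x by blast
    have "(\<forall>y\<in>U. maxi p p' \<prec> y \<longrightarrow> y \<prec> mini q q' \<longrightarrow> y \<in> open_interval M a b) \<or>
      (\<forall>y\<in>U. maxi p p' \<prec> y \<longrightarrow> y \<prec> mini q q' \<longrightarrow> y \<notin> open_interval M a b)"
      using p p' by (simp add: open_interval_def) blast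
    moreover have "maxi p p' \<in> U" "mini q q' \<in> U" "maxi p p' \<prec> x" "x \<prec> mini q q'"
      using p p' x by simp_all
    ultimately show ?thesis unfolding bd_def by blast
  qed
  then have "bd (open_interval M a b) \<subseteq> set_option a \<union> set_option b"
    unfolding bd_def by blast
  then show ?case by (rule finite_subset) simp
next
  case (union X Y)
  then show ?case using finite_subset[OF bd_Un] by simp
qed

lemma finite_max:
  "finite X \<Longrightarrow> X \<noteq> {} \<Longrightarrow> X \<subseteq> U \<Longrightarrow> \<exists>m\<in>X. \<forall>x\<in>X. \<not> m \<prec> x"
proof (induction X rule: finite_ne_induct)
  case (insert x X)
  then obtain m where m: "m \<in> X" "\<forall>x\<in>X. \<not> m \<prec> x" by auto
  show ?case
  proof (cases "m \<prec> x")
    case True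
    then have "\<forall>y\<in>insert x X. \<not> x \<prec> y"
      using m insert.prems less_trans[of m x] by auto
    then show ?thesis by blast
  qed (use m in auto)
qed auto

lemma finite_min:
  "finite X \<Longrightarrow> X \<noteq> {} \<Longrightarrow> X \<subseteq> U \<Longrightarrow> \<exists>m\<in>X. \<forall>x\<in>X. \<not> x \<prec> m"
proof (induction X rule: finite_ne_induct)
  case (insert x X)
  then obtain m where m: "m \<in> X" "\<forall>x\<in>X. \<not> x \<prec> m" by auto
  show ?case
  proof (cases "x \<prec> m")
    case True
    then have "\<forall>y\<in>insert x X. \<not> y \<prec> x"
      using m insert.prems less_trans[of _ x m] by auto
    then show ?thesis by blast
  qed (use m in auto)
qed auto

text \<open>The order tells the members apart: the least one is definable over \<open>A\<close>, and
  removing it leaves a smaller set definable over \<open>A\<close>.\<close>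

lemma finite_dset_dcl:
  assumes "finite X" "dset A X"
  shows "X \<subseteq> dcl A"
  using assms
proof (induction "card X" arbitrary: X)
  case 0
  then show ?case by simp
next
  case (Suc n)
  have XU: "X \<subseteq> U" using Suc.prems by (simp add: dset_def)
  obtain m where m: "m \<in> X" "\<forall>x\<in>X. \<not> x \<prec> m"
    using finite_min[of X] Suc XU by (metis card.empty old.nat.distinct(1))
  have "x = m \<longleftrightarrow> x \<in> X \<and> (\<forall>y\<in>U. y \<in> X \<longrightarrow> \<not> y \<prec> x)" if "x \<in> U" for x
    using m XU less_linear[OF that, of m] that by blast
  moreover have "definable A (\<lambda>e. e 0 \<in> X \<and> (\<forall>y\<in>U. y \<in> X \<longrightarrow> \<not> y \<prec> e 0))"
    by (intro field_intros definable_mem[OF Suc.prems(2)])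
  ultimately have "definable A (\<lambda>e. e 0 = m)" by (simp cong: definable_cong)
  then have mA: "m \<in> dcl A" using m XU by (auto simp: dcl_def)
  have "dset A {x \<in> U. x \<in> X \<and> x \<noteq> m}"
    using mA unfolding dcl_iff
    by (intro dsetI field_intros definable_mem[OF Suc.prems(2)])
  moreover have "{x \<in> U. x \<in> X \<and> x \<noteq> m} = X - {m}" using XU by auto
  ultimately have "X - {m} \<subseteq> dcl A"
    using Suc m by (intro Suc.hyps) auto
  then show ?case using mA by blast
qed

lemma bd_subset_dcl: "dset A X \<Longrightarrow> A \<subseteq> U \<Longrightarrow> bd X \<subseteq> dcl A"
  using finite_dset_dcl[OF finite_bd dset_bd] dset_mono by blast

text \<open>All boundary points lie in \<open>dcl A\<close>, so \<open>d\<close> is not one of them.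
  This is how a property definable over \<open>A\<close> spreads from a point outside
  \<open>dcl A\<close> to an interval.\<close>

lemma generic_interior:
  assumes "dset A X" "A \<subseteq> U" "d \<in> X" "d \<notin> dcl A"
  shows "\<exists>p\<in>U. \<exists>q\<in>U. p \<prec> d \<and> d \<prec> q \<and> ivl p q \<subseteq> X"
proof -
  have dU: "d \<in> U" using assms dset_in by blast
  have "d \<notin> bd X" using bd_subset_dcl[OF assms(1,2)] assms(4) by blast
  then obtain p q where p: "p \<in> U" "q \<in> U" "p \<prec> d" "d \<prec> q"
    "(\<forall>y\<in>U. p \<prec> y \<longrightarrow> y \<prec> q \<longrightarrow> y \<in> X) \<or> (\<forall>y\<in>U. p \<prec> y \<longrightarrow> y \<prec> q \<longrightarrow> y \<notin> X)"
    using dU unfolding bd_def by blast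
  then have "\<forall>y\<in>U. p \<prec> y \<longrightarrow> y \<prec> q \<longrightarrow> y \<in> X" using dU assms(3) by blast
  then show ?thesis using p by (auto simp: ivl_def)
qed

text \<open>The infimum of the points to the right of \<open>x\<close> that are outside
  \<open>X\<close> is such a boundary point. It exceeds \<open>x\<close> because \<open>X\<close>
  contains a right germ at \<open>x\<close>.\<close>

lemma bd_right:
  assumes X: "dset U X" and x: "x \<in> U" "evr x (\<lambda>y. y \<in> X)" and y: "y \<in> U" "x \<prec> y" "y \<notin> X"
  shows "\<exists>w\<in>bd X. x \<prec> w \<and> \<not> y \<prec> w"
proof -
  let ?Z = "{z \<in> U. x \<prec> z \<and> z \<notin> X}"
  have "dset U ?Z"
    by (intro dsetI field_intros definable_mem[OF X] dterm_const x)
  moreover have "y \<in> ?Z" using y by simp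
  moreover have "\<forall>z\<in>?Z. \<not> z \<prec> x" using x less_asym by blast
  ultimately obtain i where i: "glb ?Z i" using ex_glb[of ?Z x] x by blast
  then have iU: "i \<in> U" by (simp add: glb_def)
  obtain v where v: "v \<in> U" "x \<prec> v" "\<forall>y\<in>U. x \<prec> y \<longrightarrow> y \<prec> v \<longrightarrow> y \<in> X"
    using x(2) unfolding evr_def by blast
  have "\<not> i \<prec> v" using i v unfolding glb_def by blast
  then have xi: "x \<prec> i" using less_le_trans v x iU by blast
  have iy: "\<not> y \<prec> i" using i \<open>y \<in> ?Z\<close> unfolding glb_def by blast
  have "i \<in> bd X"
  proof (rule ccontr)
    assume "i \<notin> bd X"
    then obtain p q where p: "p \<in> U" "q \<in> U" "p \<prec> i" "i \<prec> q"
      "(\<forall>y\<in>U. p \<prec> y \<longrightarrow> y \<prec> q \<longrightarrow> y \<in> X) \<or> (\<forall>y\<in>U. p \<prec> y \<longrightarrow> y \<prec> q \<longrightarrow> y \<notin> X)"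
      using iU unfolding bd_def by blast
    from p(5) show False
    proof
      assume a: "\<forall>y\<in>U. p \<prec> y \<longrightarrow> y \<prec> q \<longrightarrow> y \<in> X"
      obtain z where z: "z \<in> ?Z" "z \<prec> q" using i p unfolding glb_def by blast
      then have "\<not> z \<prec> i" using i unfolding glb_def by blast
      then have "p \<prec> z" using z p iU less_le_trans by blast
      then show False using a z by blast
    next
      assume a: "\<forall>y\<in>U. p \<prec> y \<longrightarrow> y \<prec> q \<longrightarrow> y \<notin> X"
      obtain z where z: "z \<in> U" "maxi p x \<prec> z" "z \<prec> i"
        using dense[of "maxi p x" i] p x xi iU by auto
      then have "z \<prec> q" using less_trans p iU by blast
      then have "z \<in> ?Z" using a z p x by auto
      then show False using i z unfolding glb_def by blast
    qed
  qed
  then show ?thesis using xi iy by blast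
qed

lemma bd_left:
  assumes X: "dset U X" and x: "x \<in> U" "evl x (\<lambda>y. y \<in> X)" and y: "y \<in> U" "y \<prec> x" "y \<notin> X"
  shows "\<exists>w\<in>bd X. w \<prec> x \<and> \<not> w \<prec> y"
proof -
  let ?Z = "{z \<in> U. z \<prec> x \<and> z \<notin> X}"
  have "dset U ?Z"
    by (intro dsetI field_intros definable_mem[OF X] dterm_const x)
  moreover have "y \<in> ?Z" using y by simp
  moreover have "\<forall>z\<in>?Z. \<not> x \<prec> z" using x less_asym by blast
  ultimately obtain i where i: "lub ?Z i" using ex_lub[of ?Z x] x by blast
  then have iU: "i \<in> U" by (simp add: lub_def)
  obtain v where v: "v \<in> U" "v \<prec> x" "\<forall>y\<in>U. v \<prec> y \<longrightarrow> y \<prec> x \<longrightarrow> y \<in> X"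
    using x(2) unfolding evl_def by blast
  have "\<not> v \<prec> i" using i v unfolding lub_def by blast
  then have xi: "i \<prec> x" using le_less_trans v x iU by blast
  have iy: "\<not> i \<prec> y" using i \<open>y \<in> ?Z\<close> unfolding lub_def by blast
  have "i \<in> bd X"
  proof (rule ccontr)
    assume "i \<notin> bd X"
    then obtain p q where p: "p \<in> U" "q \<in> U" "p \<prec> i" "i \<prec> q"
      "(\<forall>y\<in>U. p \<prec> y \<longrightarrow> y \<prec> q \<longrightarrow> y \<in> X) \<or> (\<forall>y\<in>U. p \<prec> y \<longrightarrow> y \<prec> q \<longrightarrow> y \<notin> X)"
      using iU unfolding bd_def by blast
    from p(5) show False
    proof
      assume a: "\<forall>y\<in>U. p \<prec> y \<longrightarrow> y \<prec> q \<longrightarrow> y \<in> X"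
      obtain z where z: "z \<in> ?Z" "p \<prec> z" using i p unfolding lub_def by blast
      then have "\<not> i \<prec> z" using i unfolding lub_def by blast
      then have "z \<prec> q" using z p iU le_less_trans by blast
      then show False using a z by blast
    next
      assume a: "\<forall>y\<in>U. p \<prec> y \<longrightarrow> y \<prec> q \<longrightarrow> y \<notin> X"
      obtain z where z: "z \<in> U" "i \<prec> z" "z \<prec> mini q x"
        using dense[of i "mini q x"] p x xi iU by auto
      then have "p \<prec> z" using less_trans p iU by blast
      then have "z \<in> ?Z" using a z p x by auto
      then show False using i z unfolding lub_def by blast
    qed
  qed
  then show ?thesis using xi iy by blast
qed

end

section \<open>Monotonicity and continuity at generic points\<close>

context o_minimal_field
begin

definition strict_min :: "('u \<Rightarrow> 'u) \<Rightarrow> 'u \<Rightarrow> bool" where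
  "strict_min g x \<longleftrightarrow> evr x (\<lambda>y. g x \<prec> g y) \<and> evl x (\<lambda>y. g x \<prec> g y)"

text \<open>Weakly increasing at a point: nearby values are compared with the value at
  \<open>x\<close> only, not with each other. Applied to the negative of \<open>g\<close> it
  expresses weakly decreasing.\<close>

definition winc :: "('u \<Rightarrow> 'u) \<Rightarrow> 'u \<Rightarrow> bool" where
  "winc g x \<longleftrightarrow> evr x (\<lambda>y. \<not> g y \<prec> g x) \<and> evl x (\<lambda>y. \<not> g x \<prec> g y)"

text \<open>Every value just to the left of \<open>z\<close> exceeds every value just to the right;
  the value at \<open>z\<close> is left out of the comparison.\<close>

definition drops :: "('u \<Rightarrow> 'u) \<Rightarrow> 'u \<Rightarrow> bool" where
  "drops g z \<longleftrightarrow> (\<exists>u\<in>U. \<exists>v\<in>U. u \<prec> z \<and> z \<prec> v \<and>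
     (\<forall>y\<in>U. \<forall>y'\<in>U. u \<prec> y \<longrightarrow> y \<prec> z \<longrightarrow> z \<prec> y' \<longrightarrow> y' \<prec> v \<longrightarrow> g y' \<prec> g y))"

definition cont_at :: "('u \<Rightarrow> 'u) \<Rightarrow> 'u \<Rightarrow> bool" where
  "cont_at g x \<longleftrightarrow> (\<forall>p\<in>U. \<forall>q\<in>U. p \<prec> g x \<longrightarrow> g x \<prec> q \<longrightarrow>
     (\<exists>u\<in>U. \<exists>v\<in>U. u \<prec> x \<and> x \<prec> v \<and> (\<forall>y\<in>U. u \<prec> y \<longrightarrow> y \<prec> v \<longrightarrow> p \<prec> g y \<and> g y \<prec> q)))"

lemma definable_strict_min:
  assumes "dfun A g" "dterm A t"
  shows "definable A (\<lambda>e. strict_min g (t e))"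
  unfolding strict_min_def
  by (intro field_intros definable_evr definable_evl dterm_app[OF assms(1)] dterm_rename[OF assms(2)] assms(2))

lemma definable_winc:
  assumes "dfun A g" "dterm A t"
  shows "definable A (\<lambda>e. winc g (t e))"
  unfolding winc_def
  by (intro field_intros definable_evr definable_evl dterm_app[OF assms(1)] dterm_rename[OF assms(2)] assms(2))

lemma definable_drops:
  assumes "dfun A g" "dterm A t"
  shows "definable A (\<lambda>e. drops g (t e))"
  unfolding drops_def by (intro field_intros dterm_app[OF assms(1)] dterm_rename[OF assms(2)] assms(2))

lemma definable_cont_at:
  assumes "dfun A g" "dterm A t"
  shows "definable A (\<lambda>e. cont_at g (t e))"
  unfolding cont_at_def by (intro field_intros dterm_app[OF assms(1)] dterm_rename[OF assms(2)] assms(2))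

lemma dfun_neg:
  assumes "dfun A g"
  shows "dfun A (\<lambda>x. \<ominus> (g x))"
  by (intro dfunI field_intros dterm_app[OF assms])

lemma dfun_reflect:
  assumes "dfun A g"
  shows "dfun A (\<lambda>x. g (\<ominus> x))"
  by (intro dfunI field_intros dterm_app[OF assms])

lemma ivl_iff: "x \<in> ivl p q \<longleftrightarrow> x \<in> U \<and> p \<prec> x \<and> x \<prec> q"
  by (simp add: ivl_def)

lemma infinite_unbounded:
  assumes "X \<subseteq> ivl a b" "a \<in> U" "b \<in> U" "a \<prec> b" "\<And>x. x \<in> ivl a b \<Longrightarrow> \<exists>z\<in>X. x \<prec> z"
  shows "infinite X"
proof
  assume "finite X"
  have "mid a b \<in> ivl a b" using assms by (simp add: ivl_iff mid_less)
  then have "X \<noteq> {}" using assms(5) by blast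
  moreover have "X \<subseteq> U" using assms(1) by (auto simp: ivl_def)
  ultimately obtain m where "m \<in> X" "\<forall>x\<in>X. \<not> m \<prec> x" using finite_max \<open>finite X\<close> by blast
  then show False using assms(1,5) by blast
qed

lemma infinite_ivl:
  assumes "p \<in> U" "q \<in> U" "p \<prec> q"
  shows "infinite (ivl p q)"
proof (rule infinite_unbounded[OF order_refl assms])
  fix x assume "x \<in> ivl p q"
  then show "\<exists>z\<in>ivl p q. x \<prec> z"
    using dense[of x q] less_trans[of p x] assms by (auto simp: ivl_iff)
qed

text \<open>From local to global: consider the infimum \<open>i\<close> of the points z after x, up
  to y, with g(z) < g(x). It lies beyond x by the hypothesis at x. If g(i) < g(x), the left half of
  \<open>winc\<close> at \<open>i\<close> gives such points before \<open>i\<close>. Otherwise the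
  right half keeps the values just after \<open>i\<close> at or above g(x). Either way
  \<open>i\<close> is not the infimum.\<close>

lemma winc_mono:
  assumes g: "dfun U g" and pq: "p \<in> U" "q \<in> U" and w: "\<And>x. x \<in> ivl p q \<Longrightarrow> winc g x"
    and x: "x \<in> ivl p q" and y: "y \<in> ivl p q" and "x \<prec> y"
  shows "\<not> g y \<prec> g x"
proof
  assume gyx: "g y \<prec> g x"
  have xU: "x \<in> U" and yU: "y \<in> U" using x y by (auto simp: ivl_iff)
  have gU: "g z \<in> U" if "z \<in> U" for z using dfun_in[OF g that] .
  let ?Z = "{z \<in> U. x \<prec> z \<and> \<not> y \<prec> z \<and> g z \<prec> g x}"
  have "dset U ?Z"
    by (intro dsetI field_intros dterm_const xU yU dterm_app[OF g])
  moreover have "y \<in> ?Z" using yU gyx \<open>x \<prec> y\<close> by simp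
  moreover have "\<forall>z\<in>?Z. \<not> z \<prec> x" using less_asym xU by blast
  ultimately obtain i where i: "glb ?Z i" using ex_glb[of ?Z x] xU by blast
  then have iU: "i \<in> U" by (simp add: glb_def)
  obtain v where v: "v \<in> U" "x \<prec> v" "\<forall>z\<in>U. x \<prec> z \<longrightarrow> z \<prec> v \<longrightarrow> \<not> g z \<prec> g x"
    using w[OF x] unfolding winc_def evr_def by blast
  have "\<not> i \<prec> v" using i v unfolding glb_def by blast
  then have xi: "x \<prec> i" using less_le_trans[of x v i] v xU iU by simp
  have iy: "\<not> y \<prec> i" using i \<open>y \<in> ?Z\<close> unfolding glb_def by blast
  have "i \<in> ivl p q"
    using x y xi iy less_trans[of p x i] le_less_trans[of i y q] pq iU by (simp add: ivl_iff)
  from w[OF this] have wi: "evr i (\<lambda>z. \<not> g z \<prec> g i)" "evl i (\<lambda>z. \<not> g i \<prec> g z)"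
    by (auto simp: winc_def)
  show False
  proof (cases "g i \<prec> g x")
    case True
    obtain z where z: "z \<in> U" "x \<prec> z" "z \<prec> i" "\<not> g i \<prec> g z"
      using evl_ex_greater[OF wi(2) iU xU xi] by blast
    have "\<not> y \<prec> z" using iy z less_trans[of y z i] yU iU by blast
    moreover have "g z \<prec> g x" using le_less_trans[of "g z" "g i" "g x"] z True gU iU xU by simp
    ultimately have "z \<in> ?Z" using z by simp
    then show False using i z unfolding glb_def by blast
  next
    case False
    obtain v where v: "v \<in> U" "i \<prec> v" "\<forall>z\<in>U. i \<prec> z \<longrightarrow> z \<prec> v \<longrightarrow> \<not> g z \<prec> g i"
      using wi(1) unfolding evr_def by blast
    obtain z where z: "z \<in> ?Z" "z \<prec> v" using i v unfolding glb_def by blast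
    then have "\<not> z \<prec> i" using i unfolding glb_def by blast
    then have "i \<prec> z" using z False less_linear[OF iU, of z] by auto
    then have "\<not> g z \<prec> g i" using v z by blast
    then have "\<not> g z \<prec> g x" using False le_trans[of "g x" "g i" "g z"] gU iU xU z by simp
    then show False using z by blast
  qed
qed

text \<open>Near the right end of the interval the values fall below any earlier value g(x) for
  good. The place where this happens for a given x is a point where \<open>g\<close> drops, and it
  lies beyond x. The points of this kind are therefore unbounded, hence infinite in number, and
  contain an interval.\<close>

lemma strict_min_drops:
  assumes g: "dfun U g" and ab: "a \<in> U" "b \<in> U" "a \<prec> b"
    and m: "\<And>x. x \<in> ivl a b \<Longrightarrow> strict_min g x"
  shows "\<exists>p\<in>U. \<exists>q\<in>U. p \<prec> q \<and> ivl p q \<subseteq> ivl a b \<and> (\<forall>z\<in>ivl p q. drops g z)"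
proof -
  have gU: "g z \<in> U" if "z \<in> U" for z using dfun_in[OF g that] .
  \<comment> \<open>The points whose value is never undercut later. If they contained an interval, a
    point slightly to the left of some x in it would have a larger value and be undercut by x. So
    there are finitely many, and beyond the last one every value is undercut later.\<close>
  let ?B = "{x \<in> U. a \<prec> x \<and> x \<prec> b \<and> (\<forall>y\<in>U. x \<prec> y \<longrightarrow> y \<prec> b \<longrightarrow> \<not> g y \<prec> g x)}"
  have "dset U ?B"
    by (intro dsetI field_intros dterm_const ab dterm_app[OF g])
  have "finite ?B"
  proof (rule ccontr)
    assume "infinite ?B"
    then obtain p q where p: "p \<in> U" "q \<in> U" "p \<prec> q" "ivl p q \<subseteq> ?B"
      using infinite_dset[OF \<open>dset U ?B\<close>] by blast
    define x where "x = mid p q"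
    have x: "x \<in> U" "p \<prec> x" "x \<prec> q" using p mid_less by (simp_all add: x_def)
    then have xB: "x \<in> ?B" using p by (auto simp: ivl_iff)
    then have "evl x (\<lambda>y. g x \<prec> g y)" using m by (auto simp: ivl_iff strict_min_def)
    then obtain y where y: "y \<in> U" "p \<prec> y" "y \<prec> x" "g x \<prec> g y"
      using evl_ex_greater x p by blast
    then have "y \<prec> q" using less_trans[of y x q] x p by simp
    then have "y \<in> ?B" using p(4) y by (auto simp: ivl_iff)
    then show False using xB y by blast
  qed
  then have "\<exists>a1\<in>insert a ?B. \<forall>x\<in>insert a ?B. \<not> a1 \<prec> x"
    using ab by (intro finite_max) auto
  then obtain a1 where a1: "a1 \<in> insert a ?B" "\<forall>x\<in>insert a ?B. \<not> a1 \<prec> x"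
    by blast
  then have a1U: "a1 \<in> U" "a1 \<prec> b" "\<not> a1 \<prec> a" using ab by auto
  have sub: "ivl a1 b \<subseteq> ivl a b"
    using le_less_trans[of a a1] a1U ab by (auto simp: ivl_iff)
  have later: "\<exists>y\<in>U. x \<prec> y \<and> y \<prec> b \<and> g y \<prec> g x" if x: "x \<in> ivl a1 b" for x
  proof -
    have "x \<notin> ?B" using a1 x by (auto simp: ivl_iff)
    then show ?thesis using sub x by (auto simp: ivl_iff)
  qed
  \<comment> \<open>Suppose the values below g(x) stop before \<open>b\<close>, and let z be the
    supremum of their positions. If g(z) < g(x), the value at z is undercut later, beyond z. If not,
    then values below g(x), hence below g(z), occur arbitrarily close to z on its left, against the
    strict minimum at z.\<close>
  have fin: "evl b (\<lambda>y. g y \<prec> g x)" if x: "x \<in> ivl a1 b" for x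
  proof (rule ccontr)
    assume "\<not> evl b (\<lambda>y. g y \<prec> g x)"
    have xU: "x \<in> U" "x \<prec> b" "a1 \<prec> x" using x by (auto simp: ivl_iff)
    have "dset U {y \<in> U. g y \<prec> g x}"
      by (intro dsetI field_intros dterm_const xU dterm_app[OF g] gU)
    from dec_mem[OF this ab(2)] have "ldec b (\<lambda>y. g y \<prec> g x)"
      unfolding ldec_def evl_def by simp
    with \<open>\<not> evl b (\<lambda>y. g y \<prec> g x)\<close> obtain w where
      w: "w \<in> U" "w \<prec> b" "\<forall>y\<in>U. w \<prec> y \<longrightarrow> y \<prec> b \<longrightarrow> \<not> g y \<prec> g x"
      unfolding ldec_def evl_def by blast
    let ?S = "{y \<in> U. x \<prec> y \<and> y \<prec> b \<and> g y \<prec> g x}"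
    have "dset U ?S"
      by (intro dsetI field_intros dterm_const xU ab dterm_app[OF g] gU)
    moreover have "?S \<noteq> {}" using later[OF x] by blast
    moreover have "\<forall>y\<in>?S. \<not> w \<prec> y" using w by blast
    ultimately obtain z where z: "lub ?S z" using ex_lub[of ?S w] w by blast
    then have zU: "z \<in> U" by (simp add: lub_def)
    have zw: "\<not> w \<prec> z" using z w \<open>\<forall>y\<in>?S. \<not> w \<prec> y\<close> unfolding lub_def by blast
    then have zb: "z \<prec> b" using le_less_trans[of z w b] w zU ab by simp
    obtain y0 where "y0 \<in> ?S" using \<open>?S \<noteq> {}\<close> by blast
    moreover have "\<not> z \<prec> y0" using z \<open>y0 \<in> ?S\<close> unfolding lub_def by blast
    ultimately have xz: "x \<prec> z" using less_le_trans[of x y0 z] xU zU by simp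
    have z1: "z \<in> ivl a1 b" using zU zb xz less_trans[of a1 x z] xU a1U by (simp add: ivl_iff)
    show False
    proof (cases "g z \<prec> g x")
      case True
      obtain y where y: "y \<in> U" "z \<prec> y" "y \<prec> b" "g y \<prec> g z" using later[OF z1] by blast
      then have "y \<in> ?S" using less_trans[of x z y] less_trans[of "g y" "g z" "g x"] True gU xz xU zU by simp
      then show False using z y unfolding lub_def by blast
    next
      case False
      have "evl z (\<lambda>y. g z \<prec> g y)" using m z1 sub by (auto simp: strict_min_def)
      then obtain u where u: "u \<in> U" "u \<prec> z" "\<forall>y\<in>U. u \<prec> y \<longrightarrow> y \<prec> z \<longrightarrow> g z \<prec> g y"
        unfolding evl_def by blast
      obtain y where y: "y \<in> ?S" "u \<prec> y" using z u unfolding lub_def by blast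
      then have "\<not> z \<prec> y" using z unfolding lub_def by blast
      then have "y \<prec> z" using y False less_linear[of y z] zU by auto
      then have "g z \<prec> g y" using u y by blast
      then show False using y False less_trans[of "g z" "g y" "g x"] gU zU xU by simp
    qed
  qed
  let ?X = "{z \<in> U. a1 \<prec> z \<and> z \<prec> b \<and> drops g z}"
  have dX: "dset U ?X"
    by (intro dsetI field_intros dterm_const a1U ab definable_drops[OF g])
  have "infinite ?X"
  proof (rule infinite_unbounded[of _ a1 b])
    fix x assume x: "x \<in> ivl a1 b"
    have xU: "x \<in> U" "x \<prec> b" "a1 \<prec> x" using x by (auto simp: ivl_iff)
    \<comment> \<open>The left ends of the final segments on which \<open>g\<close> stays below
      g(x). Their infimum z lies beyond x, because the strict minimum at x makes the values just
      after x larger than g(x).\<close>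
    let ?T = "{w \<in> U. w \<prec> b \<and> (\<forall>y\<in>U. w \<prec> y \<longrightarrow> y \<prec> b \<longrightarrow> g y \<prec> g x)}"
    have "dset U ?T"
      by (intro dsetI field_intros dterm_const xU ab dterm_app[OF g] gU)
    moreover have "?T \<noteq> {}" using fin[OF x] unfolding evl_def by blast
    moreover obtain v where v: "v \<in> U" "x \<prec> v" "\<forall>y\<in>U. x \<prec> y \<longrightarrow> y \<prec> v \<longrightarrow> g x \<prec> g y"
      using m[of x] sub x unfolding strict_min_def evr_def by blast
    moreover have Tv: "\<forall>w\<in>?T. \<not> w \<prec> mini v b"
    proof (intro ballI notI)
      fix w assume w: "w \<in> ?T" "w \<prec> mini v b"
      obtain y where y: "y \<in> U" "maxi w x \<prec> y" "y \<prec> mini v b"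
        using dense[of "maxi w x" "mini v b"] w v xU ab by auto
      then have "g y \<prec> g x" "g x \<prec> g y" using w v xU ab by auto
      then show False using less_asym gU y xU by blast
    qed
    ultimately obtain z where z: "glb ?T z" using ex_glb[of ?T "mini v b"] mini_closed[of v b] ab by blast
    then have zU: "z \<in> U" by (simp add: glb_def)
    have "\<not> z \<prec> mini v b" using z Tv v ab unfolding glb_def by (meson mini_closed)
    then have xz: "x \<prec> z"
      using less_le_trans[of x "mini v b" z] xU v zU ab by simp
    have zb: "z \<prec> b"
    proof -
      obtain w where "w \<in> ?T" using \<open>?T \<noteq> {}\<close> by blast
      moreover have "\<not> w \<prec> z" using z \<open>w \<in> ?T\<close> unfolding glb_def by blast
      ultimately show ?thesis using le_less_trans[of z w b] zU ab by simp
    qed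
    have right: "g y \<prec> g x" if y: "y \<in> U" "z \<prec> y" "y \<prec> b" for y
    proof -
      obtain w where "w \<in> ?T" "w \<prec> y" using z y unfolding glb_def by blast
      then show ?thesis using y by blast
    qed
    have z1: "z \<in> ivl a1 b" using zU zb xz less_trans[of a1 x z] xU a1U by (simp add: ivl_iff)
    have "dset U {y \<in> U. g y \<prec> g x}"
      by (intro dsetI field_intros dterm_const xU dterm_app[OF g] gU)
    from dec_mem[OF this zU] have "ldec z (\<lambda>y. g y \<prec> g x)"
      unfolding ldec_def evl_def by simp
    \<comment> \<open>If the values just before z were below g(x), then so would be g(z), which is
      smaller than values just after z. The final segment would then extend to the left of
      z.\<close>
    moreover have "\<not> evl z (\<lambda>y. g y \<prec> g x)"
    proof
      assume "evl z (\<lambda>y. g y \<prec> g x)"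
      then obtain u where u: "u \<in> U" "u \<prec> z" "\<forall>y\<in>U. u \<prec> y \<longrightarrow> y \<prec> z \<longrightarrow> g y \<prec> g x"
        unfolding evl_def by blast
      have "evr z (\<lambda>y. g z \<prec> g y)" using m z1 sub by (auto simp: strict_min_def)
      then obtain y where y: "y \<in> U" "z \<prec> y" "y \<prec> b" "g z \<prec> g y"
        using evr_ex_less zU ab zb by blast
      then have gz: "g z \<prec> g x" using right[of y] less_trans[of "g z" "g y" "g x"] gU zU xU by simp
      have "g y \<prec> g x" if "y \<in> U" "u \<prec> y" "y \<prec> b" for y
        using less_linear[of y z] that zU u right gz by blast
      then have "u \<in> ?T" using u less_trans[of u z b] zU zb ab by simp
      then show False using z u unfolding glb_def by blast
    qed
    ultimately have "evl z (\<lambda>y. \<not> g y \<prec> g x)" by (simp add: ldec_def)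
    then obtain u where u: "u \<in> U" "u \<prec> z" "\<forall>y\<in>U. u \<prec> y \<longrightarrow> y \<prec> z \<longrightarrow> \<not> g y \<prec> g x"
      unfolding evl_def by blast
    have "g y' \<prec> g y" if "y \<in> U" "y' \<in> U" "u \<prec> y" "y \<prec> z" "z \<prec> y'" "y' \<prec> b" for y y'
      using less_le_trans[of "g y'" "g x" "g y"] right[of y'] u that gU xU by simp
    then have "drops g z" unfolding drops_def using u zb ab by blast
    then have "z \<in> ?X" using z1 by (simp add: ivl_iff)
    then show "\<exists>z\<in>?X. x \<prec> z" using xz by blast
  qed (use a1U ab in \<open>auto simp: ivl_iff\<close>)
  then obtain p q where "p \<in> U" "q \<in> U" "p \<prec> q" "ivl p q \<subseteq> ?X"
    using infinite_dset[OF dX] by blast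
  moreover have "?X \<subseteq> ivl a b" using sub by (auto simp: ivl_iff)
  ultimately show ?thesis by blast
qed

text \<open>By the previous lemma there is an interval across each point of which \<open>g\<close> drops; applied
  to \<open>g (\<ominus> x)\<close> on that interval, it gives a point across which \<open>g\<close> also rises.\<close>

lemma no_strict_min:
  assumes g: "dfun U g" and ab: "a \<in> U" "b \<in> U" "a \<prec> b"
  shows "\<exists>x\<in>ivl a b. \<not> strict_min g x"
proof (rule ccontr)
  assume "\<not> ?thesis"
  then have m: "strict_min g x" if "x \<in> ivl a b" for x using that by blast
  obtain p q where p: "p \<in> U" "q \<in> U" "p \<prec> q" "ivl p q \<subseteq> ivl a b" "\<forall>z\<in>ivl p q. drops g z"
    using strict_min_drops[OF g ab m] by blast
  let ?h = "\<lambda>x. g (\<ominus> x)"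
  have neg_ivl: "\<ominus> x \<in> ivl p q" if "x \<in> ivl (\<ominus> q) (\<ominus> p)" for x
    using that p neg_less_iff[of q x] less_neg_iff[of x p] by (simp add: ivl_iff)
  have "strict_min ?h x" if x: "x \<in> ivl (\<ominus> q) (\<ominus> p)" for x
  proof -
    have "strict_min g (\<ominus> x)" using neg_ivl[OF x] m p by blast
    then show ?thesis
      using x evr_neg[of x "\<lambda>y. g (\<ominus> x) \<prec> g y"] evl_neg[of x "\<lambda>y. g (\<ominus> x) \<prec> g y"]
      by (simp add: strict_min_def ivl_iff)
  qed
  then obtain r s where r: "r \<in> U" "s \<in> U" "r \<prec> s" "ivl r s \<subseteq> ivl (\<ominus> q) (\<ominus> p)"
    "\<forall>z\<in>ivl r s. drops ?h z"
    using strict_min_drops[OF dfun_reflect[OF g], of "\<ominus> q" "\<ominus> p"] p by auto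
  define z where "z = mid r s"
  have z: "z \<in> U" "z \<in> ivl r s" using r mid_less by (simp_all add: z_def ivl_iff)
  then have "\<ominus> z \<in> ivl p q" using neg_ivl r by blast
  with p have "drops g (\<ominus> z)" by blast
  then obtain u v where u: "u \<in> U" "v \<in> U" "u \<prec> \<ominus> z" "\<ominus> z \<prec> v"
    "\<And>y y'. y \<in> U \<Longrightarrow> y' \<in> U \<Longrightarrow> u \<prec> y \<Longrightarrow> y \<prec> \<ominus> z \<Longrightarrow> \<ominus> z \<prec> y' \<Longrightarrow> y' \<prec> v \<Longrightarrow> g y' \<prec> g y"
    unfolding drops_def by blast
  from r z have "drops ?h z" by blast
  then obtain u' v' where u': "u' \<in> U" "v' \<in> U" "u' \<prec> z" "z \<prec> v'"
    "\<And>y y'. y \<in> U \<Longrightarrow> y' \<in> U \<Longrightarrow> u' \<prec> y \<Longrightarrow> y \<prec> z \<Longrightarrow> z \<prec> y' \<Longrightarrow> y' \<prec> v' \<Longrightarrow> ?h y' \<prec> ?h y"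
    unfolding drops_def by blast
  \<comment> \<open>Both points are taken within the two windows at once. The drop of
    \<open>g\<close> across the point gives g(y') < g(y), the drop of the reflected function gives
    the opposite inequality.\<close>
  obtain y where y: "y \<in> U" "maxi u (\<ominus> v') \<prec> y" "y \<prec> \<ominus> z"
    using dense[of "maxi u (\<ominus> v')" "\<ominus> z"] u u' z by auto
  obtain y' where y': "y' \<in> U" "\<ominus> z \<prec> y'" "y' \<prec> mini v (\<ominus> u')"
    using dense[of "\<ominus> z" "mini v (\<ominus> u')"] u u' z by auto
  have "g y' \<prec> g y" using u(5)[of y y'] y y' u u' by simp
  moreover have "g y \<prec> g y'"
    using u'(5)[of "\<ominus> y'" "\<ominus> y"] y y' u u' z neg_less_iff[of z y'] neg_less_iff[of v' y]
      less_neg_iff[of y' u'] less_neg_iff[of y z] by simp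
  ultimately show False using less_asym dfun_in[OF g] y y' by blast
qed

text \<open>Being a strict local minimum is definable over the parameters of \<open>g\<close>; at a
  point outside \<open>dcl A\<close> it would hold on a whole interval.\<close>

lemma generic_not_strict_min:
  assumes g: "dfun A g" and A: "A \<subseteq> U" and d: "d \<in> U" "d \<notin> dcl A"
  shows "\<not> strict_min g d"
proof
  assume "strict_min g d"
  have "dset A {x \<in> U. strict_min g x}"
    by (intro dsetI field_intros definable_strict_min[OF g])
  from generic_interior[OF this A _ d(2)] d \<open>strict_min g d\<close> obtain p q where
    p: "p \<in> U" "q \<in> U" "p \<prec> d" "d \<prec> q" "ivl p q \<subseteq> {x \<in> U. strict_min g x}" by blast
  then have "p \<prec> q" using less_trans d by blast
  then show False using no_strict_min[OF dfun_mono[OF g A] p(1,2)] p(5) by blast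
qed

text \<open>On each side of \<open>d\<close> the sign of g(y) - g(d) is eventually constant. The
  sign is not positive on both sides, since there is no strict minimum, and not negative on both
  sides, by the same fact for the negative of \<open>g\<close>. The remaining combinations are
  weakly increasing or weakly decreasing.\<close>

lemma generic_winc:
  assumes g: "dfun A g" and A: "A \<subseteq> U" and d: "d \<in> U" "d \<notin> dcl A"
  shows "winc g d \<or> winc (\<lambda>x. \<ominus> (g x)) d"
proof -
  have gU: "g z \<in> U" if "z \<in> U" for z using dfun_in[OF g that] .
  note g' = dfun_mono[OF g A]
  have "dset U {y \<in> U. g y \<prec> g d}"
    by (intro dsetI field_intros dterm_const d dterm_app[OF g'] gU)
  from dec_mem[OF this d(1)] have 1: "rdec d (\<lambda>y. g y \<prec> g d)" "ldec d (\<lambda>y. g y \<prec> g d)"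
    unfolding rdec_def ldec_def evl_def evr_def by simp_all
  have "dset U {y \<in> U. g d \<prec> g y}"
    by (intro dsetI field_intros dterm_const d dterm_app[OF g'] gU)
  from dec_mem[OF this d(1)] have 2: "rdec d (\<lambda>y. g d \<prec> g y)" "ldec d (\<lambda>y. g d \<prec> g y)"
    unfolding rdec_def ldec_def evl_def evr_def by simp_all
  have neg: "winc (\<lambda>x. \<ominus> (g x)) d \<longleftrightarrow> evr d (\<lambda>y. \<not> g d \<prec> g y) \<and> evl d (\<lambda>y. \<not> g y \<prec> g d)"
    unfolding winc_def evr_def evl_def using gU d by simp
  have 3: "\<not> (evr d (\<lambda>y. g d \<prec> g y) \<and> evl d (\<lambda>y. g d \<prec> g y))"
    using generic_not_strict_min[OF g A d] by (simp add: strict_min_def)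
  have "\<not> strict_min (\<lambda>x. \<ominus> (g x)) d"
    using generic_not_strict_min[OF dfun_neg[OF g] A d] .
  then have 4: "\<not> (evr d (\<lambda>y. g y \<prec> g d) \<and> evl d (\<lambda>y. g y \<prec> g d))"
    unfolding strict_min_def evr_def evl_def using gU d by simp
  have 5: "evr d (\<lambda>y. g y \<prec> g d) \<Longrightarrow> evr d (\<lambda>y. \<not> g d \<prec> g y)"
    "evr d (\<lambda>y. g d \<prec> g y) \<Longrightarrow> evr d (\<lambda>y. \<not> g y \<prec> g d)"
    by (rule evr_mono, assumption, metis less_asym gU d(1))+
  have 6: "evl d (\<lambda>y. g y \<prec> g d) \<Longrightarrow> evl d (\<lambda>y. \<not> g d \<prec> g y)"
    "evl d (\<lambda>y. g d \<prec> g y) \<Longrightarrow> evl d (\<lambda>y. \<not> g y \<prec> g d)"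
    by (rule evl_mono, assumption, metis less_asym gU d(1))+
  show ?thesis
    unfolding neg winc_def[of g] using 1 2 3 4 5 6 unfolding rdec_def ldec_def by blast
qed

text \<open>If some value is taken infinitely often, \<open>g\<close> is constant on an interval.
  Otherwise all fibres are finite, so the image is infinite and contains an interval. Above an inner
  point v of that interval, values on both sides of v and as close as desired are attained, and
  monotonicity traps \<open>g\<close> between them.\<close>

lemma winc_ex_cont:
  assumes g: "dfun U g" and pq: "p \<in> U" "q \<in> U" "p \<prec> q" and w: "\<And>x. x \<in> ivl p q \<Longrightarrow> winc g x"
  shows "\<exists>x\<in>ivl p q. cont_at g x"
proof (cases "\<exists>v\<in>U. infinite {x \<in> U. p \<prec> x \<and> x \<prec> q \<and> g x = v}")
  case True
  then obtain v where v: "v \<in> U" "infinite {x \<in> U. p \<prec> x \<and> x \<prec> q \<and> g x = v}" by blast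
  have "dset U {x \<in> U. p \<prec> x \<and> x \<prec> q \<and> g x = v}"
    by (intro dsetI field_intros dterm_const pq v dterm_app[OF g])
  from infinite_dset[OF this v(2)] obtain r s where r: "r \<in> U" "s \<in> U" "r \<prec> s"
    "ivl r s \<subseteq> {x \<in> U. p \<prec> x \<and> x \<prec> q \<and> g x = v}" by blast
  define x where "x = mid r s"
  have x: "x \<in> U" "r \<prec> x" "x \<prec> s" using r mid_less by (simp_all add: x_def)
  have rs: "p \<prec> y \<and> y \<prec> q \<and> g y = v" if "y \<in> U" "r \<prec> y" "y \<prec> s" for y
    using r(4) that by (auto simp: ivl_iff)
  have "cont_at g x" unfolding cont_at_def
  proof (intro ballI impI)
    fix p' q' assume "p' \<in> U" "q' \<in> U" "p' \<prec> g x" "g x \<prec> q'"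
    then show "\<exists>u\<in>U. \<exists>v\<in>U. u \<prec> x \<and> x \<prec> v \<and> (\<forall>y\<in>U. u \<prec> y \<longrightarrow> y \<prec> v \<longrightarrow> p' \<prec> g y \<and> g y \<prec> q')"
      using r x rs by (intro bexI[of _ r] bexI[of _ s]) auto
  qed
  then show ?thesis using rs[OF x] x by (auto simp: ivl_iff)
next
  case False
  have gU: "g z \<in> U" if "z \<in> U" for z using dfun_in[OF g that] .
  have mono: "\<not> g y \<prec> g x" if "x \<in> ivl p q" "y \<in> ivl p q" "x \<prec> y" for x y
    using winc_mono[OF g pq(1,2) w that] .
  have "infinite (g ` ivl p q)"
  proof
    assume f: "finite (g ` ivl p q)"
    have "finite {x \<in> ivl p q. g x = v}" if "v \<in> g ` ivl p q" for v
    proof -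
      have "v \<in> U" using that gU by (auto simp: ivl_iff)
      with False show ?thesis by (simp add: ivl_iff)
    qed
    then have "finite (\<Union>v\<in>g ` ivl p q. {x \<in> ivl p q. g x = v})" using f by blast
    moreover have "ivl p q \<subseteq> (\<Union>v\<in>g ` ivl p q. {x \<in> ivl p q. g x = v})" by blast
    ultimately show False using infinite_ivl[OF pq] finite_subset by blast
  qed
  moreover have eq: "g ` ivl p q = {y \<in> U. \<exists>x\<in>U. p \<prec> x \<and> x \<prec> q \<and> y = g x}"
    using gU by (auto simp: ivl_iff)
  moreover have "dset U {y \<in> U. \<exists>x\<in>U. p \<prec> x \<and> x \<prec> q \<and> y = g x}"
    by (intro dsetI field_intros dterm_const pq dterm_app[OF g])
  ultimately obtain r s where r: "r \<in> U" "s \<in> U" "r \<prec> s" "ivl r s \<subseteq> g ` ivl p q"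
    using infinite_dset by metis
  define v where "v = mid r s"
  have v: "v \<in> U" "r \<prec> v" "v \<prec> s" using r mid_less by (simp_all add: v_def)
  then obtain x where x: "x \<in> ivl p q" "g x = v" using r(4) by (force simp: ivl_iff)
  have xU: "x \<in> U" using x by (simp add: ivl_iff)
  have "cont_at g x" unfolding cont_at_def
  proof (intro ballI impI)
    fix p' q' assume p': "p' \<in> U" "q' \<in> U" "p' \<prec> g x" "g x \<prec> q'"
    obtain w1 where w1: "w1 \<in> U" "maxi p' r \<prec> w1" "w1 \<prec> v"
      using dense[of "maxi p' r" v] p' r v x by auto
    obtain w2 where w2: "w2 \<in> U" "v \<prec> w2" "w2 \<prec> mini q' s"
      using dense[of v "mini q' s"] p' r v x by auto
    have "w1 \<in> ivl r s" using w1 p' r v less_trans[of w1 v s] by (simp add: ivl_iff)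
    then obtain x1 where x1: "x1 \<in> ivl p q" "g x1 = w1" using r(4) by blast
    have "w2 \<in> ivl r s" using w2 p' r v less_trans[of r v w2] by (simp add: ivl_iff)
    then obtain x2 where x2: "x2 \<in> ivl p q" "g x2 = w2" using r(4) by blast
    have xs: "x1 \<in> U" "x2 \<in> U" using x1 x2 by (auto simp: ivl_iff)
    have "x1 \<prec> x" using mono[OF x(1) x1(1)] less_linear[of x1 x] w1 x x1 xs xU v by auto
    moreover have "x \<prec> x2" using mono[OF x2(1) x(1)] less_linear[of x2 x] w2 x x2 xs xU v by auto
    moreover have "p' \<prec> g y \<and> g y \<prec> q'" if y: "y \<in> U" "x1 \<prec> y" "y \<prec> x2" for y
    proof -
      have "y \<in> ivl p q"
        using y x1(1) x2(1) less_trans[of p x1 y] less_trans[of y x2 q] pq by (simp add: ivl_iff)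
      then have "\<not> g y \<prec> w1" "\<not> w2 \<prec> g y" using mono x1 x2 y by auto
      then show ?thesis
        using less_le_trans[of p' w1 "g y"] le_less_trans[of "g y" w2 q'] w1 w2 p' r gU y by simp
    qed
    ultimately show "\<exists>u\<in>U. \<exists>v\<in>U. u \<prec> x \<and> x \<prec> v \<and> (\<forall>y\<in>U. u \<prec> y \<longrightarrow> y \<prec> v \<longrightarrow> p' \<prec> g y \<and> g y \<prec> q')"
      using xs by blast
  qed
  then show ?thesis using x by blast
qed

lemma cont_at_neg:
  assumes "\<And>x. x \<in> U \<Longrightarrow> g x \<in> U" "x \<in> U" "cont_at (\<lambda>x. \<ominus> (g x)) x"
  shows "cont_at g x"
  unfolding cont_at_def
proof (intro ballI impI)
  fix p q assume p: "p \<in> U" "q \<in> U" "p \<prec> g x" "g x \<prec> q"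
  then obtain u v where "u \<in> U" "v \<in> U" "u \<prec> x" "x \<prec> v"
    "\<forall>y\<in>U. u \<prec> y \<longrightarrow> y \<prec> v \<longrightarrow> \<ominus> q \<prec> \<ominus> (g y) \<and> \<ominus> (g y) \<prec> \<ominus> p"
    using assms(3)[unfolded cont_at_def, rule_format, of "\<ominus> q" "\<ominus> p"] assms by auto
  then show "\<exists>u\<in>U. \<exists>v\<in>U. u \<prec> x \<and> x \<prec> v \<and> (\<forall>y\<in>U. u \<prec> y \<longrightarrow> y \<prec> v \<longrightarrow> p \<prec> g y \<and> g y \<prec> q)"
    using assms(1) p by (intro bexI[of _ u] bexI[of _ v]) auto
qed

text \<open>A discontinuity at \<open>d\<close> would spread, together with the monotonicity of
  \<open>g\<close> or of its negative, to an interval, and every such interval contains a point of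
  continuity.\<close>

lemma generic_cont_at:
  assumes g: "dfun A g" and A: "A \<subseteq> U" and d: "d \<in> U" "d \<notin> dcl A"
  shows "cont_at g d"
proof (rule ccontr)
  assume nc: "\<not> cont_at g d"
  have *: False if h: "dfun A h" "winc h d" "\<And>x. x \<in> U \<Longrightarrow> cont_at h x \<Longrightarrow> cont_at g x" for h
  proof -
    have "dset A {x \<in> U. winc h x \<and> \<not> cont_at g x}"
      by (intro dsetI field_intros definable_winc[OF h(1)] definable_cont_at[OF g])
    from generic_interior[OF this A _ d(2)] h(2) nc d(1) obtain p q where
      p: "p \<in> U" "q \<in> U" "p \<prec> d" "d \<prec> q" "ivl p q \<subseteq> {x \<in> U. winc h x \<and> \<not> cont_at g x}" by blast
    then have "p \<prec> q" using less_trans d by blast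
    then obtain x where "x \<in> ivl p q" "cont_at h x"
      using winc_ex_cont[OF dfun_mono[OF h(1) A] p(1,2)] p(5) by blast
    then show False using h(3) p(5) by (auto simp: ivl_iff)
  qed
  show False
    using generic_winc[OF g A d] *[OF g] *[OF dfun_neg[OF g]] cont_at_neg dfun_in[OF g] by blast
qed

end

section \<open>Several variables\<close>

context o_minimal_field
begin

lemma definable_subst_params:
  assumes "definable A P" "\<And>k a. \<sigma> k = Inr a \<Longrightarrow> a \<in> A \<and> a \<in> U"
  shows "definable A (\<lambda>e. P (\<lambda>k. pval e (\<sigma> k)))"
proof -
  from assms(1) obtain p s where p: "is_formula L p" "\<forall>k a. s k = Inr a \<longrightarrow> a \<in> A"
    "\<forall>e\<in>vals. P e \<longleftrightarrow> sat M (\<lambda>k. pval e (s k)) p"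
    unfolding definable_def by blast
  define t where "t k = (case s k of Inl i \<Rightarrow> \<sigma> i | Inr a \<Rightarrow> Inr a)" for k
  have "\<forall>k a. t k = Inr a \<longrightarrow> a \<in> A"
    using p(2) assms(2) by (auto simp: t_def split: sum.splits)
  moreover have "P (\<lambda>k. pval e (\<sigma> k)) \<longleftrightarrow> sat M (\<lambda>k. pval e (t k)) p" if e: "e \<in> vals" for e
  proof -
    have "pval e (\<sigma> k) \<in> U" for k
      using e assms(2) by (cases "\<sigma> k") auto
    then have "(\<lambda>k. pval e (\<sigma> k)) \<in> vals" by (rule valsI)
    moreover have "pval (\<lambda>k. pval e (\<sigma> k)) (s k) = pval e (t k)" for k
      by (auto simp: t_def split: sum.splits)
    ultimately show ?thesis using p(3) by simp
  qed
  ultimately show ?thesis unfolding definable_def using p(1) by blast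
qed

text \<open>Freezing all coordinates but \<open>i\<close> turns them into parameters, so that the
  one-variable results apply in direction \<open>i\<close>.\<close>

lemma definable_slice:
  assumes "definable {} P" "e \<in> vals"
  shows "definable (e ` (- {i})) (\<lambda>e'. P (e(i := e' 0)))"
proof -
  have "(\<lambda>k. pval e' (if k = i then Inl 0 else Inr (e k))) = e(i := e' 0)" for e' :: "nat \<Rightarrow> 'u"
    by auto
  moreover have "definable (e ` (- {i})) (\<lambda>e'. P (\<lambda>k. pval e' (if k = i then Inl 0 else Inr (e k))))"
    by (rule definable_subst_params[OF definable_mono[OF assms(1)]])
      (use assms(2) in \<open>auto split: if_splits\<close>)
  ultimately show ?thesis by simp
qed

lemma dfun_slice:
  assumes "dterm {} F" "e \<in> vals"
  shows "dfun (e ` (- {i})) (\<lambda>x. F (e(i := x)))"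
proof -
  \<comment> \<open>Coordinate \<open>0\<close> holds the value of the graph and the arguments are
    shifted by one, so argument \<open>i\<close> sits at \<open>Suc i\<close>; it becomes the
    variable \<open>1\<close> and every other argument becomes a parameter.\<close>
  let ?\<sigma> = "\<lambda>k. case k of 0 \<Rightarrow> Inl 0 | Suc k \<Rightarrow> if k = i then Inl (Suc 0) else Inr (e k)"
  have "(\<lambda>k. pval e' (?\<sigma> (Suc k))) = e(i := e' 1)" for e' :: "nat \<Rightarrow> 'u"
    by auto
  moreover have "definable (e ` (- {i})) (\<lambda>e. e 0 = F (\<lambda>k. e (Suc k)))"
    using assms(1) definable_mono unfolding dterm_def by blast
  then have "definable (e ` (- {i})) (\<lambda>e'. pval e' (?\<sigma> 0) = F (\<lambda>k. pval e' (?\<sigma> (Suc k))))"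
    by (rule definable_subst_params) (use assms(2) in \<open>auto split: nat.splits if_splits\<close>)
  ultimately have "definable (e ` (- {i})) (\<lambda>e'. e' 0 = F (e(i := e' 1)))"
    by simp
  then show ?thesis
    using assms unfolding dfun_def dterm_def by simp
qed

lemma dset_slice:
  "definable {} P \<Longrightarrow> e \<in> vals \<Longrightarrow> dset (e ` (- {i})) {x \<in> U. P (e(i := x))}"
  by (intro dsetI definable_slice)

lemma definable_upd:
  assumes "definable A P"
  shows "definable A (\<lambda>e. P ((\<lambda>k. e (\<pi> k))(i := e j)))"
proof -
  have "(\<lambda>k. e (if k = i then j else \<pi> k)) = (\<lambda>k. e (\<pi> k))(i := e j)" for e :: "nat \<Rightarrow> 'u"
    by auto
  then show ?thesis
    using definable_rename[OF assms, of "\<lambda>k. if k = i then j else \<pi> k"] by (simp only:)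
qed

lemma dterm_upd:
  assumes "dterm A F"
  shows "dterm A (\<lambda>e. F ((\<lambda>k. e (\<pi> k))(i := e j)))"
proof -
  have "(\<lambda>k. e (if k = i then j else \<pi> k)) = (\<lambda>k. e (\<pi> k))(i := e j)" for e :: "nat \<Rightarrow> 'u"
    by auto
  then show ?thesis
    using dterm_rename[OF assms, of "\<lambda>k. if k = i then j else \<pi> k"] by (simp only:)
qed

text \<open>An element definable from the coordinates in \<open>J\<close> is the value at
  \<open>e\<close> of a total function that is definable without parameters: the parameters in the
  definition are made variables. Consulting only the coordinates in \<open>J\<close> is what lets
  the function survive changes of the others.\<close>

lemma dcl_function:
  assumes "c \<in> dcl (e ` J)" "e \<in> vals"
  shows "\<exists>F. dterm {} F \<and> F e = c \<and> (\<forall>e1 e2. (\<forall>j\<in>J. e1 j = e2 j) \<longrightarrow> F e1 = F e2)"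
proof -
  have cU: "c \<in> U" and "definable (e ` J) (\<lambda>e'. e' 0 = c)"
    using assms(1) by (auto simp: dcl_def)
  from definable_params_to_vars[OF this(2)] obtain Q where
    Q: "definable {} (\<lambda>E. Q (\<lambda>k. E (2 * k)) (\<lambda>k. E (2 * k + 1)))"
      "\<forall>e'\<in>vals. (e' 0 = c) = Q e e'"
      "\<forall>c c' e. (\<forall>j\<in>J. c j = c' j) \<longrightarrow> Q c e = Q c' e" by blast
  define R where "R e x \<longleftrightarrow> Q e (\<lambda>_. x) \<and> (\<forall>y\<in>U. Q e (\<lambda>_. y) \<longrightarrow> y = x)" for e x
  \<comment> \<open>Away from \<open>e\<close> the formula may have no solution or several; the
    default \<open>\<zero>\<close> keeps the function total and definable.\<close>
  define F where "F e = (if \<exists>x\<in>U. R e x then THE x. x \<in> U \<and> R e x else \<zero>)" for e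
  have Rx: "F e = x" if "x \<in> U" "R e x" for e x
  proof -
    have "(THE x. x \<in> U \<and> R e x) = x"
      using that unfolding R_def by (intro the_equality) blast+
    then show ?thesis using that by (auto simp: F_def)
  qed
  have dQ: "definable {} (\<lambda>e. Q (\<lambda>k. e (\<pi> k)) (\<lambda>_. e j))" for \<pi> j
    using definable_rename[OF Q(1), of "\<lambda>k. if even k then \<pi> (k div 2) else j"] by simp
  have dR: "definable {} (\<lambda>e. R (\<lambda>k. e (\<pi> k)) (e j))" for \<pi> j
    unfolding R_def by (intro field_intros dQ)
  have Feq: "x = F e \<longleftrightarrow> R e x \<or> x = \<zero> \<and> \<not> (\<exists>y\<in>U. R e y)" if "x \<in> U" for x e
    using Rx[of x e] Rx[of _ e] that by (cases "\<exists>y\<in>U. R e y") (auto simp: F_def[of e])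
  have "F e \<in> U" for e
    using Rx[of _ e] by (cases "\<exists>y\<in>U. R e y") (auto simp: F_def[of e])
  moreover have "definable {} (\<lambda>e. R (\<lambda>k. e (Suc k)) (e 0) \<or>
      e 0 = \<zero> \<and> \<not> (\<exists>y\<in>U. R (\<lambda>k. e (Suc k)) y))"
    by (intro field_intros dR)
  ultimately have "dterm {} F"
    unfolding dterm_def by (simp add: Feq cong: definable_cong)
  moreover have "F e = c"
  proof (rule Rx[OF cU])
    have "Q e (\<lambda>_. x) \<longleftrightarrow> x = c" if "x \<in> U" for x
      using Q(2)[rule_format, of "\<lambda>_. x"] that by (simp add: vals_def)
    then show "R e c" using cU by (auto simp: R_def)
  qed
  moreover have "F e1 = F e2" if "\<forall>j\<in>J. e1 j = e2 j" for e1 e2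
  proof -
    have "Q e1 x = Q e2 x" for x using Q(3) that by blast
    then have "R e1 = R e2" by (simp add: R_def fun_eq_iff)
    then show ?thesis by (simp add: F_def)
  qed
  ultimately show ?thesis by blast
qed

section \<open>Boxes, interior points and independence in a block of coordinates\<close>

definition near :: "nat set \<Rightarrow> 'u \<Rightarrow> (nat \<Rightarrow> 'u) \<Rightarrow> (nat \<Rightarrow> 'u) \<Rightarrow> bool" where
  "near I r e e' \<longleftrightarrow> (\<forall>k. k \<notin> I \<longrightarrow> e' k = e k) \<and> (\<forall>i\<in>I. nearby r (e i) (e' i))"

definition open_at :: "((nat \<Rightarrow> 'u) \<Rightarrow> bool) \<Rightarrow> nat set \<Rightarrow> (nat \<Rightarrow> 'u) \<Rightarrow> bool" where
  "open_at P I e \<longleftrightarrow> (\<exists>r\<in>U. \<zero> \<prec> r \<and> (\<forall>e'\<in>vals. near I r e e' \<longrightarrow> P e'))"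

definition contI :: "((nat \<Rightarrow> 'u) \<Rightarrow> 'u) \<Rightarrow> nat set \<Rightarrow> (nat \<Rightarrow> 'u) \<Rightarrow> bool" where
  "contI F I e \<longleftrightarrow> (\<forall>p\<in>U. \<forall>q\<in>U. p \<prec> F e \<longrightarrow> F e \<prec> q \<longrightarrow> open_at (\<lambda>e'. p \<prec> F e' \<and> F e' \<prec> q) I e)"

text \<open>Independence of the coordinates in \<open>I\<close>, each over all the others, including
  those outside \<open>I\<close>. The coordinates outside \<open>I\<close> act as
  parameters.\<close>

definition generic :: "nat set \<Rightarrow> (nat \<Rightarrow> 'u) \<Rightarrow> bool" where
  "generic I e \<longleftrightarrow> e \<in> vals \<and> (\<forall>i\<in>I. e i \<notin> dcl (e ` (- {i})))"

text \<open>Both halves quantify over all parameter-free predicates and functions, since the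
  induction step applies them to auxiliary ones and not only to those it starts from.\<close>

definition tame_at :: "nat set \<Rightarrow> (nat \<Rightarrow> 'u) \<Rightarrow> bool" where
  "tame_at I e \<longleftrightarrow> (\<forall>P. definable {} P \<longrightarrow> P e \<longrightarrow> open_at P I e) \<and>
     (\<forall>F. dterm {} F \<longrightarrow> contI F I e)"

text \<open>\<open>P\<close> may depend on the outer valuation as well: in \<open>contI\<close> the
  bounds \<open>p\<close> and \<open>q\<close> are coordinates of it, and \<open>\<pi>\<close> skips
  them when the centre is read off.\<close>

lemma definable_open_at:
  assumes I: "finite I" and P: "definable A (\<lambda>E. P (\<lambda>k. E (2 * k)) (\<lambda>k. E (2 * k + 1)))"
  shows "definable A (\<lambda>e. open_at (P e) I (\<lambda>k. e (\<pi> k)))"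
proof -
  have P': "definable A (\<lambda>E. P (\<lambda>k. E (2 * Suc k)) (\<lambda>k. E (2 * k + 1)))"
    using definable_rename[OF P, of "\<lambda>k. if even k then 2 * Suc (k div 2) else k"] by simp
  have "definable A (\<lambda>e. \<exists>r\<in>U. \<zero> \<prec> r \<and> (\<forall>e'\<in>vals. (\<forall>k. k \<notin> I \<longrightarrow> e' k = e (\<pi> k)) \<longrightarrow>
      (\<forall>i\<in>I. nearby r (e (\<pi> i)) (e' i)) \<longrightarrow> P e e'))"
    by (intro field_intros definable_block_all[OF I] definable_finite_all[OF I] P')
  moreover have "open_at (P e) I (\<lambda>k. e (\<pi> k)) \<longleftrightarrow>
    (\<exists>r\<in>U. \<zero> \<prec> r \<and> (\<forall>e'\<in>vals. (\<forall>k. k \<notin> I \<longrightarrow> e' k = e (\<pi> k)) \<longrightarrow>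
      (\<forall>i\<in>I. nearby r (e (\<pi> i)) (e' i)) \<longrightarrow> P e e'))" for e
    unfolding open_at_def near_def by blast
  ultimately show ?thesis by simp
qed

lemma definable_contI:
  assumes I: "finite I" and F: "dterm A F"
  shows "definable A (\<lambda>e. contI F I e)"
  unfolding contI_def
  by (intro field_intros definable_open_at[OF I] dterm_rename[OF F] F)

lemma near_mini:
  assumes "near I (mini r r') e e'" "r \<in> U" "r' \<in> U" "e \<in> vals" "e' \<in> vals"
  shows "near I r e e'" "near I r' e e'"
proof -
  have "nearby r (e i) (e' i) \<and> nearby r' (e i) (e' i)" if "i \<in> I" for i
  proof -
    have "nearby (mini r r') (e i) (e' i)" using assms(1) that by (simp add: near_def)
    from nearby_mini[OF this] assms show ?thesis by simp
  qed
  then show "near I r e e'" "near I r' e e'" using assms(1) by (auto simp: near_def)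
qed

lemma near_mini4:
  assumes "near I (mini (mini r1 r2) (mini r3 r4)) e e'" "r1 \<in> U" "r2 \<in> U" "r3 \<in> U" "r4 \<in> U"
    "e \<in> vals" "e' \<in> vals"
  shows "near I r1 e e'" "near I r2 e e'" "near I r3 e e'" "near I r4 e e'"
proof -
  note n = near_mini[OF assms(1) mini_closed[OF assms(2,3)] mini_closed[OF assms(4,5)] assms(6,7)]
  show "near I r1 e e'" "near I r2 e e'" "near I r3 e e'" "near I r4 e e'"
    using near_mini[OF n(1) assms(2,3,6,7)] near_mini[OF n(2) assms(4,5,6,7)] by simp_all
qed

lemma near_refl: "e \<in> vals \<Longrightarrow> r \<in> U \<Longrightarrow> \<zero> \<prec> r \<Longrightarrow> near I r e e"
  by (simp add: near_def nearby_refl)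

text \<open>The least boundary point to the right of \<open>x\<close> serves as \<open>c\<close>; if
  there is none, \<open>X\<close> fills the whole ray. As a boundary point, \<open>c\<close> is
  definable over \<open>A\<close>.\<close>

lemma right_end:
  assumes X: "dset A X" and A: "A \<subseteq> U" and x: "x \<in> U" "evr x (\<lambda>y. y \<in> X)"
  obtains "\<And>y. y \<in> U \<Longrightarrow> x \<prec> y \<Longrightarrow> y \<in> X"
  | c where "c \<in> dcl A" "x \<prec> c" "\<And>y. y \<in> U \<Longrightarrow> x \<prec> y \<Longrightarrow> y \<prec> c \<Longrightarrow> y \<in> X"
proof -
  let ?W = "{w \<in> bd X. x \<prec> w}"
  note X' = dset_mono[OF X A]
  have "finite ?W" by (rule finite_subset[OF _ finite_bd[OF X']]) auto
  moreover have "?W \<subseteq> U" by (auto simp: bd_def)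
  ultimately have fin: "finite ?W" "?W \<subseteq> U" .
  show thesis
  proof (cases "?W = {}")
    case True
    then show ?thesis using bd_right[OF X' x] that(1) by blast
  next
    case False
    then obtain c where c: "c \<in> ?W" "\<forall>w\<in>?W. \<not> w \<prec> c" using finite_min[OF fin(1) False fin(2)] by blast
    have cU: "c \<in> U" using c fin by blast
    have "y \<in> X" if y: "y \<in> U" "x \<prec> y" "y \<prec> c" for y
    proof (rule ccontr)
      assume "y \<notin> X"
      then obtain w where w: "w \<in> bd X" "x \<prec> w" "\<not> y \<prec> w" using bd_right[OF X' x] y by blast
      then have wU: "w \<in> U" by (simp add: bd_def)
      have "w \<prec> c" using le_less_trans[of w y c] wU w y cU by simp
      then show False using c w by blast
    qed
    then show ?thesis using that(2)[of c] c bd_subset_dcl[OF X A] by blast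
  qed
qed

lemma left_end:
  assumes X: "dset A X" and A: "A \<subseteq> U" and x: "x \<in> U" "evl x (\<lambda>y. y \<in> X)"
  obtains "\<And>y. y \<in> U \<Longrightarrow> y \<prec> x \<Longrightarrow> y \<in> X"
  | c where "c \<in> dcl A" "c \<prec> x" "\<And>y. y \<in> U \<Longrightarrow> y \<prec> x \<Longrightarrow> c \<prec> y \<Longrightarrow> y \<in> X"
proof -
  let ?W = "{w \<in> bd X. w \<prec> x}"
  note X' = dset_mono[OF X A]
  have "finite ?W" by (rule finite_subset[OF _ finite_bd[OF X']]) auto
  moreover have "?W \<subseteq> U" by (auto simp: bd_def)
  ultimately have fin: "finite ?W" "?W \<subseteq> U" .
  show thesis
  proof (cases "?W = {}")
    case True
    then show ?thesis using bd_left[OF X' x] that(1) by blast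
  next
    case False
    then obtain c where c: "c \<in> ?W" "\<forall>w\<in>?W. \<not> c \<prec> w" using finite_max[OF fin(1) False fin(2)] by blast
    have cU: "c \<in> U" using c fin by blast
    have "y \<in> X" if y: "y \<in> U" "y \<prec> x" "c \<prec> y" for y
    proof (rule ccontr)
      assume "y \<notin> X"
      then obtain w where w: "w \<in> bd X" "w \<prec> x" "\<not> w \<prec> y" using bd_left[OF X' x] y by blast
      then have wU: "w \<in> U" by (simp add: bd_def)
      have "c \<prec> w" using less_le_trans[of c y w] wU w y cU by simp
      then show False using c w by blast
    qed
    then show ?thesis using that(2)[of c] c bd_subset_dcl[OF X A] by blast
  qed
qed

text \<open>The ends of the component of \<open>e i\<close> in the fibre of \<open>P\<close> are definable from the other
  coordinates, so they are values of functions which are continuous by hypothesis.\<close>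

lemma open_at_insert:
  assumes i: "i \<notin> I" and e: "e \<in> vals" and tame: "tame_at I (e(i := \<zero>))"
    and P: "definable {} P" "P e"
    and ev: "evr (e i) (\<lambda>a. P (e(i := a)))" "evl (e i) (\<lambda>a. P (e(i := a)))"
  shows "open_at P (insert i I) e"
proof -
  define A where "A = e ` (- {i})"
  define X where "X = {a \<in> U. P (e(i := a))}"
  \<comment> \<open>The hypothesis about \<open>I\<close> is used with coordinate \<open>i\<close>
    erased. This loses nothing, because the functions for the ends do not look at that coordinate,
    and it leaves \<open>e i\<close> free to be a value on which the other coordinates
    depend.\<close>
  define e0 where "e0 = e(i := \<zero>)"
  have A: "A \<subseteq> U" using e by (auto simp: A_def)
  have X: "dset A X" unfolding A_def X_def using P e by (intro dset_slice)
  have e0: "e0 \<in> vals" using e by (simp add: e0_def)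
  have diU: "e i \<in> U" using e by simp
  have evX: "evr (e i) (\<lambda>a. a \<in> X)" "evl (e i) (\<lambda>a. a \<in> X)"
    using ev unfolding X_def evr_def evl_def by auto
  \<comment> \<open>\<open>H\<close> is a parameter-free guard for lying before the right end: it is
    trivial if there is no right end, and otherwise compares coordinate \<open>i\<close> with the
    function giving the end. The fixed point \<open>q\<close> separates \<open>e i\<close> from the
    end, so by continuity the guard holds below \<open>q\<close> at all nearby valuations.\<close>
  obtain H q r where H: "definable {} H" "\<And>a. a \<in> U \<Longrightarrow> e i \<prec> a \<Longrightarrow> H (e(i := a)) \<Longrightarrow> a \<in> X"
    "q \<in> U" "e i \<prec> q" "r \<in> U" "\<zero> \<prec> r"
    "\<And>e' a. e' \<in> vals \<Longrightarrow> near I r e0 e' \<Longrightarrow> a \<in> U \<Longrightarrow> a \<prec> q \<Longrightarrow> H (e'(i := a))"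
  proof (rule right_end[OF X A diU evX(1)])
    assume "\<And>y. y \<in> U \<Longrightarrow> e i \<prec> y \<Longrightarrow> y \<in> X"
    moreover obtain q where "q \<in> U" "e i \<prec> q" using ex_greater diU by blast
    ultimately show thesis using that[of "\<lambda>e. True" q \<one>] by (simp add: definable_True)
  next
    fix c assume c: "c \<in> dcl A" "e i \<prec> c" "\<And>y. y \<in> U \<Longrightarrow> e i \<prec> y \<Longrightarrow> y \<prec> c \<Longrightarrow> y \<in> X"
    obtain F where F: "dterm {} F" "F e = c"
      "\<forall>e1 e2. (\<forall>j\<in>- {i}. e1 j = e2 j) \<longrightarrow> F e1 = F e2"
      using dcl_function[OF c(1)[unfolded A_def] e] by blast
    have Fupd: "F (e'(i := a)) = F e'" for e' a using F(3) by simp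
    have cU: "c \<in> U" using c dcl_in by blast
    obtain q where q: "q \<in> U" "e i \<prec> q" "q \<prec> c" using dense diU cU c(2) by blast
    obtain q' where q': "q' \<in> U" "c \<prec> q'" using ex_greater cU by blast
    have "contI F I e0" using tame F(1) by (simp add: tame_at_def e0_def)
    moreover have "F e0 = c" using F(2) by (simp add: e0_def Fupd)
    ultimately have "open_at (\<lambda>e'. q \<prec> F e' \<and> F e' \<prec> q') I e0"
      using q q' by (simp add: contI_def)
    then obtain r where r: "r \<in> U" "\<zero> \<prec> r" "\<And>e'. e' \<in> vals \<Longrightarrow> near I r e0 e' \<Longrightarrow> q \<prec> F e'"
      unfolding open_at_def by blast
    have "definable {} (\<lambda>e. e i \<prec> F e)" by (intro field_intros F)
    moreover have "a \<in> X" if "a \<in> U" "e i \<prec> a" "(e(i := a)) i \<prec> F (e(i := a))" for a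
      using c(3) that F(2) by (simp add: Fupd)
    moreover have "(e'(i := a)) i \<prec> F (e'(i := a))"
      if "e' \<in> vals" "near I r e0 e'" "a \<in> U" "a \<prec> q" for e' a
      using r(3)[OF that(1,2)] less_trans[of a q "F e'"] that q dterm_in[OF F(1)] by (simp add: Fupd)
    ultimately show thesis using that[of "\<lambda>e. e i \<prec> F e" q r] q r by blast
  qed
  obtain H' q' r' where H': "definable {} H'" "\<And>a. a \<in> U \<Longrightarrow> a \<prec> e i \<Longrightarrow> H' (e(i := a)) \<Longrightarrow> a \<in> X"
    "q' \<in> U" "q' \<prec> e i" "r' \<in> U" "\<zero> \<prec> r'"
    "\<And>e' a. e' \<in> vals \<Longrightarrow> near I r' e0 e' \<Longrightarrow> a \<in> U \<Longrightarrow> q' \<prec> a \<Longrightarrow> H' (e'(i := a))"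
  proof (rule left_end[OF X A diU evX(2)])
    assume "\<And>y. y \<in> U \<Longrightarrow> y \<prec> e i \<Longrightarrow> y \<in> X"
    moreover obtain q where "q \<in> U" "q \<prec> e i" using ex_less diU by blast
    ultimately show thesis using that[of "\<lambda>e. True" q \<one>] by (simp add: definable_True)
  next
    fix c assume c: "c \<in> dcl A" "c \<prec> e i" "\<And>y. y \<in> U \<Longrightarrow> y \<prec> e i \<Longrightarrow> c \<prec> y \<Longrightarrow> y \<in> X"
    obtain F where F: "dterm {} F" "F e = c"
      "\<forall>e1 e2. (\<forall>j\<in>- {i}. e1 j = e2 j) \<longrightarrow> F e1 = F e2"
      using dcl_function[OF c(1)[unfolded A_def] e] by blast
    have Fupd: "F (e'(i := a)) = F e'" for e' a using F(3) by simp
    have cU: "c \<in> U" using c dcl_in by blast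
    obtain q where q: "q \<in> U" "c \<prec> q" "q \<prec> e i" using dense diU cU c(2) by blast
    obtain q' where q': "q' \<in> U" "q' \<prec> c" using ex_less cU by blast
    have "contI F I e0" using tame F(1) by (simp add: tame_at_def e0_def)
    moreover have "F e0 = c" using F(2) by (simp add: e0_def Fupd)
    ultimately have "open_at (\<lambda>e'. q' \<prec> F e' \<and> F e' \<prec> q) I e0"
      using q q' by (simp add: contI_def)
    then obtain r where r: "r \<in> U" "\<zero> \<prec> r" "\<And>e'. e' \<in> vals \<Longrightarrow> near I r e0 e' \<Longrightarrow> F e' \<prec> q"
      unfolding open_at_def by blast
    have "definable {} (\<lambda>e. F e \<prec> e i)" by (intro field_intros F)
    moreover have "a \<in> X" if "a \<in> U" "a \<prec> e i" "F (e(i := a)) \<prec> (e(i := a)) i" for a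
      using c(3) that F(2) by (simp add: Fupd)
    moreover have "F (e'(i := a)) \<prec> (e'(i := a)) i"
      if "e' \<in> vals" "near I r e0 e'" "a \<in> U" "q \<prec> a" for e' a
      using r(3)[OF that(1,2)] less_trans[of "F e'" q a] that q dterm_in[OF F(1)] by (simp add: Fupd)
    ultimately show thesis using that[of "\<lambda>e. F e \<prec> e i" q r] q r by blast
  qed
  \<comment> \<open>That both guards together imply \<open>P\<close> in direction \<open>i\<close>
    is a parameter-free property of the remaining coordinates. It is true at \<open>e0\<close>,
    hence true nearby by the openness half of the hypothesis.\<close>
  define W where "W e \<longleftrightarrow> (\<forall>a\<in>U. H (e(i := a)) \<longrightarrow> H' (e(i := a)) \<longrightarrow> P (e(i := a)))" for e
  have "definable {} W"
    unfolding W_def by (intro field_intros definable_upd[OF H(1)] definable_upd[OF H'(1)] definable_upd[OF P(1)])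
  moreover have "W e0"
    unfolding W_def
  proof (intro ballI impI)
    fix a assume a: "a \<in> U" "H (e0(i := a))" "H' (e0(i := a))"
    consider "a = e i" | "a \<prec> e i" | "e i \<prec> a" using less_linear a(1) diU by blast
    then have "a \<in> X"
    proof cases
      case 1
      then show ?thesis using P(2) a(1) by (simp add: X_def)
    qed (use a H(2) H'(2) in \<open>simp_all add: e0_def\<close>)
    then show "P (e0(i := a))" by (simp add: X_def e0_def)
  qed
  ultimately have "open_at W I e0" using tame by (simp add: tame_at_def e0_def)
  then obtain r0 where r0: "r0 \<in> U" "\<zero> \<prec> r0" "\<And>e'. e' \<in> vals \<Longrightarrow> near I r0 e0 e' \<Longrightarrow> W e'"
    unfolding open_at_def by blast
  obtain r1 where r1: "r1 \<in> U" "\<zero> \<prec> r1" "\<And>y. y \<in> U \<Longrightarrow> nearby r1 (e i) y \<Longrightarrow> q' \<prec> y \<and> y \<prec> q"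
    using ex_nearby[of "e i" q' q] H H' diU by blast
  define r2 where "r2 = mini (mini r r') (mini r0 r1)"
  have r2: "r2 \<in> U" "\<zero> \<prec> r2" using H H' r0 r1 by (simp_all add: r2_def)
  have "P e'" if e': "e' \<in> vals" "near (insert i I) r2 e e'" for e'
  proof -
    let ?e = "e'(i := \<zero>)"
    have eU: "?e \<in> vals" using e' by simp
    have n': "near (insert i I) r e e'" "near (insert i I) r' e e'" "near (insert i I) r0 e e'"
      "near (insert i I) r1 e e'"
      using near_mini4[OF e'(2)[unfolded r2_def]] e e'(1) H(5) H'(5) r0(1) r1(1) by simp_all
    then have n: "near I r e0 ?e" "near I r' e0 ?e" "near I r0 e0 ?e"
      using i by (auto simp: near_def e0_def)
    have "nearby r1 (e i) (e' i)" using n'(4) by (simp add: near_def)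
    then have "q' \<prec> e' i" "e' i \<prec> q" using r1 e' by auto
    then have "H (?e(i := e' i))" "H' (?e(i := e' i))"
      using H(7)[OF eU n(1), of "e' i"] H'(7)[OF eU n(2), of "e' i"] e' by simp_all
    then have "P (?e(i := e' i))"
      using r0(3)[OF eU n(3), unfolded W_def, rule_format, of "e' i"] e' by simp
    then show "P e'" by simp
  qed
  then show ?thesis unfolding open_at_def using r2 by blast
qed

lemma dcl_insert_zero: "dcl (insert \<zero> A) = dcl A"
  by (rule dcl_dcl_insert) (simp add: dcl_iff dterm_zero)

text \<open>The erased coordinate becomes \<open>\<zero>\<close>, which is definable without
  parameters, so the definable closure of the other coordinates can only shrink.\<close>

lemma generic_upd_zero:
  assumes "generic (insert i I) e" "i \<notin> I"
  shows "generic I (e(i := \<zero>))"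
  unfolding generic_def
proof (intro conjI ballI)
  fix j assume j: "j \<in> I"
  have "(e(i := \<zero>)) ` (- {j}) \<subseteq> insert \<zero> (e ` (- {j}))" by auto
  then have "dcl ((e(i := \<zero>)) ` (- {j})) \<subseteq> dcl (e ` (- {j}))"
    using dcl_mono dcl_insert_zero by metis
  moreover have "e j \<notin> dcl (e ` (- {j}))" using assms(1) j by (simp add: generic_def)
  moreover have "(e(i := \<zero>)) j = e j" using j assms(2) by auto
  ultimately show "(e(i := \<zero>)) j \<notin> dcl ((e(i := \<zero>)) ` (- {j}))" by auto
qed (use assms in \<open>simp add: generic_def\<close>)

lemma generic_subset: "generic I e \<Longrightarrow> J \<subseteq> I \<Longrightarrow> generic J e"
  unfolding generic_def by blast

lemma generic_open_insert:
  assumes g: "generic (insert i I) e" and i: "i \<notin> I" and tame: "tame_at I (e(i := \<zero>))"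
    and P: "definable {} P" "P e"
  shows "open_at P (insert i I) e"
proof -
  have e: "e \<in> vals" and ei: "e i \<notin> dcl (e ` (- {i}))" using g by (auto simp: generic_def)
  have "dset (e ` (- {i})) {x \<in> U. P (e(i := x))}" using P e by (intro dset_slice)
  moreover have "e ` (- {i}) \<subseteq> U" using e by auto
  moreover have "e i \<in> {x \<in> U. P (e(i := x))}" using P e by simp
  ultimately obtain p q where pq: "p \<in> U" "q \<in> U" "p \<prec> e i" "e i \<prec> q"
    "ivl p q \<subseteq> {x \<in> U. P (e(i := x))}"
    using generic_interior[OF _ _ _ ei] by blast
  have P': "P (e(i := x))" if "x \<in> U" "p \<prec> x" "x \<prec> q" for x
    using pq(5) that by (auto simp: ivl_iff)
  have "evr (e i) (\<lambda>a. P (e(i := a)))"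
    unfolding evr_def using pq P' less_trans[OF pq(1) vals_in[OF e] _ pq(3)] by (intro bexI[of _ q]) simp_all
  moreover have "evl (e i) (\<lambda>a. P (e(i := a)))"
    unfolding evl_def using pq P' less_trans[OF _ vals_in[OF e] pq(2) _ pq(4)] by (intro bexI[of _ p]) simp_all
  ultimately show ?thesis using open_at_insert[OF i e tame P] by blast
qed

text \<open>Monotonicity in direction \<open>i\<close> and continuity along \<open>I\<close>, both
  valid on a whole box, give joint continuity: the value at a nearby point lies between the values
  on two slices on either side of \<open>e i\<close>, and these are controlled by continuity along
  \<open>I\<close>.\<close>

lemma generic_cont_insert:
  assumes g: "generic (insert i I) e" and i: "i \<notin> I" and I: "finite I"
    and tame: "tame_at I (e(i := \<zero>))" and cI: "contI F I e" and F: "dterm {} F"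
  shows "contI F (insert i I) e"
proof -
  have e: "e \<in> vals" and ei: "e i \<notin> dcl (e ` (- {i}))" using g by (auto simp: generic_def)
  have A: "e ` (- {i}) \<subseteq> U" using e by auto
  have diU: "e i \<in> U" using e by simp
  have FU: "F e' \<in> U" if "e' \<in> vals" for e' using dterm_in[OF F that] .
  have nF: "dterm {} (\<lambda>e. \<ominus> (F e))" by (rule dterm_neg[OF F])
  have "\<exists>K. dterm {} K \<and> (K = F \<or> K = (\<lambda>e. \<ominus> (F e))) \<and> winc (\<lambda>x. K (e(i := x))) (e i)"
    using generic_winc[OF dfun_slice[OF F e] A diU ei] F nF by blast
  then obtain K where K: "dterm {} K" "K = F \<or> K = (\<lambda>e. \<ominus> (F e))" "winc (\<lambda>x. K (e(i := x))) (e i)"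
    by blast
  \<comment> \<open>Both conditions hold at \<open>e\<close> and are expressed without parameters,
    so openness extends them to a box.\<close>
  define V where "V e' \<longleftrightarrow> winc (\<lambda>x. K (e'(i := x))) (e' i) \<and> contI F I e'" for e'
  have "definable {} V"
    unfolding V_def winc_def fun_upd_triv
    by (intro field_intros definable_evr definable_evl definable_contI I F dterm_upd[OF K(1)] K(1)
        dterm_rename[OF K(1)])
  then have "open_at V (insert i I) e"
    using generic_open_insert[OF g i tame] K(3) cI by (simp add: V_def)
  then obtain r1 where r1: "r1 \<in> U" "\<zero> \<prec> r1" "\<And>e'. e' \<in> vals \<Longrightarrow> near (insert i I) r1 e e' \<Longrightarrow> V e'"
    unfolding open_at_def by blast
  have cont: "cont_at (\<lambda>x. F (e(i := x))) (e i)"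
    using generic_cont_at[OF dfun_slice[OF F e] A diU ei] .
  show ?thesis
    unfolding contI_def
  proof (intro ballI impI)
    fix p q assume pq: "p \<in> U" "q \<in> U" "p \<prec> F e" "F e \<prec> q"
    then obtain u v where uv: "u \<in> U" "v \<in> U" "u \<prec> e i" "e i \<prec> v"
      "\<And>y. y \<in> U \<Longrightarrow> u \<prec> y \<Longrightarrow> y \<prec> v \<Longrightarrow> p \<prec> F (e(i := y)) \<and> F (e(i := y)) \<prec> q"
      using cont[unfolded cont_at_def, rule_format, of p q] by auto
    let ?l = "e i \<oplus> \<ominus> r1" and ?u = "e i \<oplus> r1"
    have lu: "?l \<in> U" "?u \<in> U" "?l \<prec> e i" "e i \<prec> ?u"
      using diU r1 by (simp_all add: sub_pos_less less_add_pos)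
    \<comment> \<open>The two slices at \<open>d1\<close> and \<open>d2\<close> are close enough to
      \<open>e i\<close> for one-variable continuity to keep the values there within the target
      interval, and inside the box on which \<open>V\<close> holds.\<close>
    obtain d1 where d1: "d1 \<in> U" "u \<prec> d1" "?l \<prec> d1" "d1 \<prec> e i"
      using dense[of "maxi u ?l" "e i"] uv lu diU by auto
    obtain d2 where d2: "d2 \<in> U" "d2 \<prec> v" "d2 \<prec> ?u" "e i \<prec> d2"
      using dense[of "e i" "mini v ?u"] uv lu diU by auto
    have V: "V (e'(i := x))" if "e' \<in> vals" "near (insert i I) r1 e e'" "x \<in> U" "?l \<prec> x" "x \<prec> ?u" for e' x
    proof (rule r1(3))
      have "nearby r1 (e i) x" using that r1 diU by (simp add: nearby_iff)
      then show "near (insert i I) r1 e (e'(i := x))" using that i by (auto simp: near_def)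
    qed (use that in simp)
    have "contI F I (e(i := d1))" "contI F I (e(i := d2))"
      using V[of e d1] V[of e d2] d1 d2 lu less_trans[of d1 "e i" ?u] less_trans[of ?l "e i" d2]
        near_refl[OF e r1(1,2)] e diU by (auto simp: V_def)
    moreover have "p \<prec> F (e(i := d1)) \<and> F (e(i := d1)) \<prec> q" "p \<prec> F (e(i := d2)) \<and> F (e(i := d2)) \<prec> q"
      using uv d1 d2 less_trans[of d1 "e i" v] less_trans[of u "e i" d2] diU by auto
    ultimately have "open_at (\<lambda>e'. p \<prec> F e' \<and> F e' \<prec> q) I (e(i := d1))"
      "open_at (\<lambda>e'. p \<prec> F e' \<and> F e' \<prec> q) I (e(i := d2))"
      using pq unfolding contI_def by blast+
    then obtain r2 r3 where r2: "r2 \<in> U" "\<zero> \<prec> r2"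
      "\<And>e'. e' \<in> vals \<Longrightarrow> near I r2 (e(i := d1)) e' \<Longrightarrow> p \<prec> F e' \<and> F e' \<prec> q"
      and r3: "r3 \<in> U" "\<zero> \<prec> r3"
      "\<And>e'. e' \<in> vals \<Longrightarrow> near I r3 (e(i := d2)) e' \<Longrightarrow> p \<prec> F e' \<and> F e' \<prec> q"
      unfolding open_at_def by blast
    obtain r4 where r4: "r4 \<in> U" "\<zero> \<prec> r4" "\<And>y. y \<in> U \<Longrightarrow> nearby r4 (e i) y \<Longrightarrow> d1 \<prec> y \<and> y \<prec> d2"
      using ex_nearby[of "e i" d1 d2] d1 d2 diU by blast
    define r where "r = mini (mini r1 r2) (mini r3 r4)"
    have r: "r \<in> U" "\<zero> \<prec> r" using r1 r2 r3 r4 by (simp_all add: r_def)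
    have "p \<prec> F e' \<and> F e' \<prec> q" if e': "e' \<in> vals" "near (insert i I) r e e'" for e'
    proof -
      have n: "near (insert i I) r1 e e'" "near (insert i I) r2 e e'"
        "near (insert i I) r3 e e'" "near (insert i I) r4 e e'"
        using near_mini4[OF e'(2)[unfolded r_def]] e e'(1) r1(1) r2(1) r3(1) r4(1) by simp_all
      have a: "e' i \<in> U" "d1 \<prec> e' i" "e' i \<prec> d2"
        using n(4) r4(3)[of "e' i"] e' by (auto simp: near_def)
      have "near I r2 (e(i := d1)) (e'(i := d1))" "near I r3 (e(i := d2)) (e'(i := d2))"
        using n(2,3) i by (auto simp: near_def)
      then have b: "p \<prec> F (e'(i := d1)) \<and> F (e'(i := d1)) \<prec> q" "p \<prec> F (e'(i := d2)) \<and> F (e'(i := d2)) \<prec> q"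
        using r2(3) r3(3) e' d1 d2 by simp_all
      have Ku: "dfun U (\<lambda>x. K (e'(i := x)))"
      proof (rule dfun_mono[OF dfun_slice[OF K(1) e'(1)]])
        show "e' ` (- {i}) \<subseteq> U" using e'(1) by auto
      qed
      have w: "winc (\<lambda>x. K (e'(i := x))) x" if "x \<in> ivl ?l ?u" for x
        using V[OF e'(1) n(1), of x] that by (simp add: V_def ivl_iff)
      have in_ivl: "d1 \<in> ivl ?l ?u" "d2 \<in> ivl ?l ?u" "e' i \<in> ivl ?l ?u"
        using d1 d2 a lu diU less_trans[of d1 "e i" ?u] less_trans[of ?l "e i" d2]
          less_trans[of ?l d1 "e' i"] less_trans[of "e' i" d2 ?u] by (simp_all add: ivl_iff)
      have m: "\<not> K e' \<prec> K (e'(i := d1))" "\<not> K (e'(i := d2)) \<prec> K e'"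
        using winc_mono[OF Ku lu(1,2) w in_ivl(1,3) a(2)] winc_mono[OF Ku lu(1,2) w in_ivl(3,2) a(3)]
        by simp_all
      have FUs: "F e' \<in> U" "F (e'(i := d1)) \<in> U" "F (e'(i := d2)) \<in> U"
        using FU e' d1 d2 by simp_all
      from K(2) show ?thesis
      proof
        assume "K = F"
        then show ?thesis
          using m b FUs pq less_le_trans[of p "F (e'(i := d1))" "F e'"]
            le_less_trans[of "F e'" "F (e'(i := d2))" q] by simp
      next
        assume "K = (\<lambda>e. \<ominus> (F e))"
        then show ?thesis
          using m b FUs pq less_le_trans[of p "F (e'(i := d2))" "F e'"]
            le_less_trans[of "F e'" "F (e'(i := d1))" q] by simp
      qed
    qed
    then show "open_at (\<lambda>e'. p \<prec> F e' \<and> F e' \<prec> q) (insert i I) e"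
      unfolding open_at_def using r by blast
  qed
qed

theorem generic_tame:
  assumes "finite I" "generic I e"
  shows "tame_at I e"
  using assms
proof (induction I arbitrary: e rule: finite_induct)
  case empty
  have "e' = e" if "near {} r e e'" for r e'
    using that by (auto simp: near_def)
  then have "open_at P {} e" if "P e" for P
    unfolding open_at_def using that zero_less_one closed(2) by blast
  then show ?case by (simp add: tame_at_def contI_def)
next
  case (insert i I)
  \<comment> \<open>The induction hypothesis is used at two valuations: with coordinate
    \<open>i\<close> erased, where the ends of the fibres live, and at \<open>e\<close> itself, for
    continuity along \<open>I\<close>.\<close>
  have t0: "tame_at I (e(i := \<zero>))"
    using insert generic_upd_zero by blast
  have "tame_at I e" using insert generic_subset by blast
  then have "contI F (insert i I) e" if "dterm {} F" for F
    using generic_cont_insert[OF insert.prems insert.hyps(2,1) t0 _ that] that by (simp add: tame_at_def)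
  then show ?case
    using generic_open_insert[OF insert.prems insert.hyps(2) t0] by (simp add: tame_at_def)
qed

end

section \<open>Derivatives\<close>

context o_minimal_field
begin

text \<open>The function tilted by slope \<open>c\<close>. Comparing its values at two points
  compares the slope of the chord of \<open>g\<close> with \<open>c\<close>, without a
  division.\<close>

definition lin :: "('u \<Rightarrow> 'u) \<Rightarrow> 'u \<Rightarrow> 'u \<Rightarrow> 'u" where
  "lin g c y = g y \<oplus> \<ominus> (c \<otimes> y)"

lemma lin_closed [simp]: "g y \<in> U \<Longrightarrow> c \<in> U \<Longrightarrow> y \<in> U \<Longrightarrow> lin g c y \<in> U"
  by (simp add: lin_def)

lemma lin_eq_lin:
  assumes "g y \<in> U" "c \<in> U" "c' \<in> U" "y \<in> U"
  shows "lin g c' y = lin g c y \<oplus> (c \<oplus> \<ominus> c') \<otimes> y"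
proof -
  have "(c \<oplus> \<ominus> c') \<otimes> y = c \<otimes> y \<oplus> \<ominus> (c' \<otimes> y)"
    using assms by (simp add: distrib_right neg_mul)
  then show ?thesis using assms by (simp add: lin_def add_assoc)
qed

text \<open>If a chord has slope at least \<open>c\<close>, its slope is strictly larger than any
  smaller \<open>c'\<close>.\<close>

lemma lin_shift_down:
  assumes "x \<in> U" "y \<in> U" "c \<in> U" "c' \<in> U" "g x \<in> U" "g y \<in> U" "c' \<prec> c" "x \<prec> y"
    "\<not> lin g c y \<prec> lin g c x"
  shows "lin g c' x \<prec> lin g c' y"
proof -
  have "(c \<oplus> \<ominus> c') \<otimes> x \<prec> (c \<oplus> \<ominus> c') \<otimes> y"
    using assms by (intro mul_strict_right_mono) (simp_all add: zero_less_sub)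
  then show ?thesis
    using assms by (simp add: lin_eq_lin[of g _ c c'] add_less_le_mono)
qed

lemma lin_shift_up:
  assumes "x \<in> U" "y \<in> U" "c \<in> U" "c' \<in> U" "g x \<in> U" "g y \<in> U" "c \<prec> c'" "x \<prec> y"
    "\<not> lin g c x \<prec> lin g c y"
  shows "lin g c' y \<prec> lin g c' x"
proof -
  have neg: "lin (\<lambda>z. \<ominus> (g z)) (\<ominus> a) z = \<ominus> (lin g a z)" if "g z \<in> U" "a \<in> U" "z \<in> U" for a z
    using that by (simp add: lin_def neg_add_distrib neg_mul)
  show ?thesis
    using lin_shift_down[of x y "\<ominus> c" "\<ominus> c'" "\<lambda>z. \<ominus> (g z)"] assms by (simp add: neg)
qed

text \<open>\<open>d\<close> is the derivative of \<open>g\<close> at \<open>x\<close>: the line of slope \<open>c\<close> through \<open>(x, g x)\<close> is crossed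
  upwards for \<open>c \<prec> d\<close> and downwards for \<open>d \<prec> c\<close>.\<close>

definition hasd :: "('u \<Rightarrow> 'u) \<Rightarrow> 'u \<Rightarrow> 'u \<Rightarrow> bool" where
  "hasd g x d \<longleftrightarrow> (\<forall>c\<in>U.
     (c \<prec> d \<longrightarrow> evr x (\<lambda>y. lin g c x \<prec> lin g c y) \<and> evl x (\<lambda>y. lin g c y \<prec> lin g c x)) \<and>
     (d \<prec> c \<longrightarrow> evr x (\<lambda>y. lin g c y \<prec> lin g c x) \<and> evl x (\<lambda>y. lin g c x \<prec> lin g c y)))"

lemma hasd_unique:
  assumes "hasd g x d" "hasd g x d'" "d \<in> U" "d' \<in> U" "x \<in> U" "\<And>z. z \<in> U \<Longrightarrow> g z \<in> U"
  shows "d = d'"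
proof -
  have *: False if h: "hasd g x d" "hasd g x d'" "d \<in> U" "d' \<in> U" "d \<prec> d'" for d d'
  proof -
    obtain c where c: "c \<in> U" "d \<prec> c" "c \<prec> d'" using dense h by blast
    then have "evr x (\<lambda>y. lin g c x \<prec> lin g c y)" "evr x (\<lambda>y. lin g c y \<prec> lin g c x)"
      using h unfolding hasd_def by blast+
    then obtain y where "y \<in> U" "lin g c x \<prec> lin g c y" "lin g c y \<prec> lin g c x"
      using evr_ex[OF evr_conj] assms(5) by blast
    then show False using less_asym[of "lin g c x" "lin g c y"] c assms(5,6) by simp
  qed
  show ?thesis using *[of d d'] *[of d' d] assms less_linear by blast
qed

lemma abs_less_iff:
  assumes "a \<in> U" "r \<in> U"
  shows "abs_of M a \<prec> r \<longleftrightarrow> \<ominus> r \<prec> a \<and> a \<prec> r"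
proof (cases "a \<prec> \<zero>")
  case True
  have "a \<prec> r" if "\<ominus> a \<prec> r"
  proof -
    have "\<zero> \<prec> \<ominus> a" using True assms less_neg_iff[of \<zero> a] by simp
    then have "\<zero> \<prec> r" using that less_trans[of \<zero> "\<ominus> a" r] assms by simp
    then show ?thesis using True less_trans[of a \<zero> r] assms by simp
  qed
  then show ?thesis using True assms neg_less_iff[of a r] by (auto simp: abs_of_def)
next
  case False
  have "\<ominus> r \<prec> a" if "a \<prec> r"
  proof -
    have "\<zero> \<prec> r" using that False le_less_trans[of \<zero> a r] assms by simp
    then have "\<ominus> r \<prec> \<zero>" using assms neg_less_iff[of r \<zero>] by simp
    then show ?thesis using False less_le_trans[of "\<ominus> r" \<zero> a] assms by simp
  qed
  then show ?thesis using False by (auto simp: abs_of_def)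
qed

lemma lin_add:
  assumes "x \<in> U" "h \<in> U" "c \<in> U" "g x \<in> U" "g (x \<oplus> h) \<in> U"
  shows "lin g c (x \<oplus> h) = lin g c x \<oplus> (g (x \<oplus> h) \<oplus> \<ominus> g x \<oplus> \<ominus> (c \<otimes> h))"
proof -
  let ?a = "g (x \<oplus> h)" and ?b = "g x" and ?m = "\<ominus> (c \<otimes> x)" and ?n = "\<ominus> (c \<otimes> h)"
  have U: "?a \<in> U" "?b \<in> U" "?m \<in> U" "?n \<in> U" using assms by simp_all
  have "lin g c x \<oplus> (?a \<oplus> \<ominus> ?b \<oplus> ?n) = ?b \<oplus> ?m \<oplus> (?a \<oplus> \<ominus> ?b \<oplus> ?n)"
    by (simp add: lin_def)
  also have "\<dots> = ?b \<oplus> (\<ominus> ?b \<oplus> (?a \<oplus> (?m \<oplus> ?n)))"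
    using U by (simp only: add_ac closed)
  also have "\<dots> = ?a \<oplus> (?m \<oplus> ?n)" using U by simp
  also have "\<dots> = lin g c (x \<oplus> h)"
    using assms by (simp add: lin_def distrib neg_add_distrib)
  finally show ?thesis by simp
qed

lemma less_add_iff: "x \<in> U \<Longrightarrow> t \<in> U \<Longrightarrow> x \<prec> x \<oplus> t \<longleftrightarrow> \<zero> \<prec> t"
  using add_less_cancel_left[of \<zero> t x] by simp

lemma add_less_iff: "x \<in> U \<Longrightarrow> t \<in> U \<Longrightarrow> x \<oplus> t \<prec> x \<longleftrightarrow> t \<prec> \<zero>"
  using add_less_cancel_left[of t \<zero> x] by simp

text \<open>The slopes d - \<epsilon> and d + \<epsilon> enclose the derivative. That the first line
  is crossed upwards and the second downwards is, on both sides of \<open>x\<close>, exactly the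
  estimate required of a difference quotient.\<close>

lemma hasd_bound:
  assumes g: "\<And>z. z \<in> U \<Longrightarrow> g z \<in> U" and d: "hasd g x d" "d \<in> U" "x \<in> U"
    and \<epsilon>: "\<epsilon> \<in> U" "\<zero> \<prec> \<epsilon>"
  shows "\<exists>\<eta>\<in>U. \<zero> \<prec> \<eta> \<and> (\<forall>h\<in>U. h \<noteq> \<zero> \<longrightarrow> abs_of M h \<prec> \<eta> \<longrightarrow>
    abs_of M (sub_of M (sub_of M (g (x \<oplus> h)) (g x)) (d \<otimes> h)) \<prec> \<epsilon> \<otimes> abs_of M h)"
proof -
  let ?c = "d \<oplus> \<ominus> \<epsilon>" and ?c' = "d \<oplus> \<epsilon>"
  have c: "?c \<in> U" "?c' \<in> U" "?c \<prec> d" "d \<prec> ?c'"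
    using d \<epsilon> by (simp_all add: sub_pos_less less_add_pos)
  have "evr x (\<lambda>y. lin g ?c x \<prec> lin g ?c y \<and> lin g ?c' y \<prec> lin g ?c' x)"
    by (rule evr_conj) (use d c in \<open>auto simp: hasd_def\<close>)
  then obtain v where v: "v \<in> U" "x \<prec> v"
    "\<And>y. y \<in> U \<Longrightarrow> x \<prec> y \<Longrightarrow> y \<prec> v \<Longrightarrow> lin g ?c x \<prec> lin g ?c y \<and> lin g ?c' y \<prec> lin g ?c' x"
    unfolding evr_def by blast
  have "evl x (\<lambda>y. lin g ?c y \<prec> lin g ?c x \<and> lin g ?c' x \<prec> lin g ?c' y)"
    by (rule evl_conj) (use d c in \<open>auto simp: hasd_def\<close>)
  then obtain u where u: "u \<in> U" "u \<prec> x"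
    "\<And>y. y \<in> U \<Longrightarrow> u \<prec> y \<Longrightarrow> y \<prec> x \<Longrightarrow> lin g ?c y \<prec> lin g ?c x \<and> lin g ?c' x \<prec> lin g ?c' y"
    unfolding evl_def by blast
  obtain \<eta> where \<eta>: "\<eta> \<in> U" "\<zero> \<prec> \<eta>" "\<And>y. y \<in> U \<Longrightarrow> nearby \<eta> x y \<Longrightarrow> u \<prec> y \<and> y \<prec> v"
    using ex_nearby[of x u v] u v d by blast
  have "abs_of M (sub_of M (sub_of M (g (x \<oplus> h)) (g x)) (d \<otimes> h)) \<prec> \<epsilon> \<otimes> abs_of M h"
    if h: "h \<in> U" "h \<noteq> \<zero>" "abs_of M h \<prec> \<eta>" for h
  proof -
    have "x \<oplus> h \<oplus> \<ominus> x = h" using h d by (simp add: add_comm[of x h])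
    then have "nearby \<eta> x (x \<oplus> h)" using h by (simp add: nearby_def sub_of_def)
    then have y: "u \<prec> x \<oplus> h" "x \<oplus> h \<prec> v" using \<eta>(3)[of "x \<oplus> h"] h d by simp_all
    define \<Delta> where "\<Delta> = g (x \<oplus> h) \<oplus> \<ominus> g x \<oplus> \<ominus> (d \<otimes> h)"
    have U: "g (x \<oplus> h) \<in> U" "g x \<in> U" "\<Delta> \<in> U" "x \<oplus> h \<in> U" using g h d by (simp_all add: \<Delta>_def)
    have 1: "lin g ?c (x \<oplus> h) = lin g ?c x \<oplus> (\<Delta> \<oplus> \<epsilon> \<otimes> h)"
      using lin_add[of x h ?c g] U h d c \<epsilon>
      by (simp add: \<Delta>_def distrib_right neg_add_distrib neg_mul add_assoc)
    have 2: "lin g ?c' (x \<oplus> h) = lin g ?c' x \<oplus> (\<Delta> \<oplus> \<ominus> (\<epsilon> \<otimes> h))"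
      using lin_add[of x h ?c' g] U h d c \<epsilon>
      by (simp add: \<Delta>_def distrib_right neg_add_distrib neg_mul add_assoc)
    have eq: "sub_of M (sub_of M (g (x \<oplus> h)) (g x)) (d \<otimes> h) = \<Delta>"
      by (simp add: sub_of_def \<Delta>_def)
    have linU: "lin g ?c x \<in> U" "lin g ?c' x \<in> U" using U c d by simp_all
    consider "\<zero> \<prec> h" | "h \<prec> \<zero>" using less_linear[of h \<zero>] h by auto
    then show ?thesis
    proof cases
      case 1
      then have "x \<prec> x \<oplus> h" using h d by (simp add: less_add_pos)
      then have "lin g ?c x \<prec> lin g ?c (x \<oplus> h)" "lin g ?c' (x \<oplus> h) \<prec> lin g ?c' x"
        using v(3)[OF U(4)] y by simp_all
      then have "\<zero> \<prec> \<Delta> \<oplus> \<epsilon> \<otimes> h" "\<Delta> \<oplus> \<ominus> (\<epsilon> \<otimes> h) \<prec> \<zero>"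
        unfolding \<open>lin g ?c (x \<oplus> h) = _\<close> 2 using linU U h \<epsilon> by (simp_all add: less_add_iff add_less_iff)
      then have "\<ominus> (\<epsilon> \<otimes> h) \<prec> \<Delta>" "\<Delta> \<prec> \<epsilon> \<otimes> h"
        using U h \<epsilon> less_sub_iff[of "\<zero>" \<Delta> "\<ominus> (\<epsilon> \<otimes> h)"] by (simp_all add: sub_less_iff)
      moreover have "abs_of M h = h" using 1 less_asym[of \<zero> h] h by (simp add: abs_of_def)
      ultimately show ?thesis using U h \<epsilon> by (simp add: eq abs_less_iff)
    next
      case 2
      then have "x \<oplus> h \<prec> x" using h d by (simp add: add_less_iff)
      then have "lin g ?c (x \<oplus> h) \<prec> lin g ?c x" "lin g ?c' x \<prec> lin g ?c' (x \<oplus> h)"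
        using u(3)[OF U(4)] y by simp_all
      then have "\<Delta> \<oplus> \<epsilon> \<otimes> h \<prec> \<zero>" "\<zero> \<prec> \<Delta> \<oplus> \<ominus> (\<epsilon> \<otimes> h)"
        unfolding 1 \<open>lin g ?c' (x \<oplus> h) = _\<close> using linU U h \<epsilon> by (simp_all add: less_add_iff add_less_iff)
      then have "\<Delta> \<prec> \<ominus> (\<epsilon> \<otimes> h)" "\<epsilon> \<otimes> h \<prec> \<Delta>"
        using U h \<epsilon> sub_less_iff[of \<Delta> "\<ominus> (\<epsilon> \<otimes> h)" \<zero>] by (simp_all add: less_sub_iff)
      moreover have "abs_of M h = \<ominus> h" using 2 by (simp add: abs_of_def)
      ultimately show ?thesis using U h \<epsilon> by (simp add: eq abs_less_iff mul_neg)
    qed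
  qed
  then show ?thesis using \<eta> by blast
qed

lemma dfun_lin:
  assumes "dfun U g" "c \<in> U"
  shows "dfun U (lin g c)"
  unfolding lin_def by (intro dfunI field_intros dterm_app[OF assms(1)] dterm_const assms(2))

section \<open>Excluding corners and vertical tangents at generic points\<close>

lemma definable_strict_min_slice:
  assumes "dterm {} F"
  shows "definable {} (\<lambda>e. strict_min (\<lambda>x. F (e(j := x))) (e j))"
  unfolding strict_min_def fun_upd_triv
  by (intro field_intros definable_evr definable_evl dterm_upd[OF assms] dterm_rename[OF assms] assms)

text \<open>Given a range of slopes \<open>c\<close> for which \<open>g y - c y\<close> has a strict local minimum at a generic
  point, openness makes one slope work on a whole interval.\<close>

lemma no_min_slopes:
  assumes F: "dterm {} F" and gen: "generic {i} e" and c: "c1 \<in> U" "c2 \<in> U" "c1 \<prec> c2"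
    and m: "\<And>c. c \<in> U \<Longrightarrow> c1 \<prec> c \<Longrightarrow> c \<prec> c2 \<Longrightarrow> strict_min (lin (\<lambda>x. F (e(i := x))) c) (e i)"
  shows False
proof -
  have e: "e \<in> vals" "e i \<in> U" using gen by (simp_all add: generic_def)
  \<comment> \<open>The slope becomes a new coordinate \<open>0\<close> and the old coordinates move
    up by one, so that slope and point can vary together.\<close>
  define F' where "F' e = F (\<lambda>k. e (Suc k)) \<oplus> \<ominus> (e 0 \<otimes> e (Suc i))" for e
  have F': "dterm {} F'" unfolding F'_def by (intro field_intros dterm_rename[OF F])
  have upd: "(case_nat a e')(Suc i := x) = case_nat a (e'(i := x))" for a x and e' :: "nat \<Rightarrow> 'u"
    by (auto simp: fun_eq_iff split: nat.splits)
  have F'_eq: "F' ((case_nat a e')(Suc i := x)) = lin (\<lambda>x. F (e'(i := x))) a x" for a x e'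
    unfolding upd by (simp add: F'_def lin_def fun_upd_same del: fun_upd_apply)
  define P where "P e \<longleftrightarrow> strict_min (\<lambda>x. F' (e(Suc i := x))) (e (Suc i))" for e
  have P: "definable {} P"
    unfolding P_def by (rule definable_strict_min_slice[OF F'])
  have P_eq: "P (case_nat a e') \<longleftrightarrow> strict_min (lin (\<lambda>x. F (e'(i := x))) a) (e' i)" for a e'
    unfolding P_def F'_eq by simp
  define c where "c = mid c1 c2"
  have c': "c \<in> U" "c1 \<prec> c" "c \<prec> c2" using c mid_less by (simp_all add: c_def)
  let ?e = "case_nat c e"
  have eU: "?e \<in> vals" using e c' by simp
  have upd0: "(case_nat c e)(0 := a) = case_nat a e" for a
    by (auto simp: fun_eq_iff split: nat.splits)
  \<comment> \<open>Only the coordinate of the point has to be independent, and only after the slope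
    has been erased. In the direction of the slope, openness comes from the given interval of
    slopes.\<close>
  have "generic {Suc i} (?e(0 := \<zero>))"
  proof -
    have "(case_nat \<zero> e) ` (- {Suc i}) \<subseteq> insert \<zero> (e ` (- {i}))"
      by (auto split: nat.splits)
    then have "dcl ((case_nat \<zero> e) ` (- {Suc i})) \<subseteq> dcl (e ` (- {i}))"
      using dcl_mono dcl_insert_zero by metis
    moreover have "e i \<notin> dcl (e ` (- {i}))" using gen by (simp add: generic_def)
    ultimately have "(case_nat \<zero> e) (Suc i) \<notin> dcl ((case_nat \<zero> e) ` (- {Suc i}))" by auto
    then show ?thesis unfolding generic_def upd0 using e(1) by simp
  qed
  then have tame: "tame_at {Suc i} (?e(0 := \<zero>))" by (intro generic_tame) simp_all
  have PI: "P (?e(0 := a))" if "a \<in> U" "c1 \<prec> a" "a \<prec> c2" for a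
    unfolding upd0 P_eq using m that by blast
  have "open_at P (insert 0 {Suc i}) ?e"
  proof (rule open_at_insert[OF _ eU tame P])
    show "P ?e" using PI[of c] c' by (simp add: upd0)
    show "evr (?e 0) (\<lambda>a. P (?e(0 := a)))"
      unfolding evr_def nat.case(1) using PI c c' less_trans[OF c(1) c'(1) _ c'(2)] by blast
    show "evl (?e 0) (\<lambda>a. P (?e(0 := a)))"
      unfolding evl_def nat.case(1) using PI c c' less_trans[OF _ c'(1) c(2) _ c'(3)] by blast
  qed simp
  then obtain r where r: "r \<in> U" "\<zero> \<prec> r"
    "\<And>e'. e' \<in> vals \<Longrightarrow> near (insert 0 {Suc i}) r ?e e' \<Longrightarrow> P e'"
    unfolding open_at_def by blast
  let ?g = "\<lambda>x. F (e(i := x))"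
  let ?l = "e i \<oplus> \<ominus> r" and ?u = "e i \<oplus> r"
  have lu: "?l \<in> U" "?u \<in> U" "?l \<prec> ?u"
    using e r less_trans[of ?l "e i" ?u] by (simp_all add: sub_pos_less less_add_pos)
  \<comment> \<open>The slope is now frozen at \<open>c\<close> while the point moves through the
    box, which yields the forbidden interval of strict minima.\<close>
  have "strict_min (lin ?g c) x" if x: "x \<in> ivl ?l ?u" for x
  proof -
    have xU: "x \<in> U" and "nearby r (e i) x" using x r e by (simp_all add: ivl_iff nearby_iff)
    then have "near (insert 0 {Suc i}) r ?e (case_nat c (e(i := x)))"
      using c' r by (auto simp: near_def nearby_refl split: nat.splits)
    then have "P (case_nat c (e(i := x)))" using r(3) e c' xU by simp
    then show ?thesis by (simp add: P_eq)
  qed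
  moreover have "e ` (- {i}) \<subseteq> U" using e by auto
  then have "dfun U ?g" using dfun_mono[OF dfun_slice[OF F e(1)]] by blast
  then have "dfun U (lin ?g c)" using c' by (intro dfun_lin)
  ultimately show False using no_strict_min[OF _ lu] by blast
qed

lemma lin_neg: "g z \<in> U \<Longrightarrow> a \<in> U \<Longrightarrow> z \<in> U \<Longrightarrow> lin (\<lambda>z. \<ominus> (g z)) a z = \<ominus> (lin g (\<ominus> a) z)"
  by (simp add: lin_def neg_add_distrib neg_mul)

text \<open>The property quantifies over all slopes and is definable from the other coordinates, so
  it spreads to an interval about \<open>e i\<close>. There every tilted function is weakly
  increasing, and a chord would have slope at least \<open>c\<close> for every
  \<open>c\<close>.\<close>

lemma no_infinite_slope:
  assumes F: "dterm {} F" and gen: "generic {i} e"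
    and w: "\<And>c. c \<in> U \<Longrightarrow> winc (lin (\<lambda>x. F (e(i := x))) c) (e i)"
  shows False
proof -
  let ?A = "e ` (- {i})" and ?g = "\<lambda>x. F (e(i := x))"
  have e: "e \<in> vals" "e i \<in> U" "e i \<notin> dcl ?A" using gen by (simp_all add: generic_def)
  have A: "?A \<subseteq> U" using e by auto
  have g: "dfun ?A ?g" by (rule dfun_slice[OF F e(1)])
  have gU: "?g z \<in> U" if "z \<in> U" for z using dfun_in[OF g that] .
  have "dset ?A {x \<in> U. \<forall>c\<in>U. winc (lin ?g c) x}"
    unfolding winc_def lin_def
    by (intro dsetI field_intros definable_evr definable_evl dterm_app[OF g])
  from generic_interior[OF this A _ e(3)] w e(2) obtain p q where
    pq: "p \<in> U" "q \<in> U" "p \<prec> e i" "e i \<prec> q" "ivl p q \<subseteq> {x \<in> U. \<forall>c\<in>U. winc (lin ?g c) x}"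
    by blast
  define a b where "a = mid p (e i)" and "b = e i"
  have ab: "a \<in> U" "b \<in> U" "a \<prec> b" "p \<prec> a" "p \<prec> b" "a \<prec> q" "b \<prec> q"
    using pq e mid_less[of p "e i"] less_trans[of a "e i" q] by (simp_all add: a_def b_def)
  define D where "D = b \<oplus> \<ominus> a"
  have D: "D \<in> U" "\<zero> \<prec> D" using ab by (simp_all add: D_def zero_less_sub)
  then have "D \<noteq> \<zero>" by auto
  then obtain k where k: "k \<in> U" "D \<otimes> k = \<one>" using ex_inverse D by blast
  define s where "s = ?g b \<oplus> \<ominus> ?g a"
  have s: "s \<in> U" using gU ab by (simp add: s_def)
  \<comment> \<open>With \<open>k\<close> the inverse of b - a, this is the slope of the chord from
    a to b plus 1, so tilting by it makes the function strictly decrease from a to b.\<close>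
  define m where "m = s \<otimes> k \<oplus> \<one>"
  have m: "m \<in> U" using s k by (simp add: m_def)
  have "m \<otimes> D = s \<oplus> D"
  proof -
    have "s \<otimes> k \<otimes> D = s" using s k D by (simp add: mul_assoc mul_comm[of k D])
    moreover have "\<one> \<otimes> D = D" using D mul_comm[of \<one> D] by simp
    ultimately show ?thesis using s k D by (simp add: m_def distrib_right)
  qed
  have "b = a \<oplus> D" using ab by (simp add: D_def add_comm[of b])
  then have "lin ?g m b = lin ?g m a \<oplus> (?g b \<oplus> \<ominus> ?g a \<oplus> \<ominus> (m \<otimes> D))"
    using lin_add[of a D m ?g] ab D m gU by simp
  also have "?g b \<oplus> \<ominus> ?g a \<oplus> \<ominus> (m \<otimes> D) = \<ominus> D"
    unfolding \<open>m \<otimes> D = s \<oplus> D\<close> using s D by (simp add: s_def[symmetric] neg_add_distrib)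
  finally have "lin ?g m b = lin ?g m a \<oplus> \<ominus> D" .
  moreover have "lin ?g m a \<in> U" by (intro lin_closed gU m ab)
  ultimately have "lin ?g m b \<prec> lin ?g m a"
    using D by (metis sub_pos_less)
  moreover have "\<not> lin ?g m b \<prec> lin ?g m a"
  proof (rule winc_mono[OF dfun_lin[OF dfun_mono[OF g A] m] pq(1,2)])
    show "winc (lin ?g m) x" if "x \<in> ivl p q" for x using pq(5) that m by blast
  qed (use ab in \<open>simp_all add: ivl_iff\<close>)
  ultimately show False by blast
qed

text \<open>\<open>R\<close> and \<open>Q\<close> collect the slopes whose line is crossed upwards
  on the right and on the left of \<open>x\<close>. Both are closed downwards. Since no interval of
  slopes can separate them, they define the same cut; since infinite slopes are impossible, the cut
  is at an element, the supremum of \<open>R\<close>.\<close>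

lemma generic_hasd:
  assumes F: "dterm {} F" and gen: "generic {i} e"
  shows "\<exists>d\<in>U. hasd (\<lambda>x. F (e(i := x))) (e i) d"
proof -
  let ?A = "e ` (- {i})" and ?g = "\<lambda>x. F (e(i := x))"
  define g where "g = ?g"
  define x where "x = e i"
  have e: "e \<in> vals" "x \<in> U" using gen by (simp_all add: generic_def x_def)
  have A: "?A \<subseteq> U" using e by auto
  have g: "dfun U g" unfolding g_def using dfun_mono[OF dfun_slice[OF F e(1)] A] .
  have gU: "g z \<in> U" if "z \<in> U" for z using dfun_in[OF g that] .
  have linU: "lin g c z \<in> U" if "c \<in> U" "z \<in> U" for c z using gU that by simp
  have lin_neg': "lin (\<lambda>y. \<ominus> (g y)) (\<ominus> c) y = \<ominus> (lin g c y)" if "c \<in> U" "y \<in> U" for c y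
    using lin_neg[of g y "\<ominus> c"] gU that by simp
  have nF: "dterm {} (\<lambda>e. \<ominus> (F e))" by (rule dterm_neg[OF F])
  define R where "R = {c \<in> U. evr x (\<lambda>y. lin g c x \<prec> lin g c y)}"
  define Q where "Q = {c \<in> U. evl x (\<lambda>y. lin g c y \<prec> lin g c x)}"
  have dec: "rdec x (\<lambda>y. lin g c x \<prec> lin g c y)" "ldec x (\<lambda>y. lin g c y \<prec> lin g c x)"
    if c: "c \<in> U" for c
  proof -
    have "dset U {y \<in> U. lin g c x \<prec> lin g c y}" "dset U {y \<in> U. lin g c y \<prec> lin g c x}"
      by (intro dsetI field_intros dterm_const linU c e dterm_app[OF dfun_lin[OF g c]])+
    from dec_mem[OF this(1) e(2)] dec_mem[OF this(2) e(2)]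
    show "rdec x (\<lambda>y. lin g c x \<prec> lin g c y)" "ldec x (\<lambda>y. lin g c y \<prec> lin g c x)"
      unfolding rdec_def ldec_def evr_def evl_def by simp_all
  qed
  have notR: "evr x (\<lambda>y. \<not> lin g c x \<prec> lin g c y)" if "c \<in> U" "c \<notin> R" for c
    using dec(1)[OF that(1)] that by (simp add: R_def rdec_def)
  have notQ: "evl x (\<lambda>y. \<not> lin g c y \<prec> lin g c x)" if "c \<in> U" "c \<notin> Q" for c
    using dec(2)[OF that(1)] that by (simp add: Q_def ldec_def)
  have R_less: "evr x (\<lambda>y. lin g c' x \<prec> lin g c' y)" if "c \<in> R" "c' \<in> U" "c' \<prec> c" for c c'
  proof (rule evr_mono)
    show "evr x (\<lambda>y. lin g c x \<prec> lin g c y)" using that by (simp add: R_def)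
    show "lin g c' x \<prec> lin g c' y" if "y \<in> U" "x \<prec> y" "lin g c x \<prec> lin g c y" for y
      using lin_shift_down[of x y c c' g] less_asym[of "lin g c x" "lin g c y"] that \<open>c \<in> R\<close> \<open>c' \<in> U\<close> \<open>c' \<prec> c\<close>
        e gU by (simp add: R_def)
  qed
  have Q_less: "evl x (\<lambda>y. lin g c' y \<prec> lin g c' x)" if "c \<in> Q" "c' \<in> U" "c' \<prec> c" for c c'
  proof (rule evl_mono)
    show "evl x (\<lambda>y. lin g c y \<prec> lin g c x)" using that by (simp add: Q_def)
    show "lin g c' y \<prec> lin g c' x" if "y \<in> U" "y \<prec> x" "lin g c y \<prec> lin g c x" for y
      using lin_shift_down[of y x c c' g] less_asym[of "lin g c y" "lin g c x"] that \<open>c \<in> Q\<close> \<open>c' \<in> U\<close> \<open>c' \<prec> c\<close>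
        e gU by (simp add: Q_def)
  qed
  have notR_less: "evr x (\<lambda>y. lin g c' y \<prec> lin g c' x)" if "c \<in> U" "c \<notin> R" "c' \<in> U" "c \<prec> c'" for c c'
    by (rule evr_mono[OF notR[OF that(1,2)]]) (use lin_shift_up[of x _ c c' g] that e gU in simp)
  have notQ_less: "evl x (\<lambda>y. lin g c' x \<prec> lin g c' y)" if "c \<in> U" "c \<notin> Q" "c' \<in> U" "c \<prec> c'" for c c'
    by (rule evl_mono[OF notQ[OF that(1,2)]]) (use lin_shift_up[of _ x c c' g] that e gU in simp)
  \<comment> \<open>Slopes between \<open>c1\<close> and \<open>c2\<close> would be crossed upwards
    on the right but not on the left, a strict minimum of the tilted function for an interval of
    slopes.\<close>
  have gap1: False if c: "c1 \<in> U" "c2 \<in> R" "c1 \<prec> c2" "c1 \<notin> Q" for c1 c2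
  proof (rule no_min_slopes[OF F gen, of c1 c2])
    fix c assume "c \<in> U" "c1 \<prec> c" "c \<prec> c2"
    then show "strict_min (lin ?g c) (e i)"
      using R_less[OF c(2)] notQ_less[OF c(1,4)] unfolding strict_min_def g_def x_def by blast
  qed (use c in \<open>simp_all add: R_def\<close>)
  \<comment> \<open>The opposite gap gives strict maxima; negating the function turns them into
    strict minima, with the slopes negated and their bounds exchanged.\<close>
  have gap2: False if c: "c1 \<in> U" "c2 \<in> Q" "c1 \<prec> c2" "c1 \<notin> R" for c1 c2
  proof (rule no_min_slopes[OF nF gen, of "\<ominus> c2" "\<ominus> c1"])
    fix c assume c': "c \<in> U" "\<ominus> c2 \<prec> c" "c \<prec> \<ominus> c1"
    have c2: "c2 \<in> U" using c by (simp add: Q_def)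
    then have "\<ominus> c \<in> U" "c1 \<prec> \<ominus> c" "\<ominus> c \<prec> c2"
      using c' c less_neg_iff[of c c1] neg_less_iff[of c2 c] by simp_all
    then have "evr x (\<lambda>y. lin g (\<ominus> c) y \<prec> lin g (\<ominus> c) x)" "evl x (\<lambda>y. lin g (\<ominus> c) y \<prec> lin g (\<ominus> c) x)"
      using Q_less[OF c(2)] notR_less[OF c(1,4)] by blast+
    then have "strict_min (lin (\<lambda>y. \<ominus> (g y)) c) x"
      unfolding strict_min_def evr_def evl_def using lin_neg gU e c' by simp
    then show "strict_min (lin (\<lambda>x. \<ominus> (F (e(i := x)))) c) (e i)" by (simp add: g_def x_def)
  qed (use c in \<open>simp_all add: Q_def\<close>)
  \<comment> \<open>With \<open>R\<close> empty, \<open>Q\<close> is empty too, and the negative of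
    the function is weakly increasing at the point after tilting by any slope: its slope would be
    infinite.\<close>
  have "R \<noteq> {}"
  proof
    assume "R = {}"
    have "Q = {}"
    proof (rule ccontr)
      assume "Q \<noteq> {}"
      then obtain c2 where c2: "c2 \<in> Q" by blast
      then obtain c1 where "c1 \<in> U" "c1 \<prec> c2" using ex_less by (auto simp: Q_def)
      then show False using gap2 c2 \<open>R = {}\<close> by blast
    qed
    show False
    proof (rule no_infinite_slope[OF nF gen])
      fix c assume c: "c \<in> U"
      then have "evr x (\<lambda>y. \<not> lin g (\<ominus> c) x \<prec> lin g (\<ominus> c) y)" "evl x (\<lambda>y. \<not> lin g (\<ominus> c) y \<prec> lin g (\<ominus> c) x)"
        using notR[of "\<ominus> c"] notQ[of "\<ominus> c"] \<open>R = {}\<close> \<open>Q = {}\<close> by simp_all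
      then have "winc (lin (\<lambda>y. \<ominus> (g y)) c) x"
        unfolding winc_def evr_def evl_def using lin_neg gU e c by simp
      then show "winc (lin (\<lambda>x. \<ominus> (F (e(i := x)))) c) (e i)" by (simp add: g_def x_def)
    qed
  qed
  moreover have "\<exists>u\<in>U. \<forall>c\<in>R. \<not> u \<prec> c"
  proof (rule ccontr)
    assume "\<not> ?thesis"
    then have unb: "\<exists>c\<in>R. u \<prec> c" if "u \<in> U" for u using that by blast
    show False
    proof (rule no_infinite_slope[OF F gen])
      fix c assume c: "c \<in> U"
      obtain c' where c': "c' \<in> R" "c \<prec> c'" using unb c by blast
      have 1: "evr x (\<lambda>y. lin g c x \<prec> lin g c y)" using R_less c c' by blast
      have "c \<in> Q" using gap1 c c' by blast
      then have 2: "evl x (\<lambda>y. lin g c y \<prec> lin g c x)" by (simp add: Q_def)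
      have "evr x (\<lambda>y. \<not> lin g c y \<prec> lin g c x)"
        by (rule evr_mono[OF 1]) (use less_asym linU c e in blast)
      moreover have "evl x (\<lambda>y. \<not> lin g c x \<prec> lin g c y)"
        by (rule evl_mono[OF 2]) (use less_asym linU c e in blast)
      ultimately show "winc (lin ?g c) (e i)" by (simp add: winc_def g_def x_def)
    qed
  qed
  moreover have "dset U R"
    unfolding R_def lin_def
    by (intro dsetI field_intros definable_evr dterm_app[OF g] dterm_const gU e)
  ultimately obtain d where d: "lub R d" using ex_lub by blast
  then have dU: "d \<in> U" by (simp add: lub_def)
  have "hasd g x d"
    unfolding hasd_def
  proof (intro ballI conjI impI)
    fix c assume c: "c \<in> U" "c \<prec> d"
    then obtain c' where c': "c' \<in> R" "c \<prec> c'" using d by (auto simp: lub_def)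
    then show "evr x (\<lambda>y. lin g c x \<prec> lin g c y)" using R_less c by blast
    have "c \<in> Q" using gap1 c c' by blast
    then show "evl x (\<lambda>y. lin g c y \<prec> lin g c x)" by (simp add: Q_def)
  next
    fix c assume c: "c \<in> U" "d \<prec> c"
    obtain c1 where c1: "c1 \<in> U" "d \<prec> c1" "c1 \<prec> c" using dense dU c by blast
    have nR: "z \<notin> R" if "d \<prec> z" for z using d that unfolding lub_def by blast
    show "evr x (\<lambda>y. lin g c y \<prec> lin g c x)" using notR_less[OF c1(1) nR[OF c1(2)] c(1) c1(3)] .
    \<comment> \<open>A slope strictly between \<open>d\<close> and \<open>c1\<close> is outside
      \<open>R\<close>, so \<open>c1\<close> in \<open>Q\<close> would produce the second kind of
      gap.\<close>
    have "c1 \<notin> Q"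
    proof
      assume "c1 \<in> Q"
      obtain c0 where "c0 \<in> U" "d \<prec> c0" "c0 \<prec> c1" using dense dU c1 by blast
      then show False using gap2 nR \<open>c1 \<in> Q\<close> by blast
    qed
    then show "evl x (\<lambda>y. lin g c x \<prec> lin g c y)" using notQ_less c1 c by blast
  qed
  then show ?thesis using dU by (auto simp: g_def x_def)
qed

section \<open>Partial derivatives as definable functions\<close>

definition pderiv :: "((nat \<Rightarrow> 'u) \<Rightarrow> 'u) \<Rightarrow> nat \<Rightarrow> (nat \<Rightarrow> 'u) \<Rightarrow> 'u" where
  "pderiv F i e = (if \<exists>d\<in>U. hasd (\<lambda>x. F (e(i := x))) (e i) d
     then SOME d. d \<in> U \<and> hasd (\<lambda>x. F (e(i := x))) (e i) d else \<zero>)"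

lemma pderiv_closed [simp]: "pderiv F i e \<in> U"
  unfolding pderiv_def using someI_ex[of "\<lambda>d. d \<in> U \<and> hasd (\<lambda>x. F (e(i := x))) (e i) d"] by auto

lemma pderiv_hasd:
  "\<exists>d\<in>U. hasd (\<lambda>x. F (e(i := x))) (e i) d \<Longrightarrow> hasd (\<lambda>x. F (e(i := x))) (e i) (pderiv F i e)"
  unfolding pderiv_def using someI_ex[of "\<lambda>d. d \<in> U \<and> hasd (\<lambda>x. F (e(i := x))) (e i) d"] by auto

lemma definable_hasd:
  assumes "dterm A F"
  shows "definable A (\<lambda>e. hasd (\<lambda>x. F ((\<lambda>k. e (\<pi> k))(i := x))) (e l) (e j))"
  unfolding hasd_def lin_def
  by (intro field_intros definable_evr definable_evl dterm_upd[OF assms])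

text \<open>A derivative is unique, so the choice in \<open>pderiv\<close> does not spoil
  definability. Continuity at generic points thus covers the partial derivatives as well.\<close>

lemma dterm_pderiv:
  assumes F: "dterm A F"
  shows "dterm A (pderiv F i)"
proof -
  have FU: "F e \<in> U" if "e \<in> vals" for e using dterm_in[OF F that] .
  have eq: "x = pderiv F i e \<longleftrightarrow> hasd (\<lambda>x. F (e(i := x))) (e i) x \<or>
      (x = \<zero> \<and> \<not> (\<exists>d\<in>U. hasd (\<lambda>x. F (e(i := x))) (e i) d))" if "e \<in> vals" "x \<in> U" for e x
  proof (cases "\<exists>d\<in>U. hasd (\<lambda>x. F (e(i := x))) (e i) d")
    case True
    have "hasd (\<lambda>x. F (e(i := x))) (e i) x \<longleftrightarrow> x = pderiv F i e"
    proof
      assume "hasd (\<lambda>x. F (e(i := x))) (e i) x"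
      then show "x = pderiv F i e"
        by (rule hasd_unique[OF _ pderiv_hasd[OF True]]) (use that FU in \<open>simp_all del: fun_upd_apply\<close>)
    qed (use pderiv_hasd[OF True] in blast)
    then show ?thesis using True by blast
  next
    case False
    then show ?thesis using that by (auto simp: pderiv_def)
  qed
  have "definable A (\<lambda>e. hasd (\<lambda>x. F ((\<lambda>k. e (Suc k))(i := x))) (e (Suc i)) (e 0) \<or>
     (e 0 = \<zero> \<and> \<not> (\<exists>d\<in>U. hasd (\<lambda>x. F ((\<lambda>k. e (Suc k))(i := x))) (e (Suc i)) d)))"
    by (intro field_intros definable_hasd[OF F])
  then show ?thesis
    unfolding dterm_def by (simp add: eq cong: definable_cong)
qed

end

section \<open>Closure of the constants under definable functions\<close>

context o_minimal_field
begin

section \<open>Definably closed sets carry elementary substructures\<close>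

lemma dcl_add: "a \<in> dcl A \<Longrightarrow> b \<in> dcl A \<Longrightarrow> a \<oplus> b \<in> dcl A"
  unfolding dcl_iff by (rule dterm_add)

lemma dcl_neg: "a \<in> dcl A \<Longrightarrow> \<ominus> a \<in> dcl A"
  unfolding dcl_iff by (rule dterm_neg)

lemma dcl_mid: "a \<in> dcl A \<Longrightarrow> b \<in> dcl A \<Longrightarrow> mid a b \<in> dcl A"
  unfolding dcl_iff by (rule dterm_mid)

lemma dcl_witness:
  assumes X: "dset A X" and A: "A \<subseteq> U" and ne: "X \<noteq> {}"
  shows "\<exists>a\<in>X. a \<in> dcl A"
proof (cases "X \<inter> bd X = {}")
  case False
  then show ?thesis using bd_subset_dcl[OF X A] by blast
next
  \<comment> \<open>Now \<open>X\<close> contains none of its boundary points, so it is open, and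
    around \<open>x\<close> it is governed by the two ends of its component.\<close>
  case True
  obtain x where x: "x \<in> X" using ne by blast
  have xU: "x \<in> U" using dset_in[OF X x] .
  have "x \<notin> bd X" using x True by blast
  then obtain p q where p: "p \<in> U" "q \<in> U" "p \<prec> x" "x \<prec> q"
    "(\<forall>y\<in>U. p \<prec> y \<longrightarrow> y \<prec> q \<longrightarrow> y \<in> X) \<or> (\<forall>y\<in>U. p \<prec> y \<longrightarrow> y \<prec> q \<longrightarrow> y \<notin> X)"
    using xU unfolding bd_def by blast
  then have pq: "\<forall>y\<in>U. p \<prec> y \<longrightarrow> y \<prec> q \<longrightarrow> y \<in> X" using x xU by blast
  have "evr x (\<lambda>y. y \<in> X)" unfolding evr_def
    using pq p less_trans[OF p(1) xU _ p(3)] by (intro bexI[of _ q]) simp_all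
  note R = right_end[OF X A xU this]
  have "evl x (\<lambda>y. y \<in> X)" unfolding evl_def
    using pq p less_trans[OF _ xU p(2) _ p(4)] by (intro bexI[of _ p]) simp_all
  note L = left_end[OF X A xU this]
  have zero: "\<zero> \<in> dcl A" and one: "\<one> \<in> dcl A" by (simp_all add: dcl_iff dterm_zero dterm_one)
  have inX: "y \<in> X" if "y \<in> U" "x \<prec> y \<Longrightarrow> y \<in> X" "y \<prec> x \<Longrightarrow> y \<in> X" for y
    using less_linear[OF that(1) xU] that x by blast
  show ?thesis
  proof (rule R)
    assume r: "\<And>y. y \<in> U \<Longrightarrow> x \<prec> y \<Longrightarrow> y \<in> X"
    show ?thesis
    proof (rule L)
      \<comment> \<open>Here \<open>X\<close> is the whole carrier, and any parameter-free element
        will do.\<close>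
      assume "\<And>y. y \<in> U \<Longrightarrow> y \<prec> x \<Longrightarrow> y \<in> X"
      with r have "\<zero> \<in> X" using inX[of \<zero>] by simp
      then show ?thesis using zero by blast
    next
      fix c assume c: "c \<in> dcl A" "c \<prec> x" "\<And>y. y \<in> U \<Longrightarrow> y \<prec> x \<Longrightarrow> c \<prec> y \<Longrightarrow> y \<in> X"
      have cU: "c \<in> U" using c dcl_in by blast
      have "c \<oplus> \<one> \<in> X" using r c cU inX[of "c \<oplus> \<one>"] by (simp add: less_add_pos)
      then show ?thesis using dcl_add[OF c(1) one] by blast
    qed
  next
    fix d assume d: "d \<in> dcl A" "x \<prec> d" "\<And>y. y \<in> U \<Longrightarrow> x \<prec> y \<Longrightarrow> y \<prec> d \<Longrightarrow> y \<in> X"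
    have dU: "d \<in> U" using d dcl_in by blast
    show ?thesis
    proof (rule L)
      assume "\<And>y. y \<in> U \<Longrightarrow> y \<prec> x \<Longrightarrow> y \<in> X"
      then have "d \<oplus> \<ominus> \<one> \<in> X" using d dU inX[of "d \<oplus> \<ominus> \<one>"] by (simp add: sub_pos_less)
      then show ?thesis using dcl_add[OF d(1) dcl_neg[OF one]] by blast
    next
      fix c assume c: "c \<in> dcl A" "c \<prec> x" "\<And>y. y \<in> U \<Longrightarrow> y \<prec> x \<Longrightarrow> c \<prec> y \<Longrightarrow> y \<in> X"
      have cU: "c \<in> U" using c dcl_in by blast
      have "c \<prec> d" using less_trans[OF cU xU dU] c d by blast
      then have "mid c d \<in> X"
        using c d cU dU mid_less[OF cU dU] inX[of "mid c d"] by simp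
      then show ?thesis using dcl_mid[OF c(1) d(1)] by blast
    qed
  qed
qed

lemma fun_int_dcl:
  assumes f: "fun_ar L f = Some n" and u: "u \<in> tuples M n"
  shows "fun_int M f u \<in> dcl (set u)"
proof -
  have U: "set u \<subseteq> U" "length u = n" using u by (auto simp: tuples_def)
  let ?t = "App f (map Var [0..<n])"
  have "is_term L ?t" using f by simp
  then have "definable (set u) (\<lambda>e. e 0 = eval M (\<lambda>k. e (Suc k)) ?t)"
    using dterm_eval[of ?t "set u"] unfolding dterm_def by blast
  then have "definable (set u) (\<lambda>e. e 0 = fun_int M f (map (\<lambda>k. e (Suc k)) [0..<n]))"
    by (simp add: comp_def)
  \<comment> \<open>Variable \<open>0\<close> stays the value of the graph, variable
    \<open>Suc k\<close> becomes the parameter \<open>u ! k\<close>; the tags beyond the arity are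
    fillers.\<close>
  then have "definable (set u) (\<lambda>e. pval e (case 0 of 0 \<Rightarrow> Inl 0 | Suc k \<Rightarrow> if k < n then Inr (u ! k) else Inl 0) =
     fun_int M f (map (\<lambda>j. pval e (case Suc j of 0 \<Rightarrow> Inl 0 | Suc k \<Rightarrow> if k < n then Inr (u ! k) else Inl 0)) [0..<n]))"
    by (rule definable_subst_params) (use U in \<open>auto split: nat.splits if_splits\<close>)
  moreover have "map (\<lambda>j. pval e (if j < n then Inr (u ! j) else Inl 0)) [0..<n] = u" for e :: "nat \<Rightarrow> 'u"
    using U by (auto intro: nth_equalityI)
  ultimately have "definable (set u) (\<lambda>e. e 0 = fun_int M f u)" by simp
  moreover have "fun_int M f u \<in> U" using struct f u by (simp add: is_struct_def)
  ultimately show ?thesis by (simp add: dcl_def)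
qed

lemma dcl_closed_elementary:
  assumes C: "C \<subseteq> U" "dcl C \<subseteq> C"
  shows "elementary_substructure L (M\<lparr>carrier := C\<rparr>) M"
proof -
  let ?N = "M\<lparr>carrier := C\<rparr>"
  have zero: "\<zero> \<in> C" using C(2) by (auto simp: dcl_iff dterm_zero)
  have tup: "u \<in> tuples M n" if "u \<in> tuples ?N n" for u n
    using that C(1) by (auto simp: tuples_def)
  have "fun_int M f u \<in> C" if "fun_ar L f = Some n" "u \<in> tuples ?N n" for f n u
  proof -
    have "set u \<subseteq> C" using that by (simp add: tuples_def)
    then have "dcl (set u) \<subseteq> C" using dcl_mono C(2) by blast
    then show ?thesis using fun_int_dcl[OF that(1) tup[OF that(2)]] by blast
  qed
  then have "is_struct L ?N" using zero by (auto simp: is_struct_def)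
  then have sub: "substructure L ?N M"
    using struct C(1) by (simp add: substructure_def)
  have eval_N: "eval ?N e t = eval M e t" for e t
  proof (induction t)
    case (App f ts)
    then have "map (eval ?N e) ts = map (eval M e) ts" by (intro map_cong) auto
    then show ?case by (simp only: eval.simps) simp
  qed simp
  have "sat ?N e p = sat M e p" if "is_formula L p" "range e \<subseteq> C" for p e
    using that
  proof (induction p arbitrary: e)
    case (FRel r ts)
    have "map (eval ?N e) ts = map (eval M e) ts" by (simp add: eval_N)
    then show ?case by (simp only: sat.simps) simp
  next
    case (FAnd p q)
    then show ?case by simp
  next
    case (FEx x p)
    have IH: "sat ?N (e(x := a)) p = sat M (e(x := a)) p" if "a \<in> C" for a
    proof (rule FEx.IH)
      show "range (e(x := a)) \<subseteq> C" using FEx.prems(2) that by auto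
    qed (use FEx.prems in simp)
    show ?case
    proof
      assume "sat ?N e (FEx x p)"
      then show "sat M e (FEx x p)" using IH C(1) by (auto simp del: fun_upd_apply)
    next
      assume h: "sat M e (FEx x p)"
      have e: "e \<in> vals" using FEx.prems(2) C(1) by (auto simp: vals_def)
      let ?X = "{a \<in> U. sat M (e(x := a)) p}"
      \<comment> \<open>The set of witnesses is definable over values of \<open>e\<close>, all of
        which lie in \<open>C\<close>, so it has a member in the definable closure of
        \<open>C\<close>.\<close>
      have "dset (e ` (- {x})) ?X"
        using FEx.prems(1) e by (intro dset_slice definable_sat) simp_all
      then have "dset C ?X" by (rule dset_mono) (use FEx.prems(2) in auto)
      moreover have "?X \<noteq> {}" using h by auto
      ultimately obtain a where "a \<in> ?X" "a \<in> dcl C" using dcl_witness[OF _ C(1)] by blast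
      then have "a \<in> C" "sat M (e(x := a)) p" using C(2) by auto
      then show "sat ?N e (FEx x p)" using IH by (auto simp del: fun_upd_apply)
    qed
  qed (simp_all add: eval_N)
  then show ?thesis
    using sub by (simp add: elementary_substructure_def)
qed

text \<open>Valuations are infinite while the statement uses lists. The padding
  \<open>\<zero>\<close> is definable without parameters and therefore does not affect the
  independence of the entries.\<close>

definition pad :: "'u list \<Rightarrow> nat \<Rightarrow> 'u" where
  "pad u k = (if k < length u then u ! k else \<zero>)"

lemma pad_vals: "u \<in> tuples M n \<Longrightarrow> pad u \<in> vals"
  by (rule valsI) (auto simp: pad_def tuples_def subset_iff)

lemma in_box_iff_near:
  "u \<in> tuples M n \<Longrightarrow> v \<in> tuples M n \<Longrightarrow> in_box M n r u v \<longleftrightarrow> near {..<n} r (pad u) (pad v)"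
  by (auto simp: in_box_def near_def nearby_def pad_def tuples_def)

lemma open_at_open:
  assumes "open_at P I e" "e \<in> vals"
  shows "open_at (open_at P I) I e"
proof -
  from assms obtain r where r: "r \<in> U" "\<zero> \<prec> r" "\<And>e'. e' \<in> vals \<Longrightarrow> near I r e e' \<Longrightarrow> P e'"
    unfolding open_at_def by blast
  let ?h = "half \<otimes> r"
  have h: "?h \<in> U" "\<zero> \<prec> ?h" using r mul_pos[of half r] half_pos by simp_all
  have "open_at P I e'" if e': "e' \<in> vals" "near I ?h e e'" for e'
  proof -
    have "near I r e e''" if e'': "e'' \<in> vals" "near I ?h e' e''" for e''
    proof -
      have "nearby r (e i) (e'' i)" if "i \<in> I" for i
        using nearby_half[of r "e i" "e' i" "e'' i"] e' e'' r(1,2) assms(2) that by (simp add: near_def)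
      then show ?thesis using e'(2) e''(2) by (simp add: near_def)
    qed
    then show ?thesis unfolding open_at_def using h r(3) by blast
  qed
  then show ?thesis unfolding open_at_def[of _ I e] using h by blast
qed

lemma open_atD: "open_at P I e \<Longrightarrow> e \<in> vals \<Longrightarrow> P e"
  unfolding open_at_def using near_refl by blast

section \<open>The domain on which a definable function is continuously differentiable\<close>

definition C1_point :: "((nat \<Rightarrow> 'u) \<Rightarrow> 'u) \<Rightarrow> nat \<Rightarrow> (nat \<Rightarrow> 'u) \<Rightarrow> bool" where
  "C1_point F n e \<longleftrightarrow> (\<forall>i\<in>{..<n}. (\<exists>d\<in>U. hasd (\<lambda>x. F (e(i := x))) (e i) d) \<and>
     contI (pderiv F i) {..<n} e)"

text \<open>The interior of the set of good points: open by construction, and definable without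
  parameters because being an interior point is.\<close>

definition C1_domain :: "((nat \<Rightarrow> 'u) \<Rightarrow> 'u) \<Rightarrow> nat \<Rightarrow> 'u list set" where
  "C1_domain F n = {u \<in> tuples M n. open_at (C1_point F n) {..<n} (pad u)}"

lemma definable_C1_point:
  assumes F: "dterm {} F"
  shows "definable {} (C1_point F n)"
  unfolding C1_point_def
  by (intro definable_finite_all definable_conj definable_ex definable_hasd[OF F]
      definable_contI dterm_pderiv[OF F] finite_lessThan)

lemma definable_open_at': "finite I \<Longrightarrow> definable {} P \<Longrightarrow> definable {} (open_at P I)"
  by (rule definable_open_at[where P = "\<lambda>_. P" and \<pi> = "\<lambda>k. k"]) (assumption, rule definable_rename)

text \<open>At a generic point the derivatives exist and are continuous. This is itself a
  parameter-free property, so by openness it holds on a box about the point.\<close>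

lemma generic_C1_point:
  assumes F: "dterm {} F" and gen: "generic {..<n} e"
  shows "open_at (C1_point F n) {..<n} e"
proof -
  have "tame_at {..<n} e" by (rule generic_tame[OF finite_lessThan gen])
  moreover have "generic {i} e" if "i < n" for i using generic_subset[OF gen, of "{i}"] that by simp
  ultimately show ?thesis
    using generic_hasd[OF F] definable_C1_point[OF F] dterm_pderiv[OF F]
    unfolding tame_at_def by (simp add: C1_point_def)
qed

lemma open_C1_domain: "open_in_power M n (C1_domain F n)"
  unfolding open_in_power_def
proof (intro conjI ballI)
  show "C1_domain F n \<subseteq> tuples M n" by (auto simp: C1_domain_def)
  fix u assume "u \<in> C1_domain F n"
  then have u: "u \<in> tuples M n" "open_at (C1_point F n) {..<n} (pad u)" by (auto simp: C1_domain_def)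
  from open_at_open[OF u(2) pad_vals[OF u(1)]] obtain r where r: "r \<in> U" "\<zero> \<prec> r"
    "\<And>e'. e' \<in> vals \<Longrightarrow> near {..<n} r (pad u) e' \<Longrightarrow> open_at (C1_point F n) {..<n} e'"
    unfolding open_at_def[of _ _ "pad u"] by blast
  show "\<exists>r\<in>pos_of M. \<forall>v\<in>tuples M n. in_box M n r u v \<longrightarrow> v \<in> C1_domain F n"
  proof (intro bexI[of _ r] ballI impI)
    fix v assume v: "v \<in> tuples M n" "in_box M n r u v"
    then have "near {..<n} r (pad u) (pad v)" using in_box_iff_near u by blast
    then show "v \<in> C1_domain F n" using r(3)[OF pad_vals[OF v(1)]] v by (simp add: C1_domain_def)
  qed (use r in \<open>simp add: pos_of_def\<close>)
qed

lemma C1_domain_point: "u \<in> C1_domain F n \<Longrightarrow> C1_point F n (pad u)"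
  by (auto simp: C1_domain_def intro: open_atD pad_vals)

lemma C1_with_Jacobian_pderiv:
  assumes F: "dterm {} F"
  shows "C1_with_Jacobian M n (C1_domain F n) (\<lambda>u. F (pad u)) (\<lambda>u. map (\<lambda>i. pderiv F i (pad u)) [0..<n])"
  unfolding C1_with_Jacobian_def
proof (intro conjI allI impI ballI)
  show "(\<lambda>u. F (pad u)) ` C1_domain F n \<subseteq> U"
    using dterm_in[OF F] pad_vals by (auto simp: C1_domain_def)
  show "(\<lambda>u. map (\<lambda>i. pderiv F i (pad u)) [0..<n]) ` C1_domain F n \<subseteq> tuples M n"
    by (auto simp: tuples_def)
next
  fix i u assume i: "i < n" and u: "u \<in> C1_domain F n"
  have ut: "u \<in> tuples M n" "length u = n" using u by (auto simp: C1_domain_def tuples_def)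
  note uv = pad_vals[OF ut(1)]
  let ?g = "\<lambda>x. F ((pad u)(i := x))"
  have d: "hasd ?g (pad u i) (pderiv F i (pad u))"
    using C1_domain_point[OF u] i by (intro pderiv_hasd) (simp add: C1_point_def)
  have upd: "pad (u[i := x]) = (pad u)(i := x)" for x
    using i ut by (auto simp: pad_def fun_eq_iff)
  have ui: "u ! i = pad u i" using i ut by (simp add: pad_def)
  have gU: "?g z \<in> U" if "z \<in> U" for z using dterm_in[OF F] uv that by simp
  show "has_partial_derivative M (C1_domain F n) (\<lambda>u. F (pad u)) i u (map (\<lambda>i. pderiv F i (pad u)) [0..<n] ! i)"
    unfolding has_partial_derivative_def
  proof (intro ballI)
    fix \<epsilon> assume "\<epsilon> \<in> pos_of M"
    then have \<epsilon>: "\<epsilon> \<in> U" "\<zero> \<prec> \<epsilon>" by (auto simp: pos_of_def)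
    from hasd_bound[OF gU d pderiv_closed _ this] uv obtain \<eta> where \<eta>: "\<eta> \<in> U" "\<zero> \<prec> \<eta>"
      "\<And>h. h \<in> U \<Longrightarrow> h \<noteq> \<zero> \<Longrightarrow> abs_of M h \<prec> \<eta> \<Longrightarrow>
        abs_of M (sub_of M (sub_of M (?g (pad u i \<oplus> h)) (?g (pad u i))) (pderiv F i (pad u) \<otimes> h)) \<prec> \<epsilon> \<otimes> abs_of M h"
      by (auto simp del: fun_upd_apply)
    show "\<exists>\<eta>\<in>pos_of M. \<forall>h\<in>U. let u' = u[i := u ! i \<oplus> h] in
        h \<noteq> \<zero> \<longrightarrow> abs_of M h \<prec> \<eta> \<longrightarrow> u' \<in> C1_domain F n \<longrightarrow>
        abs_of M (sub_of M (sub_of M (F (pad u')) (F (pad u)))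
          (map (\<lambda>i. pderiv F i (pad u)) [0..<n] ! i \<otimes> h)) \<prec> \<epsilon> \<otimes> abs_of M h"
    proof (intro bexI[of _ \<eta>] ballI)
      fix h assume "h \<in> U"
      from \<eta>(3)[OF this] show "let u' = u[i := u ! i \<oplus> h] in
        h \<noteq> \<zero> \<longrightarrow> abs_of M h \<prec> \<eta> \<longrightarrow> u' \<in> C1_domain F n \<longrightarrow>
        abs_of M (sub_of M (sub_of M (F (pad u')) (F (pad u)))
          (map (\<lambda>i. pderiv F i (pad u)) [0..<n] ! i \<otimes> h)) \<prec> \<epsilon> \<otimes> abs_of M h"
        using i by (simp add: Let_def upd ui del: fun_upd_apply)
    qed (use \<eta> in \<open>simp add: pos_of_def\<close>)
  qed
next
  fix i assume i: "i < n"
  show "continuous_on_power M n (C1_domain F n) (\<lambda>u. map (\<lambda>i. pderiv F i (pad u)) [0..<n] ! i)"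
    unfolding continuous_on_power_def
  proof (intro ballI)
    fix u \<epsilon> assume u: "u \<in> C1_domain F n" and "\<epsilon> \<in> pos_of M"
    then have \<epsilon>: "\<epsilon> \<in> U" "\<zero> \<prec> \<epsilon>" by (auto simp: pos_of_def)
    have ut: "u \<in> tuples M n" using u by (auto simp: C1_domain_def)
    let ?d = "pderiv F i (pad u)"
    have "contI (pderiv F i) {..<n} (pad u)"
      using C1_domain_point[OF u] i by (simp add: C1_point_def)
    then have "open_at (\<lambda>e'. ?d \<oplus> \<ominus> \<epsilon> \<prec> pderiv F i e' \<and> pderiv F i e' \<prec> ?d \<oplus> \<epsilon>) {..<n} (pad u)"
      unfolding contI_def using \<epsilon> by (simp add: sub_pos_less less_add_pos)
    then obtain r where r: "r \<in> U" "\<zero> \<prec> r" "\<And>e'. e' \<in> vals \<Longrightarrow> near {..<n} r (pad u) e' \<Longrightarrow>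
        ?d \<oplus> \<ominus> \<epsilon> \<prec> pderiv F i e' \<and> pderiv F i e' \<prec> ?d \<oplus> \<epsilon>"
      unfolding open_at_def by blast
    show "\<exists>r\<in>pos_of M. \<forall>v\<in>C1_domain F n. in_box M n r u v \<longrightarrow>
        abs_of M (sub_of M (map (\<lambda>i. pderiv F i (pad v)) [0..<n] ! i)
          (map (\<lambda>i. pderiv F i (pad u)) [0..<n] ! i)) \<prec> \<epsilon>"
    proof (intro bexI[of _ r] ballI impI)
      fix v assume v: "v \<in> C1_domain F n" "in_box M n r u v"
      then have vt: "v \<in> tuples M n" by (auto simp: C1_domain_def)
      then have "near {..<n} r (pad u) (pad v)" using v(2) in_box_iff_near ut by blast
      from r(3)[OF pad_vals[OF vt] this] have "nearby \<epsilon> ?d (pderiv F i (pad v))"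
        using \<epsilon> by (simp add: nearby_iff)
      then show "abs_of M (sub_of M (map (\<lambda>i. pderiv F i (pad v)) [0..<n] ! i)
          (map (\<lambda>i. pderiv F i (pad u)) [0..<n] ! i)) \<prec> \<epsilon>"
        using i by (simp add: nearby_def)
    qed (use r in \<open>simp add: pos_of_def\<close>)
  qed
qed

lemma definable_list_formula:
  assumes R: "definable {} R" and dep: "\<And>e e'. (\<And>k. k \<le> n \<Longrightarrow> e k = e' k) \<Longrightarrow> R e = R e'"
  shows "\<exists>p. is_formula L p \<and> fm_vars p \<subseteq> {..n} \<and>
    (\<forall>v\<in>tuples M (Suc n). sat M ((!) v) p = R (pad v))"
proof -
  from R obtain p s where p: "is_formula L p" "\<forall>k a. s k = Inr a \<longrightarrow> a \<in> {}"
    "\<forall>e\<in>vals. R e \<longleftrightarrow> sat M (\<lambda>k. pval e (s k)) p"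
    unfolding definable_def by blast
  \<comment> \<open>The valuation \<open>(!) v\<close> is unspecified beyond the list, so the
    formula may only mention the variables up to \<open>n\<close>. Larger indices are capped at
    \<open>n\<close>, which is harmless because \<open>R\<close> does not look at them. All tags are
    of the form \<open>Inl\<close>, as there are no parameters.\<close>
  define \<pi> where "\<pi> k = min (projl (s k)) n" for k
  have s: "pval e (s k) = e (projl (s k))" for e k
    using p(2) by (cases "s k") auto
  obtain q where q: "is_formula L q" "fm_vars q = \<pi> ` fm_vars p" "\<forall>e. sat M e q = sat M (\<lambda>k. e (\<pi> k)) p"
    using ex_renaming[OF p(1)] by metis
  have qn: "fm_vars q \<subseteq> {..n}" using q(2) by (auto simp: \<pi>_def)
  have "sat M ((!) v) q = R (pad v)" if v: "v \<in> tuples M (Suc n)" for v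
  proof -
    have "sat M ((!) v) q = sat M (pad v) q"
      using qn v by (intro sat_cong) (auto simp: pad_def tuples_def)
    also have "\<dots> = sat M (\<lambda>k. pval (\<lambda>j. pad v (min j n)) (s k)) p"
      using q(3) by (simp add: s \<pi>_def)
    also have "\<dots> = R (\<lambda>j. pad v (min j n))"
      using p(3)[rule_format, OF vals_ren[OF pad_vals[OF v]], of "\<lambda>j. min j n"] by simp
    also have "\<dots> = R (pad v)" by (rule dep) simp
    finally show ?thesis .
  qed
  then show ?thesis using q(1) qn by blast
qed

lemma zero_definable_C1:
  assumes F: "dterm {} F"
  shows "zero_definable_fun L M n (C1_domain F n) (\<lambda>u. F (pad u))"
proof -
  \<comment> \<open>The arguments are the first \<open>n\<close> coordinates and coordinate
    \<open>n\<close> holds the value. Everything from \<open>n\<close> on is overwritten, so that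
    the defining predicate depends on the coordinates up to \<open>n\<close> only and agrees with
    \<open>pad\<close>.\<close>
  define cut where "cut z e k = (if k < n then e k else z)" for z :: 'u and e :: "nat \<Rightarrow> 'u" and k :: nat
  let ?G = "open_at (C1_point F n) {..<n}"
  define R where "R e \<longleftrightarrow> ?G (cut \<zero> e) \<and> e n = F (cut \<zero> e)" for e
  have dG: "definable {} ?G" by (intro definable_open_at' definable_C1_point F finite_lessThan)
  have cut: "(\<lambda>k. e (if k < n then Suc k else 0)) = cut (e 0) (\<lambda>k. e (Suc k))" for e
    by (auto simp: cut_def)
  have "definable {} (\<lambda>e. ?G (cut (e 0) (\<lambda>k. e (Suc k))) \<and> e (Suc n) = F (cut (e 0) (\<lambda>k. e (Suc k))))"
    using definable_rename[OF dG, of "\<lambda>k. if k < n then Suc k else 0", unfolded cut]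
      dterm_rename[OF F, of "\<lambda>k. if k < n then Suc k else 0", unfolded cut]
    by (intro definable_conj definable_eq dterm_var)
  \<comment> \<open>Renaming can only copy coordinates, so the filler is first a coordinate of its
    own; \<open>\<zero>\<close> is substituted for it here.\<close>
  from definable_let[OF dterm_zero, of _ "\<lambda>z e. ?G (cut z e) \<and> e n = F (cut z e)", OF this]
  have "definable {} R" unfolding R_def .
  moreover have "R e = R e'" if "\<And>k. k \<le> n \<Longrightarrow> e k = e' k" for e e'
  proof -
    have "cut \<zero> e = cut \<zero> e'" using that by (auto simp: cut_def)
    then show ?thesis using that[of n] by (simp add: R_def)
  qed
  ultimately obtain p where p: "is_formula L p" "fm_vars p \<subseteq> {..n}"
    "\<forall>v\<in>tuples M (Suc n). sat M ((!) v) p = R (pad v)"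
    using definable_list_formula[of R n] by blast
  have "{u @ [F (pad u)] | u. u \<in> C1_domain F n} = {v \<in> tuples M (Suc n). R (pad v)}"
  proof (intro set_eqI iffI)
    fix v assume "v \<in> {u @ [F (pad u)] | u. u \<in> C1_domain F n}"
    then obtain u where u: "u \<in> C1_domain F n" "v = u @ [F (pad u)]" by blast
    have ut: "u \<in> tuples M n" "length u = n" using u by (auto simp: C1_domain_def tuples_def)
    have "F (pad u) \<in> U" using dterm_in[OF F pad_vals[OF ut(1)]] .
    then have "v \<in> tuples M (Suc n)" using ut u(2) by (simp add: tuples_def)
    moreover have "cut \<zero> (pad v) = pad u"
      using ut u(2) by (auto simp: cut_def pad_def fun_eq_iff nth_append)
    then have "R (pad v)" using u ut by (simp add: R_def C1_domain_def) (simp add: pad_def nth_append)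
    ultimately show "v \<in> {v \<in> tuples M (Suc n). R (pad v)}" by simp
  next
    fix v assume "v \<in> {v \<in> tuples M (Suc n). R (pad v)}"
    then have v: "v \<in> tuples M (Suc n)" "R (pad v)" by auto
    define u where "u = take n v"
    have l: "length v = Suc n" "set v \<subseteq> U" using v by (auto simp: tuples_def)
    then have ut: "u \<in> tuples M n" using set_take_subset[of n v] by (auto simp: u_def tuples_def)
    have vu: "v = u @ [v ! n]" unfolding u_def using l take_Suc_conv_app_nth[of n v] by simp
    have "cut \<zero> (pad v) = pad u"
      using l by (auto simp: cut_def pad_def fun_eq_iff u_def)
    then have "?G (pad u)" "pad v n = F (pad u)" using v(2) by (simp_all add: R_def)
    then have "u \<in> C1_domain F n" "v ! n = F (pad u)" using ut l by (simp_all add: C1_domain_def pad_def)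
    then show "v \<in> {u @ [F (pad u)] | u. u \<in> C1_domain F n}" using vu by auto
  qed
  also have "\<dots> = {v \<in> tuples M (Suc n). sat M ((!) v) p}" using p(3) by blast
  finally show ?thesis unfolding zero_definable_fun_def using p(1,2) by blast
qed

section \<open>The derivation vanishes on the definable closure of the constants\<close>

lemma dot_of_zeros:
  assumes "set v \<subseteq> U" "set w \<subseteq> {\<zero>}"
  shows "dot_of M v w = \<zero>"
  using assms unfolding dot_of_def
proof (induction v arbitrary: w)
  case (Cons x v)
  then show ?case by (cases w) auto
qed simp

lemma derivation_zero_dcl:
  assumes \<delta>: "T_derivation L M \<delta>" and a: "a \<in> dcl (constants M \<delta>)"
  shows "a \<in> constants M \<delta>"
proof -
  let ?C = "constants M \<delta>"
  have CU: "?C \<subseteq> U" by (auto simp: constants_def)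
  have "\<exists>S. finite S \<and> S \<subseteq> ?C \<and> a \<in> dcl S"
    using definable_finite_params[of ?C "\<lambda>e. e 0 = a"] a by (auto simp: dcl_def)
  then have "\<exists>n S. finite S \<and> S \<subseteq> ?C \<and> a \<in> dcl S \<and> card S = n" by blast
  then obtain n S where S: "finite S" "S \<subseteq> ?C" "a \<in> dcl S" "card S = n"
    and min: "\<And>S'. finite S' \<Longrightarrow> S' \<subseteq> ?C \<Longrightarrow> a \<in> dcl S' \<Longrightarrow> n \<le> card S'"
    using exists_least_iff[of "\<lambda>n. \<exists>S. finite S \<and> S \<subseteq> ?C \<and> a \<in> dcl S \<and> card S = n"]
    by (metis not_less)
  \<comment> \<open>A member definable from the others could be dropped without losing
    \<open>a\<close>, against the least cardinality of \<open>S\<close>.\<close>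
  have indep: "b \<notin> dcl (S - {b})" if "b \<in> S" for b
  proof
    assume "b \<in> dcl (S - {b})"
    then have "dcl S = dcl (S - {b})" using dcl_dcl_insert that by (metis insert_Diff)
    then have "n \<le> card (S - {b})" using min[of "S - {b}"] S by auto
    then show False using S that card_Diff1_less[of S b] by simp
  qed
  obtain u where u: "set u = S" "distinct u" using finite_distinct_list S(1) by blast
  have lu: "length u = n" using u S(4) distinct_card by fastforce
  have ut: "u \<in> tuples M n" using u lu S(2) CU by (auto simp: tuples_def)
  let ?e = "pad u"
  have ev: "?e \<in> vals" using pad_vals[OF ut] .
  have gen: "generic {..<n} ?e"
    unfolding generic_def
  proof (intro conjI ballI)
    fix i assume "i \<in> {..<n}"
    then have i: "i < n" by simp
    \<comment> \<open>The remaining coordinates are the other entries of \<open>u\<close>, distinct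
      from \<open>u ! i\<close>, and the padding.\<close>
    have "?e ` (- {i}) \<subseteq> insert \<zero> (S - {u ! i})"
    proof
      fix x assume "x \<in> ?e ` (- {i})"
      then obtain k where k: "k \<noteq> i" "x = ?e k" by blast
      show "x \<in> insert \<zero> (S - {u ! i})"
      proof (cases "k < n")
        case True
        then have "u ! k \<noteq> u ! i" "u ! k \<in> S"
          using u i lu k nth_eq_iff_index_eq by (blast, auto)
        then show ?thesis using k True lu by (simp add: pad_def)
      qed (use k lu in \<open>simp add: pad_def\<close>)
    qed
    then have "dcl (?e ` (- {i})) \<subseteq> dcl (S - {u ! i})"
      using dcl_mono dcl_insert_zero by metis
    moreover have "u ! i \<notin> dcl (S - {u ! i})" using indep u i lu by auto
    ultimately show "?e i \<notin> dcl (?e ` (- {i}))" using i lu by (auto simp: pad_def)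
  qed (rule ev)
  have "S = ?e ` {..<n}" using u lu by (auto simp: pad_def set_conv_nth)
  then obtain F where F: "dterm {} F" "F ?e = a"
    using dcl_function[of a ?e "{..<n}"] S(3) ev by auto
  have uD: "u \<in> C1_domain F n" using ut generic_C1_point[OF F(1) gen] by (simp add: C1_domain_def)
  have "\<delta> (F (pad u)) = dot_of M (map (\<lambda>i. pderiv F i (pad u)) [0..<n]) (map \<delta> u)"
    by (rule \<delta>[unfolded T_derivation_def, THEN conjunct2, rule_format, OF open_C1_domain
        zero_definable_C1[OF F(1)] C1_with_Jacobian_pderiv[OF F(1)] uD])
  also have "\<dots> = \<zero>"
  proof (rule dot_of_zeros)
    show "set (map \<delta> u) \<subseteq> {\<zero>}" using u(1) S(2) by (auto simp: constants_def)
  qed auto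
  finally show ?thesis using F(2) dcl_in[OF a] by (simp add: constants_def)
qed

theorem constants_elementary_substructure:
  assumes "T_derivation L M \<delta>"
  shows "elementary_substructure L (M\<lparr>carrier := constants M \<delta>\<rparr>) M"
proof (rule dcl_closed_elementary)
  show "constants M \<delta> \<subseteq> U" by (auto simp: constants_def)
  show "dcl (constants M \<delta>) \<subseteq> constants M \<delta>" using derivation_zero_dcl[OF assms] by blast
qed

end

theorem lemma2p3:
  fixes L :: "('a oring_fun, 'b oring_rel) lang"
    and T :: "('a, 'b) oring_fm set"
    and M :: "('a, 'b, 'm) oring_struct"
    and \<delta> :: "'m \<Rightarrow> 'm"
  assumes "extends_oring L"
    and "is_theory L T"
    and "complete_theory TYPE('m + ('a, 'b) oring_fm) L T"
    and "model_complete TYPE('m + ('a, 'b) oring_fm) L T"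
    and "o_minimal_theory TYPE('m + ('a, 'b) oring_fm) L T"
    and "extends_RCF TYPE('m + ('a, 'b) oring_fm) L T"
    and "is_model L T M"
    and "T_derivation L M \<delta>"
  shows "\<exists>N. elementary_substructure L N M \<and> carrier N = constants M \<delta>"
proof -
  let ?M = "lift_struct M :: ('a, 'b, 'm + ('a, 'b) oring_fm) oring_struct"
  have M: "is_model L T ?M" by (rule is_model_lift_struct[OF assms(7)])
  have "o_minimal L ?M" using assms(5) M unfolding o_minimal_theory_def by blast
  then have "o_minimal L M" by (rule o_minimal_lift_struct)
  moreover have "holds_in M p" if "p \<in> ordered_field_axioms" for p
  proof -
    have "p \<in> RCF" using that by (simp add: RCF_def)
    \<comment> \<open>Entailment, too, speaks of structures over the larger type only, so the axiom
      is obtained for the copy and transported back.\<close>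
    then have "holds_in ?M p" using assms(6) M unfolding extends_RCF_def entails_def by blast
    then show ?thesis by (simp add: holds_in_lift_struct)
  qed
  moreover have "is_struct L M" using assms(7) by (simp add: is_model_def)
  ultimately interpret o_minimal_field L M
    using assms(1) by unfold_locales simp_all
  show ?thesis
    using constants_elementary_substructure[OF assms(8)]
    by (intro exI[of _ "M\<lparr>carrier := constants M \<delta>\<rparr>"]) simp
qed

end
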